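(* Let $T$ and, for every $\eta\in\mathrm{spt}\,\lambda_\varepsilon$, $T_\eta$ be maps of the interval $I$ as described in the context (two branches, Hölder potentials, horizontally close branches), and suppose that assumptions A1–A8 listed in the context are satisfied. Then the invariant measure $\mu_T$ of $T$ is strongly stochastically stable, i.e. the density $h_\varepsilon$ of the absolutely continuous stationary measure of the Markov chain with transition probability $\mathcal Q(x,A)=\lambda_\varepsilon\{\eta:T_\eta(x)\in A\}$ converges, as $\varepsilon\to0$, to the density $h$ of $\mu_T$ in $L^1(I,\mathrm{Lebesgue})$.
   Context: **Maps.** $I=[0,1]$. $\lambda_\varepsilon$ is a probability measure on $[-1,1]$ with $\mathrm{spt}\,\lambda_\varepsilon\subset(-\varepsilon,\varepsilon)$. $T:I\to I$ is a Lorenz-like cusp map: continuous, with one critical (cusp) point $x_0\in(0,1)$, $T(0)=T(1)=0$, $T(x_0)=1$, with two injective differentiable branches $T_1$ on $I_1$ (left of $x_0$, increasing) and $T_2$ on $I_2$ (right of $x_0$, decreasing), each onto, the derivative diverging at $x_0$. Each $T_\eta$ is a map of the same type with cusp $x_{0,\eta}$, branches $T_{i,\eta}$ on $I_{i,\eta}$, $i=1,2$, and an absolutely continuous invariant measure. Inverse branches are denoted $T_j^{-1},T_{j,\eta}^{-1}$. Throughout, $\upsilon(\varepsilon)$ denotes a generic function (possibly different at each occurrence) with $\upsilon(\varepsilon)\to0$ as $\varepsilon\to0$ and $\upsilon(\varepsilon)\le\varepsilon$. The following closeness is assumed: - the potentials $g=1/|T'|$, $g_\eta=1/|T'_\eta|$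 (defined off the critical points) satisfy $|g(x)-g(y)|\le C_h|x-y|^{\epsilon}$ and $|g_\eta(x)-g_\eta(y)|\le C_h|x-y|^{\epsilon}$ for $x,y$ in the same injectivity domain, with the same constant $C_h$ and exponent $\epsilon$ for all $\eta$; - horizontal closeness: for all $z\in I$, $j=1,2$: $|T_j^{-1}(z)-T_{j,\eta}^{-1}(z)|\le\upsilon(\varepsilon)$ and (for $z\ne1$) $|T'(T_j^{-1}(z))-T'_\eta(T_{j,\eta}^{-1}(z))|\le\upsilon(\varepsilon)$. **Function space.** For $0<\alpha\le1$ and fixed $\varepsilon_0>0$, $|h|_\alpha=\sup_{0<\varepsilon_1\le\varepsilon_0}\varepsilon_1^{-\alpha}\int\mathrm{osc}(h,B_{\varepsilon_1}(x))\,dx$, with $\mathrm{osc}(h,A)=\operatorname{ess\,sup}_Ah-\operatorname{ess\,inf}_Ah$. $\mathbb B=V_\alpha=\{h\in L^1(I):|h|_\alpha<\infty\}$ with norm $\|h\|_{\mathbb B}=|h|_\alpha+\|h\|_1$. **Operators.** $\mathcal L$, $\mathcal L_\eta$ are the transfer (Perron–Frobenius) operators of $T$, $T_\eta$ with respect to Lebesgue measure, and $\mathcal L_\varepsilon f=\int d\lambda_\varepsilon(\eta)\,\mathcal L_\eta f$. For a linear operator $L$ on $L^1$, $|||L|||=\sup_{\|f\|_{\mathbb B}\le1}\|Lf\|_1$. **Assumptions.** - A1: there are $0<\varkappa<1$, $D>0$ with $\|\mathcal Lf\|_{\mathbb B}\le\varkappa\|f\|_{\mathbb B}+D\|f\|_1$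 for all $f\in\mathbb B$. - A2: $T$ preserves only one absolutely continuous invariant probability measure $\mu_T$, with density $h$ (hence ergodic and mixing). - A3: $\mathcal L_\varepsilon$ satisfies the same inequality as in A1 with the same $\varkappa,D$. - A4: there is a measurable function $\upsilon'$ with values in $\mathbb R^+$, $\upsilon'(\varepsilon)\to0$ as $\varepsilon\to0$, such that $|||\mathcal L-\mathcal L_\varepsilon|||\le\upsilon'(\varepsilon)$. - A5: $\mathcal Q(x,A)=\int_A\mathfrak q_\varepsilon(x,y)\,dy$ for some density $\mathfrak q_\varepsilon$. - A6: $\mathrm{spt}\,\mathcal Q(x,\cdot)=B_\varepsilon(Tx)$ (ball of centre $Tx$ and radius $\varepsilon$) for every $x\in I$. - A7: for $\eta\in\mathrm{spt}\,\lambda_\varepsilon$ let $k_\eta=\inf\{k\in\mathbb N:x_{0,\eta}\in B_{k\eta}(x_0)\}$; there is a constant $C>0$ with $\sup_{\eta\in\mathrm{spt}\lambda_\varepsilon}\sup_{x\notin B_{k_\eta\eta}(x_0)}|T'_\eta(x)-T'(x)|\le C\upsilon(\varepsilon)$. - A8: for every $\eta\in\mathrm{spt}\,\lambda_\varepsilon$ and $i=1,2$, the graphs of $T_i$ and $T_{i,\eta}$ do not intersect except at $x=0,1$. *)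

theory Defs
  imports "HOL-Probability.Probability" "HOL-Probability.Essential_Supremum"
begin

abbreviation I :: "real set" where "I \<equiv> {0..1}"

abbreviation leb_I :: "real measure" where "leb_I \<equiv> restrict_space lborel I"


subsection \<open>Cusp maps\<close>

text \<open>The derivative is taken relative to \<open>I\<close>, hence one-sided at 0 and 1.\<close>

definition DI :: "(real \<Rightarrow> real) \<Rightarrow> real \<Rightarrow> real" where
  "DI T x = vector_derivative T (at x within I)"

text \<open>That the branches are onto follows from continuity. The cusp is the only critical point, so
  the derivative does not vanish elsewhere and the potential \<open>1 / \<bar>T'\<bar>\<close> is meaningful there.\<close>

definition cusp_map :: "(real \<Rightarrow> real) \<Rightarrow> real \<Rightarrow> bool" where
  "cusp_map T c \<longleftrightarrow>
     0 < c \<and> c < 1 \<and> continuous_on I T \<and> T ` I \<subseteq> I \<and> T 0 = 0 \<and> T 1 = 0 \<and> T c = 1 \<and>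
     strict_mono_on {0..<c} T \<and> strict_antimono_on {c<..1} T \<and>
     (\<forall>x\<in>I - {c}. T differentiable (at x within I) \<and> DI T x \<noteq> 0) \<and>
     filterlim (\<lambda>x. \<bar>DI T x\<bar>) at_top (at c within I)"

definition potential :: "(real \<Rightarrow> real) \<Rightarrow> real \<Rightarrow> real" where
  "potential T x = 1 / \<bar>DI T x\<bar>"

text \<open>Domains of the two branches without the cusp; the inverse branches also take the value \<open>c\<close>,
  at 1.\<close>

definition branch_dom :: "real \<Rightarrow> nat \<Rightarrow> real set" where
  "branch_dom c j = (if j = 1 then {0..<c} else {c<..1})"

definition inv_branch :: "(real \<Rightarrow> real) \<Rightarrow> real \<Rightarrow> nat \<Rightarrow> real \<Rightarrow> real" where
  "inv_branch T c j = inv_into (insert c (branch_dom c j)) T"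

definition holder_potential :: "(real \<Rightarrow> real) \<Rightarrow> real \<Rightarrow> real \<Rightarrow> real \<Rightarrow> bool" where
  "holder_potential T c Ch \<gamma> \<longleftrightarrow>
     (\<forall>j\<in>{1, 2}. \<forall>x\<in>branch_dom c j. \<forall>y\<in>branch_dom c j.
        \<bar>potential T x - potential T y\<bar> \<le> Ch * \<bar>x - y\<bar> powr \<gamma>)"

text \<open>The generic small functions: each occurrence gets its own function, defined for noise levels
  in \<open>{0<..e}\<close>.\<close>

definition small_fun :: "real \<Rightarrow> (real \<Rightarrow> real) \<Rightarrow> bool" where
  "small_fun e u \<longleftrightarrow> (u \<longlongrightarrow> 0) (at_right 0) \<and> (\<forall>\<epsilon>\<in>{0<..e}. u \<epsilon> \<le> \<epsilon>)"

definition horizontally_close ::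
  "(real \<Rightarrow> real) \<Rightarrow> real \<Rightarrow> (real \<Rightarrow> real) \<Rightarrow> real \<Rightarrow> real \<Rightarrow> real \<Rightarrow> bool" where
  "horizontally_close T c S d u v \<longleftrightarrow>
     (\<forall>j\<in>{1, 2}.
        (\<forall>z\<in>I. \<bar>inv_branch T c j z - inv_branch S d j z\<bar> \<le> u) \<and>
        (\<forall>z\<in>I - {1}. \<bar>DI T (inv_branch T c j z) - DI S (inv_branch S d j z)\<bar> \<le> v))"

text \<open>Ratio \<open>k\<^sub>\<eta>\<close> of cusp displacement to noise parameter, for open balls. For \<open>\<eta> = 0\<close> the set is
  empty, but only the radius \<open>k\<^sub>\<eta> * \<bar>\<eta>\<bar>\<close> is used below.\<close>

definition cusp_ratio :: "real \<Rightarrow> real \<Rightarrow> real \<Rightarrow> nat" where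
  "cusp_ratio c d \<eta> = Inf {k. d \<in> ball c (real k * \<bar>\<eta>\<bar>)}"


subsection \<open>The space of functions of bounded oscillation\<close>

text \<open>The essential infimum is written as \<open>- esssup (- f)\<close>. Functions live on \<open>I\<close>, so balls are
  intersected with \<open>I\<close>.\<close>

definition osc :: "(real \<Rightarrow> real) \<Rightarrow> real set \<Rightarrow> ennreal" where
  "osc f A = e2ennreal (esssup (restrict_space lborel A) (\<lambda>x. ereal (f x))
                        - (- esssup (restrict_space lborel A) (\<lambda>x. - ereal (f x))))"

definition V_seminorm :: "real \<Rightarrow> real \<Rightarrow> (real \<Rightarrow> real) \<Rightarrow> ennreal" where
  "V_seminorm \<epsilon>0 \<alpha> f =
     (SUP r\<in>{0<..\<epsilon>0}. ennreal (r powr (- \<alpha>)) * (\<integral>\<^sup>+ x. osc f (ball x r \<inter> I) \<partial>leb_I))"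

definition L1_norm :: "(real \<Rightarrow> real) \<Rightarrow> ennreal" where
  "L1_norm f = (\<integral>\<^sup>+ x. ennreal \<bar>f x\<bar> \<partial>leb_I)"

definition V_space :: "real \<Rightarrow> real \<Rightarrow> (real \<Rightarrow> real) set" where
  "V_space \<epsilon>0 \<alpha> = {f. integrable leb_I f \<and> V_seminorm \<epsilon>0 \<alpha> f < \<infinity>}"

definition V_norm :: "real \<Rightarrow> real \<Rightarrow> (real \<Rightarrow> real) \<Rightarrow> ennreal" where
  "V_norm \<epsilon>0 \<alpha> f = V_seminorm \<epsilon>0 \<alpha> f + L1_norm f"

definition mixed_norm ::
  "real \<Rightarrow> real \<Rightarrow> ((real \<Rightarrow> real) \<Rightarrow> real \<Rightarrow> real) \<Rightarrow> ennreal" where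
  "mixed_norm \<epsilon>0 \<alpha> A = (SUP f\<in>{f \<in> V_space \<epsilon>0 \<alpha>. V_norm \<epsilon>0 \<alpha> f \<le> 1}. L1_norm (A f))"


subsection \<open>Transfer operators\<close>

definition spt :: "real measure \<Rightarrow> real set" where
  "spt M = {y. \<forall>U. open U \<and> y \<in> U \<longrightarrow> 0 < emeasure M U}"

definition transfer :: "(real \<Rightarrow> real) \<Rightarrow> real \<Rightarrow> (real \<Rightarrow> real) \<Rightarrow> real \<Rightarrow> real" where
  "transfer T c f x =
     (\<Sum>j\<in>{1, 2}. f (inv_branch T c j x) * potential T (inv_branch T c j x))"

text \<open>Outside the support, a null set, the maps need not be cusp maps (nor the integrand measurable);
  hence the restriction of the domain of integration.\<close>

definition random_transfer ::
  "real measure \<Rightarrow> (real \<Rightarrow> real \<Rightarrow> real) \<Rightarrow> (real \<Rightarrow> real) \<Rightarrow> (real \<Rightarrow> real) \<Rightarrow> real \<Rightarrow> real" where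
  "random_transfer \<Lambda> S d f x = (LINT \<eta>:spt \<Lambda>|\<Lambda>. transfer (S \<eta>) (d \<eta>) f x)"

definition lasota_yorke ::
  "real \<Rightarrow> real \<Rightarrow> ((real \<Rightarrow> real) \<Rightarrow> real \<Rightarrow> real) \<Rightarrow> real \<Rightarrow> real \<Rightarrow> bool" where
  "lasota_yorke \<epsilon>0 \<alpha> A \<kappa> D \<longleftrightarrow>
     (\<forall>f\<in>V_space \<epsilon>0 \<alpha>.
        V_norm \<epsilon>0 \<alpha> (A f) \<le> ennreal \<kappa> * V_norm \<epsilon>0 \<alpha> f + ennreal D * L1_norm f)"


subsection \<open>Noise, invariant and stationary measures\<close>

definition noise :: "real measure \<Rightarrow> real \<Rightarrow> bool" where
  "noise \<Lambda> \<epsilon> \<longleftrightarrow>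
     prob_space \<Lambda> \<and> sets \<Lambda> = sets borel \<and> emeasure \<Lambda> {-1..1} = 1 \<and> spt \<Lambda> \<subseteq> {-\<epsilon><..<\<epsilon>}"

text \<open>The transition probability \<open>A \<mapsto> \<Lambda> {\<eta>. S \<eta> x \<in> A}\<close>.\<close>

definition transition :: "real measure \<Rightarrow> (real \<Rightarrow> real \<Rightarrow> real) \<Rightarrow> real \<Rightarrow> real measure" where
  "transition \<Lambda> S x = distr \<Lambda> borel (\<lambda>\<eta>. S \<eta> x)"

definition ac_prob :: "real measure \<Rightarrow> bool" where
  "ac_prob \<mu> \<longleftrightarrow> prob_space \<mu> \<and> sets \<mu> = sets leb_I \<and> absolutely_continuous leb_I \<mu>"

definition ac_invariant :: "(real \<Rightarrow> real) \<Rightarrow> real measure \<Rightarrow> bool" where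
  "ac_invariant T \<mu> \<longleftrightarrow> ac_prob \<mu> \<and> distr \<mu> leb_I T = \<mu>"

definition ac_stationary ::
  "real measure \<Rightarrow> (real \<Rightarrow> real \<Rightarrow> real) \<Rightarrow> real measure \<Rightarrow> bool" where
  "ac_stationary \<Lambda> S \<mu> \<longleftrightarrow>
     ac_prob \<mu> \<and>
     (\<forall>A\<in>sets leb_I. emeasure \<mu> A = (\<integral>\<^sup>+ x. emeasure (transition \<Lambda> S x) A \<partial>\<mu>))"

definition is_density :: "real measure \<Rightarrow> (real \<Rightarrow> real) \<Rightarrow> bool" where
  "is_density \<mu> h \<longleftrightarrow>
     h \<in> borel_measurable leb_I \<and> (AE x in leb_I. 0 \<le> h x) \<and>
     \<mu> = density leb_I (\<lambda>x. ennreal (h x))"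

text \<open>The first conjunct makes \<open>the\<close> stationary density well defined for small noise.\<close>

definition strongly_stochastically_stable ::
  "(real \<Rightarrow> real) \<Rightarrow> (real \<Rightarrow> real measure) \<Rightarrow> (real \<Rightarrow> real \<Rightarrow> real) \<Rightarrow> bool" where
  "strongly_stochastically_stable h \<Lambda> S \<longleftrightarrow>
     (\<forall>\<^sub>F \<epsilon> in at_right 0. \<exists>!\<mu>. ac_stationary (\<Lambda> \<epsilon>) S \<mu>) \<and>
     (\<forall>h\<^sub>\<epsilon>. (\<forall>\<^sub>F \<epsilon> in at_right 0. \<exists>\<mu>. ac_stationary (\<Lambda> \<epsilon>) S \<mu> \<and> is_density \<mu> (h\<^sub>\<epsilon> \<epsilon>)) \<longrightarrow>
          ((\<lambda>\<epsilon>. L1_norm (\<lambda>x. h\<^sub>\<epsilon> \<epsilon> x - h x)) \<longlongrightarrow> 0) (at_right 0))"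

end

theory Submission
  imports Defs "HOL-Complex_Analysis.Great_Picard"
begin

text \<open>The proof is a compactness argument for the averaged transfer operators \<open>L\<^sub>\<epsilon>\<close>, viewed as Markov
  operators on the integrable functions on \<open>I\<close>.

  Changing variables on each branch of \<open>S\<^sub>\<eta>\<close> and integrating over the noise shows that
  \<open>L\<^sub>\<epsilon>\<close> is dual to the transition probability (\<open>averaged_transfer_dual\<close>). Hence the densities of absolutely continuous
  stationary measures are exactly the probability densities fixed by \<open>L\<^sub>\<epsilon>\<close>, and a density fixed by the
  transfer operator \<open>L\<close> of \<open>T\<close> is the density of an invariant measure of \<open>T\<close>, so it equals \<open>h\<close>. The joint
  measurability in \<open>\<eta>\<close> and \<open>x\<close> that Fubini's theorem needs comes from monotonicity of the branches
  (for preimages) and from difference quotients (for derivatives).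

  By the Lasota-Yorke inequality, whose constants do not depend on \<open>\<epsilon>\<close>, each density fixed by \<open>L\<^sub>\<epsilon>\<close> is
  a limit in mean of functions with a common bound on their norms in \<open>V\<^sub>\<alpha>\<close> (\<open>fixed_density_approx\<close>), and sets bounded
  in \<open>V\<^sub>\<alpha>\<close> are relatively compact in mean (\<open>L1_precompact\<close>, \<open>L1_dist_block_average_le_V_norm\<close>). So fixed densities
  for \<open>\<epsilon> \<rightarrow> 0\<close> have limit points, and since \<open>L\<^sub>\<epsilon>\<close> is close to \<open>L\<close> from \<open>V\<^sub>\<alpha>\<close> to the integrable functions, each
  limit point is fixed by \<open>L\<close> and therefore equal to \<open>h\<close>. This gives convergence, uniformly over all
  densities fixed at a given noise level (\<open>fixed_densities_converge\<close>).

  Existence at a given noise level follows from the same compactness, applied to Cesaro means of the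
  iterates of the constant density (\<open>ex_fixed_density\<close>). Uniqueness for small noise follows from the uniform convergence:
  two distinct fixed densities would produce two fixed densities with disjoint supports, at distance
  \<open>2\<close> from each other, although both are at distance less than \<open>1\<close> from \<open>h\<close>
  (\<open>fixed_density_unique\<close>).\<close>

section \<open>The space of integrable functions\<close>

definition L1_dist :: "'a measure \<Rightarrow> ('a \<Rightarrow> real) \<Rightarrow> ('a \<Rightarrow> real) \<Rightarrow> real" where
  "L1_dist M f g = (\<integral>x. \<bar>f x - g x\<bar> \<partial>M)"

lemma L1_dist_nonneg [simp]: "0 \<le> L1_dist M f g"
  by (simp add: L1_dist_def)

lemma L1_dist_commute: "L1_dist M f g = L1_dist M g f"
  by (simp add: L1_dist_def abs_minus_commute)

lemma L1_dist_triangle: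
  assumes "integrable M f" "integrable M g" "integrable M h"
  shows "L1_dist M f h \<le> L1_dist M f g + L1_dist M g h"
proof -
  have "L1_dist M f h \<le> (\<integral>x. \<bar>f x - g x\<bar> + \<bar>g x - h x\<bar> \<partial>M)"
    unfolding L1_dist_def using assms by (intro integral_mono) auto
  then show ?thesis
    using assms by (simp add: L1_dist_def)
qed

lemma L1_dist_eq_0_iff:
  assumes "integrable M f" "integrable M g"
  shows "L1_dist M f g = 0 \<longleftrightarrow> (AE x in M. f x = g x)"
  unfolding L1_dist_def using assms
  by (subst integral_nonneg_eq_0_iff_AE) auto

lemma L1_dist_cong_AE:
  assumes "integrable M f" "integrable M f'" "integrable M g" "integrable M g'"
    "AE x in M. f x = f' x" "AE x in M. g x = g' x"
  shows "L1_dist M f g = L1_dist M f' g'"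
proof -
  have "AE x in M. \<bar>f x - g x\<bar> = \<bar>f' x - g' x\<bar>"
    using assms(5,6) by eventually_elim simp
  then show ?thesis
    unfolding L1_dist_def using assms(1-4) by (intro integral_cong_AE) auto
qed

lemma integral_diff_le_L1_dist:
  assumes "integrable M f" "integrable M g"
  shows "\<bar>integral\<^sup>L M f - integral\<^sup>L M g\<bar> \<le> L1_dist M f g"
proof -
  have "\<bar>\<integral>x. f x - g x \<partial>M\<bar> \<le> L1_dist M f g"
    unfolding L1_dist_def by (rule integral_abs_bound)
  then show ?thesis
    using assms by simp
qed

lemma L1_norm_dist_le:
  assumes "integrable M f" "integrable M g"
  shows "(\<integral>x. \<bar>f x\<bar> \<partial>M) \<le> (\<integral>x. \<bar>g x\<bar> \<partial>M) + L1_dist M f g"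
  using L1_dist_triangle[OF assms, of "\<lambda>_. 0"] by (simp add: L1_dist_def)

text \<open>A Cauchy sequence has an almost everywhere convergent subsequence; Fatou's lemma shows that its
  limit is the limit in mean of the whole sequence.\<close>

lemma L1_complete:
  fixes f :: "nat \<Rightarrow> 'a \<Rightarrow> real"
  assumes f: "\<And>n. integrable M (f n)"
    and cauchy: "\<And>e. 0 < e \<Longrightarrow> \<exists>N. \<forall>i\<ge>N. \<forall>j\<ge>N. L1_dist M (f i) (f j) < e"
  obtains g where "integrable M g" "(\<lambda>n. L1_dist M (f n) g) \<longlonglongrightarrow> 0"
proof -
  obtain r where r: "strict_mono r" "AE x in M. Cauchy (\<lambda>i. f (r i) x)"
    using cauchy_L1_AE_cauchy_subseq[of M f] f cauchy by (auto simp: L1_dist_def)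
  define g where "g x = lim (\<lambda>i. f (r i) x)" for x
  have [measurable]: "f n \<in> borel_measurable M" for n
    using f by auto
  have g_meas [measurable]: "g \<in> borel_measurable M"
    unfolding g_def by measurable
  have lim: "AE x in M. (\<lambda>i. f (r i) x) \<longlonglongrightarrow> g x"
    using r(2) by eventually_elim (simp add: g_def Cauchy_convergent_iff convergent_LIMSEQ_iff)
  \<comment> \<open>Fatou's lemma along the almost everywhere convergent subsequence.\<close>
  have fatou: "(\<integral>\<^sup>+x. ennreal \<bar>f i x - g x\<bar> \<partial>M) \<le> ennreal e"
    if i: "\<forall>j\<ge>N. L1_dist M (f i) (f j) < e" for i N e
  proof -
    have "(\<integral>\<^sup>+x. ennreal \<bar>f i x - g x\<bar> \<partial>M) = (\<integral>\<^sup>+x. liminf (\<lambda>j. ennreal \<bar>f i x - f (r j) x\<bar>) \<partial>M)"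
    proof (rule nn_integral_cong_AE)
      show "AE x in M. ennreal \<bar>f i x - g x\<bar> = liminf (\<lambda>j. ennreal \<bar>f i x - f (r j) x\<bar>)"
        using lim
      proof eventually_elim
        case (elim x)
        have "(\<lambda>j. ennreal \<bar>f i x - f (r j) x\<bar>) \<longlonglongrightarrow> ennreal \<bar>f i x - g x\<bar>"
          using elim by (intro tendsto_intros tendsto_ennrealI)
        from lim_imp_Liminf[OF trivial_limit_sequentially this] show ?case by simp
      qed
    qed
    also have "\<dots> \<le> liminf (\<lambda>j. \<integral>\<^sup>+x. ennreal \<bar>f i x - f (r j) x\<bar> \<partial>M)"
      by (rule nn_integral_liminf) auto
    also have "\<dots> \<le> ennreal e"
    proof -
      have "(\<integral>\<^sup>+x. ennreal \<bar>f i x - f (r j) x\<bar> \<partial>M) \<le> ennreal e" if "j \<ge> N" for j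
      proof -
        have "r j \<ge> N" using seq_suble[OF r(1), of j] that by simp
        then have "L1_dist M (f i) (f (r j)) \<le> e" using i by (simp add: less_imp_le)
        then show ?thesis using f
          by (subst nn_integral_eq_integral) (auto simp: L1_dist_def intro!: ennreal_leI)
      qed
      then have "\<forall>\<^sub>F j in sequentially. (\<integral>\<^sup>+x. ennreal \<bar>f i x - f (r j) x\<bar> \<partial>M) \<le> ennreal e"
        using eventually_sequentially by blast
      then have "limsup (\<lambda>j. \<integral>\<^sup>+x. ennreal \<bar>f i x - f (r j) x\<bar> \<partial>M) \<le> ennreal e"
        by (rule Limsup_bounded)
      then show ?thesis
        using Liminf_le_Limsup[OF trivial_limit_sequentially] order_trans by blast
    qed
    finally show ?thesis .
  qed
  obtain N0 where N0: "\<forall>i\<ge>N0. \<forall>j\<ge>N0. L1_dist M (f i) (f j) < 1"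
    using cauchy[of 1] by auto
  have "(\<integral>\<^sup>+x. ennreal \<bar>f N0 x - g x\<bar> \<partial>M) \<le> ennreal 1"
    using fatou[of N0 N0 1] N0 by simp
  then have diff: "integrable M (\<lambda>x. f N0 x - g x)"
    by (intro integrableI_bounded) (auto intro: le_less_trans[of _ 1])
  have g: "integrable M g"
    using Bochner_Integration.integrable_diff[OF f[of N0] diff] by simp
  have "(\<lambda>n. L1_dist M (f n) g) \<longlonglongrightarrow> 0"
  proof (rule LIMSEQ_I)
    fix e :: real assume "0 < e"
    then obtain N where N: "\<forall>i\<ge>N. \<forall>j\<ge>N. L1_dist M (f i) (f j) < e/2"
      using cauchy[of "e/2"] by auto
    have "L1_dist M (f i) g < e" if "i \<ge> N" for i
    proof -
      have "ennreal (L1_dist M (f i) g) \<le> ennreal (e/2)"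
      proof -
        have "ennreal (L1_dist M (f i) g) = (\<integral>\<^sup>+x. ennreal \<bar>f i x - g x\<bar> \<partial>M)"
          unfolding L1_dist_def using f g by (intro nn_integral_eq_integral[symmetric]) auto
        then show ?thesis using fatou[of N i "e/2"] N that by simp
      qed
      then show ?thesis using \<open>0 < e\<close> by simp
    qed
    then show "\<exists>no. \<forall>n\<ge>no. norm (L1_dist M (f n) g - 0) < e"
      by (intro exI[of _ N]) simp
  qed
  then show ?thesis using g that by blast
qed

lemma L1_limit_density:
  assumes f: "\<And>n. integrable M (f n)" "\<And>n. AE x in M. 0 \<le> f n x" "\<And>n. integral\<^sup>L M (f n) = 1"
    and g: "integrable M g" and lim: "(\<lambda>n. L1_dist M (f n) g) \<longlonglongrightarrow> 0"
  shows "AE x in M. 0 \<le> g x" and "integral\<^sup>L M g = 1"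
proof -
  obtain r where r: "AE x in M. (\<lambda>n. f (r n) x - g x) \<longlonglongrightarrow> 0"
    using tendsto_L1_AE_subseq[of M "\<lambda>n x. f n x - g x"] f(1) g lim by (auto simp: L1_dist_def)
  have "AE x in M. \<forall>n. 0 \<le> f n x"
    using f(2) by (simp add: AE_all_countable)
  with r show "AE x in M. 0 \<le> g x"
  proof eventually_elim
    case (elim x)
    from tendsto_add[OF elim(1) tendsto_const[of "g x"]] have "(\<lambda>n. f (r n) x) \<longlonglongrightarrow> g x" by simp
    then show ?case using elim(2) by (intro LIMSEQ_le_const) auto
  qed
  have "\<bar>1 - integral\<^sup>L M g\<bar> \<le> 0"
  proof (rule LIMSEQ_le_const[OF lim], intro exI allI impI)
    fix n show "\<bar>1 - integral\<^sup>L M g\<bar> \<le> L1_dist M (f n) g"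
      using integral_diff_le_L1_dist[OF f(1)[of n] g] f(3)[of n] by simp
  qed
  then show "integral\<^sup>L M g = 1" by simp
qed

section \<open>Markov operators and fixed densities\<close>

text \<open>Only almost everywhere linearity is required: a Bochner integral over the noise parameter is
  additive only at the points where both integrands are integrable. Positivity follows from the
  last two conditions (\<open>P_nonneg\<close> below).\<close>

locale markov_operator =
  fixes M :: "'a measure" and P :: "('a \<Rightarrow> real) \<Rightarrow> 'a \<Rightarrow> real"
  assumes P_integrable: "integrable M f \<Longrightarrow> integrable M (P f)"
    and P_linear: "integrable M f \<Longrightarrow> integrable M g \<Longrightarrow>
      AE x in M. P (\<lambda>x. a * f x + b * g x) x = a * P f x + b * P g x"
    and P_contraction: "integrable M f \<Longrightarrow> (\<integral>x. \<bar>P f x\<bar> \<partial>M) \<le> (\<integral>x. \<bar>f x\<bar> \<partial>M)"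
    and P_integral: "integrable M f \<Longrightarrow> integral\<^sup>L M (P f) = integral\<^sup>L M f"
begin

definition fixed_density :: "('a \<Rightarrow> real) \<Rightarrow> bool" where
  "fixed_density g \<longleftrightarrow> integrable M g \<and> (AE x in M. 0 \<le> g x) \<and> integral\<^sup>L M g = 1 \<and>
     (AE x in M. P g x = g x)"

lemma P_diff:
  assumes "integrable M f" "integrable M g"
  shows "AE x in M. P (\<lambda>x. f x - g x) x = P f x - P g x"
  using P_linear[OF assms, of 1 "-1"] by simp

lemma P_dist:
  assumes f: "integrable M f" and g: "integrable M g"
  shows "L1_dist M (P f) (P g) \<le> L1_dist M f g"
proof -
  have "L1_dist M (P f) (P g) = (\<integral>x. \<bar>P (\<lambda>x. f x - g x) x\<bar> \<partial>M)"
    unfolding L1_dist_def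
  proof (rule integral_cong_AE)
    show "AE x in M. \<bar>P f x - P g x\<bar> = \<bar>P (\<lambda>x. f x - g x) x\<bar>"
      using P_diff[OF f g] by eventually_elim simp
  qed (use f g P_integrable[OF f] P_integrable[OF g] P_integrable[of "\<lambda>x. f x - g x"] in auto)
  also have "\<dots> \<le> L1_dist M f g"
    unfolding L1_dist_def using f g by (intro P_contraction) auto
  finally show ?thesis .
qed

text \<open>A contraction that preserves integrals cannot create negative mass:
  \<open>\<integral> (\<bar>P f\<bar> - P f) \<le> \<integral> (\<bar>f\<bar> - f) = 0\<close>.\<close>

lemma P_nonneg:
  assumes f: "integrable M f" and nonneg: "AE x in M. 0 \<le> f x"
  shows "AE x in M. 0 \<le> P f x"
proof -
  have int: "integrable M (P f)" by (rule P_integrable[OF f])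
  have "(\<integral>x. \<bar>f x\<bar> \<partial>M) = integral\<^sup>L M f"
    using f nonneg by (intro integral_cong_AE) (auto elim: eventually_mono)
  then have "(\<integral>x. \<bar>P f x\<bar> - P f x \<partial>M) \<le> 0"
    using P_contraction[OF f] P_integral[OF f] int by simp
  moreover have "0 \<le> (\<integral>x. \<bar>P f x\<bar> - P f x \<partial>M)" by simp
  ultimately have "(\<integral>x. \<bar>P f x\<bar> - P f x \<partial>M) = 0" by linarith
  then have "AE x in M. \<bar>P f x\<bar> - P f x = 0"
    using int by (subst (asm) integral_nonneg_eq_0_iff_AE) auto
  then show ?thesis by eventually_elim simp
qed

text \<open>\<open>P f\<^sup>+\<close> dominates both \<open>0\<close> and \<open>P f = f\<close>, hence \<open>f\<^sup>+\<close>, and has the same integral as \<open>f\<^sup>+\<close>.\<close>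

lemma pos_part_fixed:
  assumes f: "integrable M f" and fixed: "AE x in M. P f x = f x"
  shows "AE x in M. P (\<lambda>x. max 0 (f x)) x = max 0 (f x)"
proof -
  let ?p = "\<lambda>x. max 0 (f x)"
  let ?n = "\<lambda>x. max 0 (f x) - f x"
  have p: "integrable M ?p" using f by (intro integrable_max) auto
  have n: "integrable M ?n" using f p by auto
  have "AE x in M. 0 \<le> P ?p x" by (rule P_nonneg[OF p]) auto
  moreover have "AE x in M. 0 \<le> P ?n x" by (rule P_nonneg[OF n]) auto
  ultimately have ge: "AE x in M. ?p x \<le> P ?p x"
    using P_diff[OF p f] fixed by eventually_elim auto
  have "(\<integral>x. P ?p x - ?p x \<partial>M) = 0"
    using P_integral[OF p] P_integrable[OF p] p by simp
  then have "AE x in M. P ?p x - ?p x = 0"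
    using P_integrable[OF p] p ge
    by (subst (asm) integral_nonneg_eq_0_iff_AE) (auto elim: eventually_mono)
  then show ?thesis by eventually_elim simp
qed

lemma fixed_density_scaled:
  assumes f: "integrable M f" and fixed: "AE x in M. P f x = f x"
    and nonneg: "AE x in M. 0 \<le> f x" and m: "integral\<^sup>L M f = m" "0 < m"
  shows "fixed_density (\<lambda>x. f x / m)"
proof -
  have "AE x in M. P (\<lambda>x. f x / m) x = f x / m"
    using P_linear[OF f f, of "1/m" 0] fixed by eventually_elim simp
  moreover have "AE x in M. 0 \<le> f x / m"
    using nonneg by eventually_elim (use m in simp)
  ultimately show ?thesis
    unfolding fixed_density_def using f m by auto
qed

text \<open>The normalised positive and negative parts of the difference of two distinct fixed densities
  are fixed densities with disjoint supports, hence at distance \<open>2\<close>. So fixed densities that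
  all lie at distance less than \<open>1\<close> from one function coincide.\<close>

lemma fixed_density_unique:
  assumes near: "\<And>g. fixed_density g \<Longrightarrow> L1_dist M g h < 1" and h: "integrable M h"
    and g: "fixed_density g1" "fixed_density g2"
  shows "AE x in M. g1 x = g2 x"
proof (rule ccontr)
  assume neq: "\<not> (AE x in M. g1 x = g2 x)"
  define f where "f x = g1 x - g2 x" for x
  define m where "m = (\<integral>x. max 0 (f x) \<partial>M)"
  let ?p = "\<lambda>x. max 0 (f x)"
  let ?q = "\<lambda>x. max 0 (- f x)"
  have gi: "integrable M g1" "integrable M g2" using g by (auto simp: fixed_density_def)
  then have f: "integrable M f" and f': "integrable M (\<lambda>x. - f x)" by (auto simp: f_def[abs_def])
  have p: "integrable M ?p" using f by (intro integrable_max) auto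
  have q: "integrable M ?q" using f by (intro integrable_max) auto
  have int_f: "integral\<^sup>L M f = 0" using g gi by (simp add: f_def[abs_def] fixed_density_def)
  have "(\<integral>x. ?p x - ?q x \<partial>M) = integral\<^sup>L M f"
    by (intro Bochner_Integration.integral_cong) auto
  then have int_q: "integral\<^sup>L M ?q = m" using int_f p q by (simp add: m_def)
  have abs: "(\<integral>x. \<bar>f x\<bar> \<partial>M) = 2 * m"
  proof -
    have "(\<integral>x. \<bar>f x\<bar> \<partial>M) = (\<integral>x. ?p x + ?q x \<partial>M)"
      by (intro Bochner_Integration.integral_cong) auto
    then show ?thesis using p q int_q by (simp add: m_def)
  qed
  have "L1_dist M g1 g2 \<noteq> 0"
    using neq L1_dist_eq_0_iff[OF gi] by simp
  then have "0 < m"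
    using abs L1_dist_nonneg[of M g1 g2] by (simp add: L1_dist_def f_def)
  have "AE x in M. P g1 x = g1 x" "AE x in M. P g2 x = g2 x"
    using g by (auto simp: fixed_density_def)
  then have fixed: "AE x in M. P f x = f x"
    using P_diff[OF gi] unfolding f_def by eventually_elim simp
  have fixed': "AE x in M. P (\<lambda>x. - f x) x = - f x"
    using P_linear[OF f f, of "-1" 0] fixed by eventually_elim simp
  have pd: "fixed_density (\<lambda>x. ?p x / m)"
    by (rule fixed_density_scaled[OF p pos_part_fixed[OF f fixed]]) (use \<open>0 < m\<close> m_def in auto)
  have qd: "fixed_density (\<lambda>x. ?q x / m)"
    by (rule fixed_density_scaled[OF q pos_part_fixed[OF f' fixed']]) (use \<open>0 < m\<close> int_q in auto)
  have "L1_dist M (\<lambda>x. ?p x / m) (\<lambda>x. ?q x / m) = (\<integral>x. \<bar>f x\<bar> / m \<partial>M)"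
    unfolding L1_dist_def
    by (intro Bochner_Integration.integral_cong) (use \<open>0 < m\<close> in \<open>auto simp: max_def abs_if field_simps\<close>)
  also have "\<dots> = 2" using abs \<open>0 < m\<close> by simp
  finally show False
    using near[OF pd] near[OF qd] L1_dist_triangle[of M "\<lambda>x. ?p x / m" h "\<lambda>x. ?q x / m"] p q h
    by (simp add: L1_dist_commute[of M h])
qed

lemma iterate_integrable: "integrable M f \<Longrightarrow> integrable M ((P ^^ n) f)"
  by (induction n) (auto intro: P_integrable)

lemma iterate_contraction:
  "integrable M f \<Longrightarrow> (\<integral>x. \<bar>(P ^^ n) f x\<bar> \<partial>M) \<le> (\<integral>x. \<bar>f x\<bar> \<partial>M)"
  by (induction n) (auto intro: order_trans[OF P_contraction] iterate_integrable)

lemma iterate_dist_fixed: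
  assumes f: "integrable M f" and g: "fixed_density g"
  shows "L1_dist M ((P ^^ n) f) g \<le> L1_dist M f g"
proof (induction n)
  case (Suc n)
  have gi: "integrable M g" "AE x in M. P g x = g x" using g by (auto simp: fixed_density_def)
  have fi: "integrable M ((P ^^ n) f)" by (rule iterate_integrable[OF f])
  have "L1_dist M ((P ^^ Suc n) f) g = L1_dist M (P ((P ^^ n) f)) (P g)"
    using gi fi by (intro L1_dist_cong_AE) (auto intro: P_integrable elim: eventually_mono)
  also have "\<dots> \<le> L1_dist M ((P ^^ n) f) g" by (rule P_dist[OF fi gi(1)])
  finally show ?case using Suc by simp
qed simp

lemma iterate_density:
  assumes f: "integrable M f" "AE x in M. 0 \<le> f x" "integral\<^sup>L M f = 1"
  shows "AE x in M. 0 \<le> (P ^^ n) f x" "integral\<^sup>L M ((P ^^ n) f) = 1"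
proof -
  show "AE x in M. 0 \<le> (P ^^ n) f x"
  proof (induction n)
    case (Suc n)
    from P_nonneg[OF iterate_integrable[OF f(1)] Suc] show ?case by simp
  qed (use f in simp)
  show "integral\<^sup>L M ((P ^^ n) f) = 1"
    by (induction n) (use f in \<open>auto simp: P_integral iterate_integrable\<close>)
qed

definition cesaro :: "nat \<Rightarrow> ('a \<Rightarrow> real) \<Rightarrow> 'a \<Rightarrow> real" where
  "cesaro n f x = (\<Sum>k<Suc n. (P ^^ k) f x) / real (Suc n)"

lemma P_sum:
  fixes f :: "nat \<Rightarrow> 'a \<Rightarrow> real"
  assumes f: "\<And>k. integrable M (f k)"
  shows "AE x in M. P (\<lambda>x. \<Sum>k<n. f k x) x = (\<Sum>k<n. P (f k) x)"
proof (induction n)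
  case 0
  have "AE x in M. P (\<lambda>_. 0 * 0 + 0 * 0) x = 0 * P (\<lambda>_. 0) x + 0 * P (\<lambda>_. 0) x"
    by (rule P_linear) auto
  then show ?case by simp
next
  case (Suc n)
  have "integrable M (\<lambda>x. \<Sum>k<n. f k x)" using f by auto
  from P_linear[OF this f[of n], of 1 1]
  have "AE x in M. P (\<lambda>x. \<Sum>k<Suc n. f k x) x = P (\<lambda>x. \<Sum>k<n. f k x) x + P (f n) x" by simp
  with Suc show ?case by eventually_elim simp
qed

lemma cesaro_integrable: "integrable M f \<Longrightarrow> integrable M (cesaro n f)"
  unfolding cesaro_def[abs_def]
  by (intro integrable_divide Bochner_Integration.integrable_sum iterate_integrable)

lemma cesaro_density:
  assumes f: "integrable M f" "AE x in M. 0 \<le> f x" "integral\<^sup>L M f = 1"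
  shows "AE x in M. 0 \<le> cesaro n f x" "integral\<^sup>L M (cesaro n f) = 1"
proof -
  have "AE x in M. \<forall>k. 0 \<le> (P ^^ k) f x"
    using iterate_density(1)[OF f] by (simp add: AE_all_countable)
  then show "AE x in M. 0 \<le> cesaro n f x"
    by eventually_elim (auto simp: cesaro_def intro!: divide_nonneg_nonneg sum_nonneg simp del: sum.lessThan_Suc)
  have "integral\<^sup>L M (cesaro n f) = (\<Sum>k<Suc n. integral\<^sup>L M ((P ^^ k) f)) / real (Suc n)"
    unfolding cesaro_def[abs_def] integral_divide_zero
    by (subst Bochner_Integration.integral_sum) (auto intro: iterate_integrable f)
  also have "\<dots> = 1"
    by (subst sum.cong[OF refl iterate_density(2)[OF f]]) auto
  finally show "integral\<^sup>L M (cesaro n f) = 1" .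
qed

text \<open>\<open>P\<close> shifts the sum of iterates by one, so only the first and the last term survive.\<close>

lemma cesaro_almost_fixed:
  assumes f: "integrable M f"
  shows "L1_dist M (P (cesaro n f)) (cesaro n f) \<le> 2 * (\<integral>x. \<bar>f x\<bar> \<partial>M) / real (Suc n)"
proof -
  let ?s = "\<lambda>x. \<Sum>k<Suc n. (P ^^ k) f x"
  have s: "integrable M ?s" by (intro Bochner_Integration.integrable_sum iterate_integrable f)
  have "AE x in M. P (\<lambda>x. (1 / real (Suc n)) * ?s x + 0 * ?s x) x
      = (1 / real (Suc n)) * P ?s x + 0 * P ?s x"
    by (rule P_linear[OF s s])
  moreover have "(\<lambda>x. (1 / real (Suc n)) * ?s x + 0 * ?s x) = cesaro n f"
    by (auto simp: cesaro_def)
  ultimately have "AE x in M. P (cesaro n f) x = (1 / real (Suc n)) * P ?s x" by simp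
  moreover have "AE x in M. P ?s x = (\<Sum>k<Suc n. P ((P ^^ k) f) x)"
    by (rule P_sum[OF iterate_integrable[OF f]])
  ultimately have eq: "AE x in M. \<bar>P (cesaro n f) x - cesaro n f x\<bar> = \<bar>(P ^^ Suc n) f x - f x\<bar> / real (Suc n)"
  proof eventually_elim
    case (elim x)
    have "(\<Sum>k<Suc n. P ((P ^^ k) f) x) - (\<Sum>k<Suc n. (P ^^ k) f x) = (P ^^ Suc n) f x - f x"
      unfolding sum_subtractf[symmetric]
      using sum_lessThan_telescope[of "\<lambda>k. (P ^^ k) f x" "Suc n"] by simp
    then have "P (cesaro n f) x - cesaro n f x = ((P ^^ Suc n) f x - f x) / real (Suc n)"
      unfolding elim cesaro_def
      by (simp only: times_divide_eq_left mult_1 diff_divide_distrib[symmetric])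
    then show ?case by simp
  qed
  have i: "integrable M ((P ^^ Suc n) f)" by (rule iterate_integrable[OF f])
  have "L1_dist M (P (cesaro n f)) (cesaro n f) = (\<integral>x. \<bar>(P ^^ Suc n) f x - f x\<bar> / real (Suc n) \<partial>M)"
    unfolding L1_dist_def
    using eq i f cesaro_integrable[OF f, of n] P_integrable[OF cesaro_integrable[OF f, of n]]
    by (intro integral_cong_AE) (auto simp del: funpow.simps)
  also have "\<dots> \<le> (\<integral>x. (\<bar>(P ^^ Suc n) f x\<bar> + \<bar>f x\<bar>) / real (Suc n) \<partial>M)"
    using i f by (intro integral_mono) (auto simp del: funpow.simps intro!: divide_right_mono)
  also have "\<dots> = ((\<integral>x. \<bar>(P ^^ Suc n) f x\<bar> \<partial>M) + (\<integral>x. \<bar>f x\<bar> \<partial>M)) / real (Suc n)"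
    using i f by (simp del: funpow.simps)
  also have "\<dots> \<le> (2 * (\<integral>x. \<bar>f x\<bar> \<partial>M)) / real (Suc n)"
    using iterate_contraction[OF f, of "Suc n"] by (intro divide_right_mono) auto
  finally show ?thesis .
qed

text \<open>The defect \<open>\<parallel>P f - f\<parallel>\<close> is continuous in \<open>f\<close> because \<open>P\<close> is a contraction.\<close>

lemma almost_fixed_limit:
  assumes f: "\<And>n. integrable M (f n)" "\<And>n. AE x in M. 0 \<le> f n x" "\<And>n. integral\<^sup>L M (f n) = 1"
    and g: "integrable M g" and lim: "(\<lambda>n. L1_dist M (f n) g) \<longlonglongrightarrow> 0"
    and fixed: "(\<lambda>n. L1_dist M (P (f n)) (f n)) \<longlonglongrightarrow> 0"
  shows "fixed_density g"
proof -
  have "L1_dist M (P g) g \<le> 0"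
  proof (rule LIMSEQ_le_const)
    show "(\<lambda>n. 2 * L1_dist M (f n) g + L1_dist M (P (f n)) (f n)) \<longlonglongrightarrow> 0"
      using tendsto_add[OF tendsto_mult_left[OF lim, of 2] fixed] by simp
    show "\<exists>N. \<forall>n\<ge>N. L1_dist M (P g) g \<le> 2 * L1_dist M (f n) g + L1_dist M (P (f n)) (f n)"
    proof (intro exI allI impI)
      fix n
      note i = P_integrable[OF g] P_integrable[OF f(1)[of n]] f(1)[of n] g
      show "L1_dist M (P g) g \<le> 2 * L1_dist M (f n) g + L1_dist M (P (f n)) (f n)"
        using L1_dist_triangle[OF i(1,2,4)] L1_dist_triangle[OF i(2,3,4)] P_dist[OF i(4,3)]
        by (simp add: L1_dist_commute[of M g])
    qed
  qed
  then have "L1_dist M (P g) g = 0"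
    using L1_dist_nonneg[of M "P g" g] by linarith
  then have "AE x in M. P g x = g x"
    using L1_dist_eq_0_iff[OF P_integrable[OF g] g] by simp
  then show ?thesis
    using g L1_limit_density[OF f g lim] by (simp add: fixed_density_def)
qed

end

section \<open>Compactness through block averages\<close>

lemma prob_space_leb_I: "prob_space leb_I"
  by (intro prob_spaceI) (simp add: emeasure_restrict_space space_restrict_space)

interpretation leb_I: prob_space leb_I
  by (rule prob_space_leb_I)

lemma space_leb_I [simp]: "space leb_I = I"
  by (simp add: space_restrict_space)

lemma sets_leb_I: "A \<in> sets leb_I \<longleftrightarrow> A \<in> sets borel \<and> A \<subseteq> I"
  by (subst sets_restrict_space_iff) auto

lemma AE_leb_I_neq: "AE x in leb_I. x \<noteq> a"
proof -
  have "AE x in lborel. x \<noteq> a" by (rule AE_lborel_singleton)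
  then show ?thesis by (auto simp: AE_restrict_space_iff elim!: eventually_mono)
qed

lemma L1_norm_eq: "integrable leb_I f \<Longrightarrow> L1_norm f = ennreal (\<integral>x. \<bar>f x\<bar> \<partial>leb_I)"
  unfolding L1_norm_def by (intro nn_integral_eq_integral) auto

definition block :: "nat \<Rightarrow> nat \<Rightarrow> real set" where
  "block n i = {real i / real n ..< (real i + 1) / real n}"

definition block_mass :: "nat \<Rightarrow> (real \<Rightarrow> real) \<Rightarrow> nat \<Rightarrow> real" where
  "block_mass n f i = (\<integral>y. indicator (block n i) y * f y \<partial>leb_I)"

definition block_average :: "nat \<Rightarrow> (real \<Rightarrow> real) \<Rightarrow> real \<Rightarrow> real" where
  "block_average n f x = (\<Sum>i<n. indicator (block n i) x * (real n * block_mass n f i))"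

lemma block_subset: "i < n \<Longrightarrow> block n i \<subseteq> I"
proof
  fix x assume i: "i < n" and "x \<in> block n i"
  then have x: "real i / real n \<le> x" "x < (real i + 1) / real n" by (auto simp: block_def)
  have "0 \<le> real i / real n" "(real i + 1) / real n \<le> 1" using i by auto
  then have "0 \<le> x" "x \<le> 1" using x by linarith+
  then show "x \<in> I" by simp
qed

lemma block_sets [measurable]: "i < n \<Longrightarrow> block n i \<in> sets leb_I"
  using block_subset by (auto simp: sets_leb_I block_def)

lemma measure_block: "i < n \<Longrightarrow> measure leb_I (block n i) = 1 / real n"
  using block_subset[of i n]
  by (subst measure_restrict_space) (auto simp: block_def field_simps measure_lborel_Ico)

text \<open>The floor function names the unique block of a point, which settles disjointness and covering at once.\<close>

lemma block_unique: "x \<in> block n i \<longleftrightarrow> 0 < n \<and> int i = \<lfloor>x * real n\<rfloor>"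
proof (cases "n = 0")
  case False
  then have "x \<in> block n i \<longleftrightarrow> real i \<le> x * real n \<and> x * real n < real i + 1"
    by (auto simp: block_def field_simps)
  also have "\<dots> \<longleftrightarrow> int i = \<lfloor>x * real n\<rfloor>"
    by (metis floor_eq_iff of_int_of_nat_eq)
  finally show ?thesis using False by simp
qed (simp add: block_def)

lemma ex_block: "0 < n \<Longrightarrow> 0 \<le> x \<Longrightarrow> x < 1 \<Longrightarrow> \<exists>i<n. x \<in> block n i"
proof -
  assume x: "0 < n" "0 \<le> x" "x < 1"
  have "0 \<le> \<lfloor>x * real n\<rfloor>" using x by simp
  moreover have "\<lfloor>x * real n\<rfloor> < int n" using x by (simp add: floor_less_iff)
  ultimately show ?thesis
    using x by (intro exI[of _ "nat \<lfloor>x * real n\<rfloor>"]) (auto simp: block_unique)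
qed

lemma block_average_eq:
  assumes "i < n" "x \<in> block n i"
  shows "block_average n f x = real n * block_mass n f i"
proof -
  have "block_average n f x = (\<Sum>j<n. if j = i then real n * block_mass n f i else 0)"
    unfolding block_average_def using assms(2)
    by (intro sum.cong) (auto simp: block_unique indicator_def)
  then show ?thesis using assms(1) by simp
qed

lemma block_average_integrable [simp]: "integrable leb_I (block_average n f)"
  unfolding block_average_def[abs_def]
  by (intro Bochner_Integration.integrable_sum integrable_mult_left)
     (auto intro!: leb_I.integrable_const_bound[of _ 1] simp: indicator_def)

lemma
  fixes c :: real
  assumes i: "i < n"
  shows block_step_integrable: "integrable leb_I (\<lambda>x. indicator (block n i) x * c)"
    and block_step_integral: "(\<integral>x. indicator (block n i) x * c \<partial>leb_I) = c / real n"
proof -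
  show "integrable leb_I (\<lambda>x. indicator (block n i) x * c)"
    using i by (intro integrable_mult_left) (auto intro!: leb_I.integrable_const_bound[of _ 1] simp: indicator_def)
  have "(\<integral>x. indicator (block n i) x \<partial>leb_I) = measure leb_I (block n i \<inter> space leb_I)"
    by (rule Bochner_Integration.integral_indicator)
  also have "\<dots> = 1 / real n"
    using block_subset[OF i] measure_block[OF i] by (simp add: Int_absorb2)
  finally show "(\<integral>x. indicator (block n i) x * c \<partial>leb_I) = c / real n"
    by (simp add: mult.commute[of _ c])
qed

lemma indicator_block_integrable:
  fixes f :: "real \<Rightarrow> real"
  shows "integrable leb_I f \<Longrightarrow> i < n \<Longrightarrow> integrable leb_I (\<lambda>y. indicator (block n i) y * f y)"
  using integrable_mult_indicator[OF block_sets, of i n f] by simp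

lemma block_mass_bound:
  assumes "integrable leb_I f"
  shows "\<bar>block_mass n f i\<bar> \<le> (\<integral>x. \<bar>f x\<bar> \<partial>leb_I)"
proof -
  have "\<bar>block_mass n f i\<bar> \<le> (\<integral>y. \<bar>indicator (block n i) y * f y\<bar> \<partial>leb_I)"
    unfolding block_mass_def by (rule integral_abs_bound)
  also have "\<dots> \<le> (\<integral>x. \<bar>f x\<bar> \<partial>leb_I)"
    using assms by (intro integral_mono') (auto simp: indicator_def)
  finally show ?thesis .
qed

lemma block_average_dist:
  "L1_dist leb_I (block_average n f) (block_average n g)
    \<le> (\<Sum>i<n. \<bar>block_mass n f i - block_mass n g i\<bar>)"
proof -
  have "L1_dist leb_I (block_average n f) (block_average n g)
      \<le> (\<integral>x. (\<Sum>i<n. indicator (block n i) x * (real n * \<bar>block_mass n f i - block_mass n g i\<bar>)) \<partial>leb_I)"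
    unfolding L1_dist_def
  proof (rule integral_mono)
    fix x
    have "block_average n f x - block_average n g x
        = (\<Sum>i<n. indicator (block n i) x * (real n * (block_mass n f i - block_mass n g i)))"
      unfolding block_average_def by (simp add: sum_subtractf[symmetric] algebra_simps)
    also have "\<bar>\<dots>\<bar> \<le> (\<Sum>i<n. \<bar>indicator (block n i) x * (real n * (block_mass n f i - block_mass n g i))\<bar>)"
      by (rule sum_abs)
    also have "\<dots> = (\<Sum>i<n. indicator (block n i) x * (real n * \<bar>block_mass n f i - block_mass n g i\<bar>))"
      by (simp add: abs_mult)
    finally show "\<bar>block_average n f x - block_average n g x\<bar>
        \<le> (\<Sum>i<n. indicator (block n i) x * (real n * \<bar>block_mass n f i - block_mass n g i\<bar>))" .
  next
    show "integrable leb_I (\<lambda>x. \<Sum>i<n. indicator (block n i) x * (real n * \<bar>block_mass n f i - block_mass n g i\<bar>))"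
      by (intro Bochner_Integration.integrable_sum block_step_integrable) simp
  qed simp
  also have "\<dots> = (\<Sum>i<n. \<integral>x. indicator (block n i) x * (real n * \<bar>block_mass n f i - block_mass n g i\<bar>) \<partial>leb_I)"
    by (rule Bochner_Integration.integral_sum, rule block_step_integrable) simp
  also have "\<dots> = (\<Sum>i<n. \<bar>block_mass n f i - block_mass n g i\<bar>)"
    by (rule sum.cong[OF refl], subst block_step_integral) auto
  finally show ?thesis .
qed

text \<open>A bounded set is relatively compact in mean as soon as averaging over blocks of length \<open>1 / n\<close>
  approximates all its members uniformly. A diagonal argument makes every block mass converge
  along one subsequence; the averages are then Cauchy for each \<open>n\<close>, and hence so are the functions.\<close>

lemma L1_precompact:
  fixes f :: "nat \<Rightarrow> real \<Rightarrow> real" and \<rho> :: "nat \<Rightarrow> real"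
  assumes f: "\<And>m. integrable leb_I (f m)" and bound: "\<And>m. (\<integral>x. \<bar>f m x\<bar> \<partial>leb_I) \<le> B"
    and approx: "\<And>m n. n0 \<le> n \<Longrightarrow> L1_dist leb_I (f m) (block_average n (f m)) \<le> \<rho> n"
    and \<rho>: "\<rho> \<longlonglongrightarrow> 0"
  obtains r g where "strict_mono (r :: nat \<Rightarrow> nat)" "integrable leb_I g"
    "(\<lambda>m. L1_dist leb_I (f (r m)) g) \<longlonglongrightarrow> 0"
proof -
  have mass_le: "norm (block_mass (fst p) (f m) (snd p)) \<le> B" for m and p :: "nat \<times> nat"
    using block_mass_bound[OF f, of "fst p" m "snd p"] bound[of m] by simp
  obtain r :: "nat \<Rightarrow> nat" where r: "strict_mono r"
    and conv: "\<And>p. p \<in> UNIV \<Longrightarrow> \<exists>l. (\<lambda>m. block_mass (fst p) (f (r m)) (snd p)) \<longlonglongrightarrow> l"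
    by (rule function_convergent_subsequence[of "UNIV :: (nat \<times> nat) set"
          "\<lambda>m p. block_mass (fst p) (f m) (snd p)" B])
       (use mass_le in auto)
  have "\<exists>N. \<forall>i\<ge>N. \<forall>j\<ge>N. L1_dist leb_I (f (r i)) (f (r j)) < e" if "0 < e" for e
  proof -
    have "\<forall>\<^sub>F n in sequentially. \<rho> n < e / 4 \<and> n0 \<le> n"
      using order_tendstoD(2)[OF \<rho>, of "e / 4"] that
      by (intro eventually_conj eventually_ge_at_top) auto
    then obtain n where n: "n0 \<le> n" "\<rho> n < e / 4"
      using eventually_happens'[OF sequentially_bot] by blast
    have "\<forall>i. \<exists>l. (\<lambda>m. block_mass n (f (r m)) i) \<longlonglongrightarrow> l"
      using conv[of "(n, _)"] by simp
    then obtain l where l: "\<And>i. (\<lambda>m. block_mass n (f (r m)) i) \<longlonglongrightarrow> l i" by metis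
    have "(\<lambda>m. \<Sum>i<n. \<bar>block_mass n (f (r m)) i - l i\<bar>) \<longlonglongrightarrow> (\<Sum>i<n. \<bar>l i - l i\<bar>)"
      by (intro tendsto_intros l)
    then have "(\<lambda>m. \<Sum>i<n. \<bar>block_mass n (f (r m)) i - l i\<bar>) \<longlonglongrightarrow> 0" by simp
    from order_tendstoD(2)[OF this, of "e/4"] that
    obtain N where N: "\<And>m. m \<ge> N \<Longrightarrow> (\<Sum>i<n. \<bar>block_mass n (f (r m)) i - l i\<bar>) < e / 4"
      by (auto simp: eventually_sequentially)
    have "L1_dist leb_I (f (r i)) (f (r j)) < e" if ij: "i \<ge> N" "j \<ge> N" for i j
    proof -
      let ?A = "\<lambda>m. block_average n (f (r m))"
      have "L1_dist leb_I (?A i) (?A j)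
          \<le> (\<Sum>k<n. \<bar>block_mass n (f (r i)) k - block_mass n (f (r j)) k\<bar>)"
        by (rule block_average_dist)
      also have "\<dots> \<le> (\<Sum>k<n. \<bar>block_mass n (f (r i)) k - l k\<bar> + \<bar>block_mass n (f (r j)) k - l k\<bar>)"
        by (intro sum_mono) auto
      also have "\<dots> < e / 2"
        using N[OF ij(1)] N[OF ij(2)] by (simp add: sum.distrib)
      finally have "L1_dist leb_I (?A i) (?A j) < e / 2" .
      moreover have "L1_dist leb_I (f (r m)) (?A m) < e / 4" for m
        using approx[OF n(1), of "r m"] n(2) by linarith
      ultimately show ?thesis
        using L1_dist_triangle[OF f[of "r i"] block_average_integrable[of n "f (r i)"] f[of "r j"]]
          L1_dist_triangle[OF block_average_integrable[of n "f (r i)"]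
            block_average_integrable[of n "f (r j)"] f[of "r j"]]
          \<open>\<And>m. L1_dist leb_I (f (r m)) (?A m) < e / 4\<close>[of i]
          \<open>\<And>m. L1_dist leb_I (f (r m)) (?A m) < e / 4\<close>[of j]
          L1_dist_commute[of leb_I "f (r j)" "?A j"]
        by linarith
    qed
    then show ?thesis by blast
  qed
  then obtain g where "integrable leb_I g" "(\<lambda>m. L1_dist leb_I (f (r m)) g) \<longlonglongrightarrow> 0"
    using L1_complete[of leb_I "\<lambda>m. f (r m)"] f by blast
  then show ?thesis using r that by blast
qed

text \<open>The condition of \<open>L1_precompact\<close> is convex, so it passes from the iterates of an operator to their
  Cesaro means.\<close>

lemma mean_block_average_dist:
  fixes f :: "nat \<Rightarrow> real \<Rightarrow> real"
  assumes f: "\<And>k. integrable leb_I (f k)"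
    and approx: "\<And>k. L1_dist leb_I (f k) (block_average n (f k)) \<le> \<rho>"
  shows "L1_dist leb_I (\<lambda>x. (\<Sum>k<Suc m. f k x) / real (Suc m))
    (block_average n (\<lambda>x. (\<Sum>k<Suc m. f k x) / real (Suc m))) \<le> \<rho>" (is "L1_dist _ ?F _ \<le> _")
proof -
  have mass: "block_mass n ?F i = (\<Sum>k<Suc m. block_mass n (f k) i) / real (Suc m)" if "i < n" for i
  proof -
    have "block_mass n ?F i = (\<integral>y. (\<Sum>k<Suc m. indicator (block n i) y * f k y) / real (Suc m) \<partial>leb_I)"
      unfolding block_mass_def by (simp only: sum_distrib_left times_divide_eq_right)
    also have "\<dots> = (\<integral>y. (\<Sum>k<Suc m. indicator (block n i) y * f k y) \<partial>leb_I) / real (Suc m)"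
      by (rule integral_divide_zero)
    also have "\<dots> = (\<Sum>k<Suc m. block_mass n (f k) i) / real (Suc m)"
      unfolding block_mass_def
      by (subst Bochner_Integration.integral_sum) (use indicator_block_integrable[OF f that] in auto)
    finally show ?thesis .
  qed
  have avg: "block_average n ?F x = (\<Sum>k<Suc m. block_average n (f k) x) / real (Suc m)" for x
  proof -
    have "block_average n ?F x = (\<Sum>i<n. \<Sum>k<Suc m. indicator (block n i) x * (real n * block_mass n (f k) i) / real (Suc m))"
      unfolding block_average_def
    proof (rule sum.cong[OF refl])
      fix i assume "i \<in> {..<n}"
      then have "i < n" by simp
      show "indicator (block n i) x * (real n * block_mass n ?F i)
          = (\<Sum>k<Suc m. indicator (block n i) x * (real n * block_mass n (f k) i) / real (Suc m))"
        unfolding mass[OF \<open>i < n\<close>] by (simp only: sum_distrib_left sum_divide_distrib times_divide_eq_right)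
    qed
    also have "\<dots> = (\<Sum>k<Suc m. \<Sum>i<n. indicator (block n i) x * (real n * block_mass n (f k) i) / real (Suc m))"
      by (rule sum.swap)
    finally show ?thesis
      unfolding block_average_def by (simp only: sum_divide_distrib)
  qed
  have "L1_dist leb_I ?F (block_average n ?F)
      \<le> (\<integral>x. (\<Sum>k<Suc m. \<bar>f k x - block_average n (f k) x\<bar>) / real (Suc m) \<partial>leb_I)"
    unfolding L1_dist_def
  proof (rule integral_mono)
    fix x
    have "?F x - block_average n ?F x = (\<Sum>k<Suc m. f k x - block_average n (f k) x) / real (Suc m)"
      unfolding avg sum_subtractf diff_divide_distrib ..
    also have "\<bar>\<dots>\<bar> \<le> (\<Sum>k<Suc m. \<bar>f k x - block_average n (f k) x\<bar>) / real (Suc m)"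
      using sum_abs[of "\<lambda>k. f k x - block_average n (f k) x" "{..<Suc m}"]
      by (simp add: divide_right_mono del: sum.lessThan_Suc)
    finally show "\<bar>?F x - block_average n ?F x\<bar> \<le> (\<Sum>k<Suc m. \<bar>f k x - block_average n (f k) x\<bar>) / real (Suc m)" .
  qed (use f in \<open>auto intro!: Bochner_Integration.integrable_sum integrable_divide Bochner_Integration.integrable_diff
        integrable_abs simp del: sum.lessThan_Suc\<close>)
  also have "\<dots> = (\<Sum>k<Suc m. L1_dist leb_I (f k) (block_average n (f k))) / real (Suc m)"
    unfolding integral_divide_zero L1_dist_def
    by (subst Bochner_Integration.integral_sum) (use f in auto)
  also have "\<dots> \<le> (\<Sum>k<Suc m. \<rho>) / real (Suc m)"
    by (intro divide_right_mono sum_mono approx) auto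
  also have "\<dots> = \<rho>" by (simp del: sum.lessThan_Suc)
  finally show ?thesis .
qed

section \<open>Functions of bounded oscillation\<close>

lemma restrict_measurable_mono:
  "f \<in> borel_measurable leb_I \<Longrightarrow> A \<subseteq> I \<Longrightarrow> f \<in> borel_measurable (restrict_space lborel A)"
  by (rule measurable_restrict_mono)

lemma osc_mono:
  assumes f: "f \<in> borel_measurable leb_I" and A: "A \<in> sets borel" and B: "B \<in> sets borel"
    and sub: "A \<subseteq> B" "B \<subseteq> I"
  shows "osc f A \<le> osc f B"
proof -
  have mono: "esssup (restrict_space lborel A) g \<le> esssup (restrict_space lborel B) g"
    if "g \<in> borel_measurable (restrict_space lborel A)" for g :: "real \<Rightarrow> ereal"
  proof (rule esssup_I[OF that])
    show "AE x in restrict_space lborel A. g x \<le> esssup (restrict_space lborel B) g"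
      using esssup_AE[of g "restrict_space lborel B"] A B sub
      by (auto simp: AE_restrict_space_iff elim!: eventually_mono)
  qed
  have [measurable]: "f \<in> borel_measurable (restrict_space lborel A)"
    using restrict_measurable_mono[OF f] sub by blast
  show ?thesis
    unfolding osc_def by (intro e2ennreal_mono) (auto intro!: add_mono mono simp: minus_ereal_def)
qed

text \<open>Almost all values and the mean value lie between the essential infimum and supremum.\<close>

lemma block_deviation_le_osc:
  assumes f: "integrable leb_I f" and i: "i < n"
  shows "AE x in leb_I. x \<in> block n i \<longrightarrow>
    ennreal \<bar>f x - block_average n f x\<bar> \<le> osc f (block n i)"
proof -
  let ?R = "restrict_space lborel (block n i)"
  let ?hi = "esssup ?R (\<lambda>x. ereal (f x))"
  let ?lo = "esssup ?R (\<lambda>x. - ereal (f x))"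
  have fm: "f \<in> borel_measurable leb_I" using f by auto
  have sub: "block n i \<subseteq> I" by (rule block_subset[OF i])
  have AE_block: "AE x in leb_I. x \<in> block n i \<longrightarrow> Q x" if "AE x in ?R. Q x" for Q
    using that sub by (auto simp: AE_restrict_space_iff block_def elim!: eventually_mono)
  have hi: "AE x in leb_I. x \<in> block n i \<longrightarrow> ereal (f x) \<le> ?hi"
    by (rule AE_block[OF esssup_AE])
  have lo: "AE x in leb_I. x \<in> block n i \<longrightarrow> - ereal (f x) \<le> ?lo"
    by (rule AE_block[OF esssup_AE])
  have pos: "\<not> (AE x in leb_I. x \<notin> block n i)"
    using measure_block[OF i] leb_I.AE_prob_1 leb_I.prob_eq_0[OF block_sets[OF i]] i by auto
  have finite: "?hi \<noteq> -\<infinity>" "?lo \<noteq> -\<infinity>"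
  proof -
    show "?hi \<noteq> -\<infinity>"
    proof
      assume "?hi = -\<infinity>"
      then show False using hi pos by simp
    qed
    show "?lo \<noteq> -\<infinity>"
    proof
      assume "?lo = -\<infinity>"
      then show False using lo pos by simp
    qed
  qed
  show ?thesis
  proof (cases "?hi = \<infinity> \<or> ?lo = \<infinity>")
    case True
    then have "osc f (block n i) = top"
      unfolding osc_def using finite by (auto simp: minus_ereal_def)
    then show ?thesis by simp
  next
    case False
    then obtain b a where b: "?hi = ereal b" and a: "?lo = ereal a"
      using finite by (cases ?hi; cases ?lo) auto
    have osc: "osc f (block n i) = ennreal (b + a)"
      unfolding osc_def a b by (simp add: ennreal.abs_eq eq_onp_def e2ennreal_ereal)
    have up: "AE x in leb_I. x \<in> block n i \<longrightarrow> f x \<le> b" using hi b by simp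
    have down: "AE x in leb_I. x \<in> block n i \<longrightarrow> - a \<le> f x"
      using lo a by (simp add: minus_le_iff)
    have "block_mass n f i \<le> b / real n"
      unfolding block_mass_def block_step_integral[OF i, symmetric]
      by (rule integral_mono_AE[OF indicator_block_integrable[OF f i] block_step_integrable[OF i]])
         (use up in \<open>auto elim!: eventually_mono simp: indicator_def\<close>)
    moreover have "(- a) / real n \<le> block_mass n f i"
      unfolding block_mass_def block_step_integral[OF i, symmetric]
      by (rule integral_mono_AE[OF block_step_integrable[OF i] indicator_block_integrable[OF f i]])
         (use down in \<open>auto elim!: eventually_mono simp: indicator_def\<close>)
    ultimately have avg: "real n * block_mass n f i \<le> b" "- a \<le> real n * block_mass n f i"
      using i by (auto simp: field_simps)
    from up down show ?thesis
    proof eventually_elim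
      case (elim x)
      show ?case
        unfolding osc using elim avg by (auto simp: block_average_eq[OF i] intro!: ennreal_leI)
    qed
  qed
qed

text \<open>The block of \<open>x\<close> lies in the ball of radius \<open>1 / n\<close> around \<open>x\<close>, so the deviation of \<open>f\<close> from its block
  average is at most the oscillation on that ball, whose integral the seminorm controls. This is
  the compact embedding of \<open>V\<^sub>\<alpha>\<close> into the integrable functions.\<close>

lemma L1_dist_block_average_le_V_norm:
  assumes f: "integrable leb_I f" and V: "V_norm \<epsilon>0 \<alpha> f \<le> ennreal B" and B: "0 \<le> B"
    and n: "0 < n" "1 / real n \<le> \<epsilon>0"
  shows "L1_dist leb_I f (block_average n f) \<le> B * (1 / real n) powr \<alpha>"
proof -
  let ?r = "1 / real n"
  let ?J = "\<integral>\<^sup>+ x. osc f (ball x ?r \<inter> I) \<partial>leb_I"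
  have r: "?r \<in> {0<..\<epsilon>0}" using n by simp
  have fm: "f \<in> borel_measurable leb_I" using f by auto
  have le: "osc f (block n i) \<le> osc f (ball x ?r \<inter> I)" if "i < n" "x \<in> block n i" for i x
  proof (rule osc_mono[OF fm])
    show "block n i \<subseteq> ball x ?r \<inter> I"
      using block_subset[OF that(1)] that(2) by (auto simp: block_def dist_real_def add_divide_distrib)
  qed (auto simp: block_def)
  have "AE x in leb_I. \<forall>i\<in>{..<n}. x \<in> block n i \<longrightarrow>
      ennreal \<bar>f x - block_average n f x\<bar> \<le> osc f (block n i)"
    by (rule AE_finite_allI) (auto intro: block_deviation_le_osc[OF f])
  then have ae: "AE x in leb_I. ennreal \<bar>f x - block_average n f x\<bar>
      \<le> (\<Sum>i<n. osc f (block n i) * indicator (block n i) x)"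
    using AE_leb_I_neq[of 1] AE_space[of leb_I]
  proof eventually_elim
    case (elim x)
    then obtain i where i: "i < n" "x \<in> block n i" using ex_block[OF n(1), of x] by auto
    have "(\<Sum>j\<in>{i}. osc f (block n j) * indicator (block n j) x) \<le> (\<Sum>j<n. osc f (block n j) * indicator (block n j) x)"
      by (rule sum_mono2) (use i in auto)
    then show ?case using elim(1) i by (auto intro: order_trans)
  qed
  have "ennreal (L1_dist leb_I f (block_average n f)) = (\<integral>\<^sup>+x. ennreal \<bar>f x - block_average n f x\<bar> \<partial>leb_I)"
    unfolding L1_dist_def using f by (intro nn_integral_eq_integral[symmetric]) auto
  also have "\<dots> \<le> (\<integral>\<^sup>+x. (\<Sum>i<n. osc f (block n i) * indicator (block n i) x) \<partial>leb_I)"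
    by (rule nn_integral_mono_AE[OF ae])
  also have "\<dots> \<le> ?J"
  proof (rule nn_integral_mono)
    fix x assume "x \<in> space leb_I"
    show "(\<Sum>i<n. osc f (block n i) * indicator (block n i) x) \<le> osc f (ball x ?r \<inter> I)"
    proof (cases "\<exists>i<n. x \<in> block n i")
      case True
      then obtain i where i: "i < n" "x \<in> block n i" by blast
      have "(\<Sum>j<n. osc f (block n j) * indicator (block n j) x)
          = (\<Sum>j<n. if j = i then osc f (block n i) else 0)"
        using i(2) by (intro sum.cong) (auto simp: block_unique indicator_def)
      also have "\<dots> = osc f (block n i)" using i(1) by simp
      finally show ?thesis using le[OF i] by simp
    qed (auto simp: sum.neutral)
  qed
  finally have 1: "ennreal (L1_dist leb_I f (block_average n f)) \<le> ?J" .
  have "ennreal (?r powr - \<alpha>) * ?J \<le> V_seminorm \<epsilon>0 \<alpha> f"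
    unfolding V_seminorm_def by (rule SUP_upper[OF r])
  also have "\<dots> \<le> V_norm \<epsilon>0 \<alpha> f" unfolding V_norm_def by simp
  finally have "ennreal (?r powr - \<alpha>) * ennreal (L1_dist leb_I f (block_average n f)) \<le> ennreal B"
    using V mult_left_mono[OF 1, of "ennreal (?r powr - \<alpha>)"] by (meson order_trans zero_le)
  then have "?r powr - \<alpha> * L1_dist leb_I f (block_average n f) \<le> B"
    using B by (simp add: ennreal_mult[symmetric])
  then have "?r powr \<alpha> * (?r powr - \<alpha> * L1_dist leb_I f (block_average n f)) \<le> ?r powr \<alpha> * B"
    by (intro mult_left_mono) auto
  moreover have "?r powr \<alpha> * ?r powr - \<alpha> = 1"
    using n by (simp add: powr_add[symmetric])
  ultimately show ?thesis
    by (simp add: mult.assoc[symmetric] mult.commute)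
qed

text \<open>Stated for arbitrary functions, in order to apply to the oscillation on the ball around \<open>x\<close> as a
  function of \<open>x\<close>, for which measurability is not established. Dividing the simple functions below
  \<open>c * f\<close> by \<open>c\<close> gives simple functions below \<open>f\<close>.\<close>

lemma nn_integral_cmult_le:
  fixes f :: "'a \<Rightarrow> ennreal"
  assumes c: "0 < c"
  shows "(\<integral>\<^sup>+x. ennreal c * f x \<partial>M) \<le> ennreal c * (\<integral>\<^sup>+x. f x \<partial>M)"
proof -
  have inv: "ennreal (1/c) * ennreal c = 1" "ennreal c * ennreal (1/c) = 1"
    using c by (simp_all add: ennreal_mult[symmetric])
  show ?thesis
    unfolding nn_integral_def[of M "\<lambda>x. ennreal c * f x"]
  proof (rule SUP_least, clarsimp)
    fix g assume g: "simple_function M g" "g \<le> (\<lambda>x. ennreal c * f x)"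
    let ?g = "\<lambda>x. ennreal (1/c) * g x"
    have s: "simple_function M ?g" using g(1) by (rule simple_function_mult[OF simple_function_const])
    have "?g x \<le> f x" for x
    proof -
      have "?g x \<le> ennreal (1/c) * (ennreal c * f x)"
        using g(2) by (intro mult_left_mono) (auto simp: le_fun_def)
      then show ?thesis by (simp add: mult.assoc[symmetric] inv)
    qed
    then have "(\<integral>\<^sup>+x. ?g x \<partial>M) \<le> (\<integral>\<^sup>+x. f x \<partial>M)" by (intro nn_integral_mono)
    then have "ennreal (1/c) * integral\<^sup>S M g \<le> (\<integral>\<^sup>+x. f x \<partial>M)"
      using g(1) s by (simp add: nn_integral_eq_simple_integral)
    then have "ennreal c * (ennreal (1/c) * integral\<^sup>S M g) \<le> ennreal c * (\<integral>\<^sup>+x. f x \<partial>M)"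
      by (rule mult_left_mono) simp
    then show "integral\<^sup>S M g \<le> ennreal c * (\<integral>\<^sup>+x. f x \<partial>M)"
      by (simp add: mult.assoc[symmetric] inv)
  qed
qed

lemma osc_scale:
  assumes c: "0 < c"
  shows "osc (\<lambda>x. c * f x) A = ennreal c * osc f A"
proof -
  let ?R = "restrict_space lborel A"
  let ?a = "esssup ?R (\<lambda>x. ereal (f x))"
  let ?b = "esssup ?R (\<lambda>x. - ereal (f x))"
  have a: "esssup ?R (\<lambda>x. ereal (c * f x)) = ereal c * ?a"
    using esssup_cmult[OF c, of ?R "\<lambda>x. ereal (f x)"] by simp
  have b: "esssup ?R (\<lambda>x. - ereal (c * f x)) = ereal c * ?b"
    using esssup_cmult[OF c, of ?R "\<lambda>x. - ereal (f x)"] by simp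
  have "ereal c * ?a - - (ereal c * ?b) = ereal c * (?a - - ?b)"
    using c by (cases ?a; cases ?b) (auto simp: algebra_simps)
  moreover have "e2ennreal (ereal c * z) = ennreal c * e2ennreal z" for z
    using c by (cases z) (auto simp: ennreal_mult' ennreal_mult_top e2ennreal_neg)
  ultimately show ?thesis
    unfolding osc_def a b by simp
qed

lemma V_norm_scale:
  assumes c: "0 < c"
  shows "V_norm \<epsilon>0 \<alpha> (\<lambda>x. c * f x) \<le> ennreal c * V_norm \<epsilon>0 \<alpha> f"
proof -
  have "V_seminorm \<epsilon>0 \<alpha> (\<lambda>x. c * f x) \<le> ennreal c * V_seminorm \<epsilon>0 \<alpha> f"
    unfolding V_seminorm_def[of _ _ "\<lambda>x. c * f x"]
  proof (rule SUP_least)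
    fix r assume r: "r \<in> {0<..\<epsilon>0}"
    let ?J = "\<integral>\<^sup>+ x. osc f (ball x r \<inter> I) \<partial>leb_I"
    have "ennreal (r powr - \<alpha>) * (\<integral>\<^sup>+ x. osc (\<lambda>x. c * f x) (ball x r \<inter> I) \<partial>leb_I)
        \<le> ennreal (r powr - \<alpha>) * (ennreal c * ?J)"
      unfolding osc_scale[OF c] by (intro mult_left_mono nn_integral_cmult_le[OF c]) simp
    also have "\<dots> = ennreal c * (ennreal (r powr - \<alpha>) * ?J)" by (simp add: ac_simps)
    also have "\<dots> \<le> ennreal c * V_seminorm \<epsilon>0 \<alpha> f"
      unfolding V_seminorm_def by (intro mult_left_mono SUP_upper r) simp
    finally show "ennreal (r powr - \<alpha>) * (\<integral>\<^sup>+ x. osc (\<lambda>x. c * f x) (ball x r \<inter> I) \<partial>leb_I)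
        \<le> ennreal c * V_seminorm \<epsilon>0 \<alpha> f" .
  qed
  moreover have "L1_norm (\<lambda>x. c * f x) \<le> ennreal c * L1_norm f"
    unfolding L1_norm_def using nn_integral_cmult_le[OF c, of leb_I "\<lambda>x. ennreal \<bar>f x\<bar>"] c
    by (simp add: abs_mult ennreal_mult)
  ultimately show ?thesis
    unfolding V_norm_def by (simp add: distrib_left add_mono)
qed

lemma V_norm_finite: "f \<in> V_space \<epsilon>0 \<alpha> \<Longrightarrow> V_norm \<epsilon>0 \<alpha> f < \<infinity>"
  by (auto simp: V_space_def V_norm_def L1_norm_eq)

lemma V_space_iff: "f \<in> V_space \<epsilon>0 \<alpha> \<longleftrightarrow> integrable leb_I f \<and> V_norm \<epsilon>0 \<alpha> f < \<infinity>"
  by (auto simp: V_space_def V_norm_def L1_norm_eq)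

lemma L1_norm_le_mixed_norm:
  assumes hom: "\<And>c f x. 0 < c \<Longrightarrow> A (\<lambda>x. c * f x) x = c * A f x"
    and f: "f \<in> V_space \<epsilon>0 \<alpha>" and B: "V_norm \<epsilon>0 \<alpha> f \<le> ennreal B" "0 < B"
  shows "L1_norm (A f) \<le> ennreal B * mixed_norm \<epsilon>0 \<alpha> A"
proof -
  let ?g = "\<lambda>x. (1/B) * f x"
  have "V_norm \<epsilon>0 \<alpha> ?g \<le> ennreal (1/B) * V_norm \<epsilon>0 \<alpha> f"
    using B by (intro V_norm_scale) simp
  also have "\<dots> \<le> ennreal (1/B) * ennreal B" by (intro mult_left_mono B) simp
  also have "\<dots> = 1" using B by (simp add: ennreal_mult[symmetric])
  finally have g: "V_norm \<epsilon>0 \<alpha> ?g \<le> 1" .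
  then have "?g \<in> V_space \<epsilon>0 \<alpha>"
    using f by (auto simp: V_space_iff intro: le_less_trans)
  then have le: "L1_norm (A ?g) \<le> mixed_norm \<epsilon>0 \<alpha> A"
    unfolding mixed_norm_def using g by (intro SUP_upper) auto
  have Af: "\<bar>A f x\<bar> = B * \<bar>A ?g x\<bar>" for x
    using hom[of "1/B" f x] B by (simp add: abs_mult)
  have "L1_norm (A f) = (\<integral>\<^sup>+x. ennreal B * ennreal \<bar>A ?g x\<bar> \<partial>leb_I)"
    unfolding L1_norm_def Af using B by (simp add: ennreal_mult)
  also have "\<dots> \<le> ennreal B * L1_norm (A ?g)"
    unfolding L1_norm_def by (rule nn_integral_cmult_le[OF B(2)])
  also have "\<dots> \<le> ennreal B * mixed_norm \<epsilon>0 \<alpha> A" by (intro mult_left_mono le) simp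
  finally show ?thesis .
qed

lemma lipschitz_integrable:
  fixes g :: "real \<Rightarrow> real"
  assumes "L-lipschitz_on UNIV g"
  shows "integrable leb_I g"
proof -
  have cont: "continuous_on UNIV g" by (rule lipschitz_on_continuous_on[OF assms])
  have "compact (g ` I)"
    by (intro compact_continuous_image continuous_on_subset[OF cont]) auto
  then obtain B where B: "\<And>x. x \<in> I \<Longrightarrow> norm (g x) \<le> B"
    using compact_imp_bounded bounded_iff by (metis imageI)
  have "g \<in> borel_measurable lborel"
    using borel_measurable_continuous_onI[OF cont] by simp
  then have "g \<in> borel_measurable leb_I" by (rule measurable_restrict_space1)
  then show ?thesis
    by (intro leb_I.integrable_const_bound[of _ B]) (auto intro!: AE_I2 B[simplified])
qed

text \<open>The oscillation of \<open>f\<close> on a ball of radius \<open>r\<close> is at most \<open>2 L r\<close>, and \<open>r\<^sup>1\<^sup>-\<^sup>\<alpha>\<close> stays bounded because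
  \<open>\<alpha> \<le> 1\<close>.\<close>

lemma lipschitz_V_space:
  assumes L: "L-lipschitz_on UNIV f" and \<alpha>: "\<alpha> \<le> 1"
  shows "f \<in> V_space \<epsilon>0 \<alpha>"
proof -
  have L0: "0 \<le> L" by (rule lipschitz_on_nonneg[OF L])
  have int: "integrable leb_I f" by (rule lipschitz_integrable[OF L])
  then have fm: "f \<in> borel_measurable leb_I" by auto
  have "V_seminorm \<epsilon>0 \<alpha> f \<le> ennreal (2 * L * \<epsilon>0 powr (1 - \<alpha>))"
    unfolding V_seminorm_def
  proof (rule SUP_least)
    fix r assume r: "r \<in> {0<..\<epsilon>0}"
    have osc: "osc f (ball x r \<inter> I) \<le> ennreal (2 * L * r)" for x
    proof -
      let ?R = "restrict_space lborel (ball x r \<inter> I)"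
      have [measurable]: "f \<in> borel_measurable ?R"
        by (rule restrict_measurable_mono[OF fm]) auto
      have close: "\<bar>f y - f x\<bar> \<le> L * r" if "y \<in> ball x r" for y
      proof -
        have "\<bar>f y - f x\<bar> \<le> L * dist y x"
          using lipschitz_onD[OF L, of y x] by (simp add: dist_real_def)
        also have "\<dots> \<le> L * r"
          using that L0 by (intro mult_left_mono) (auto simp: dist_commute)
        finally show ?thesis .
      qed
      have "esssup ?R (\<lambda>y. ereal (f y)) \<le> ereal (f x + L * r)"
      proof (rule esssup_I)
        show "AE y in ?R. ereal (f y) \<le> ereal (f x + L * r)"
          using close by (intro AE_I2) (fastforce simp: space_restrict_space)
      qed measurable
      moreover have "esssup ?R (\<lambda>y. - ereal (f y)) \<le> ereal (L * r - f x)"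
      proof (rule esssup_I)
        show "AE y in ?R. - ereal (f y) \<le> ereal (L * r - f x)"
          using close by (intro AE_I2) (fastforce simp: space_restrict_space)
      qed measurable
      ultimately have "esssup ?R (\<lambda>y. ereal (f y)) - - esssup ?R (\<lambda>y. - ereal (f y))
          \<le> ereal (f x + L * r) + ereal (L * r - f x)"
        by (simp only: minus_ereal_def ereal_uminus_uminus add_mono)
      then have "osc f (ball x r \<inter> I) \<le> e2ennreal (ereal (2 * L * r))"
        unfolding osc_def by (intro e2ennreal_mono) (simp add: algebra_simps)
      then show ?thesis by (simp add: e2ennreal_ereal)
    qed
    have "(\<integral>\<^sup>+x. osc f (ball x r \<inter> I) \<partial>leb_I) \<le> (\<integral>\<^sup>+x. ennreal (2 * L * r) \<partial>leb_I)"
      by (intro nn_integral_mono osc)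
    also have "\<dots> = ennreal (2 * L * r)"
      using leb_I.emeasure_space_1 by simp
    finally have "ennreal (r powr - \<alpha>) * (\<integral>\<^sup>+ x. osc f (ball x r \<inter> I) \<partial>leb_I)
        \<le> ennreal (r powr - \<alpha>) * ennreal (2 * L * r)"
      by (intro mult_left_mono) auto
    also have "\<dots> = ennreal (2 * L * r powr (1 - \<alpha>))"
      using r L0 by (simp add: ennreal_mult[symmetric] powr_diff powr_minus_divide)
    also have "\<dots> \<le> ennreal (2 * L * \<epsilon>0 powr (1 - \<alpha>))"
      using r L0 \<alpha> by (intro ennreal_leI mult_left_mono powr_mono2) auto
    finally show "ennreal (r powr - \<alpha>) * (\<integral>\<^sup>+ x. osc f (ball x r \<inter> I) \<partial>leb_I)
        \<le> ennreal (2 * L * \<epsilon>0 powr (1 - \<alpha>))" .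
  qed
  then show ?thesis using int by (auto simp: V_space_def intro: le_less_trans)
qed

lemma dominated_L1_dist:
  fixes s :: "nat \<Rightarrow> 'a \<Rightarrow> real"
  assumes s: "\<And>i. integrable M (s i)" and f: "integrable M f" and w: "integrable M w"
    and lim: "\<And>x. x \<in> space M \<Longrightarrow> (\<lambda>i. s i x) \<longlonglongrightarrow> f x"
    and bound: "\<And>i x. x \<in> space M \<Longrightarrow> \<bar>s i x\<bar> \<le> w x"
  shows "(\<lambda>i. L1_dist M (s i) f) \<longlonglongrightarrow> 0"
proof -
  have "(\<lambda>i. \<integral>x. \<bar>s i x - f x\<bar> \<partial>M) \<longlonglongrightarrow> (\<integral>x. 0 \<partial>M)"
  proof (rule integral_dominated_convergence)
    show "AE x in M. (\<lambda>i. \<bar>s i x - f x\<bar>) \<longlonglongrightarrow> 0"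
    proof (rule AE_I2)
      fix x assume "x \<in> space M"
      from tendsto_rabs[OF tendsto_diff[OF lim[OF this] tendsto_const[of "f x"]]]
      show "(\<lambda>i. \<bar>s i x - f x\<bar>) \<longlonglongrightarrow> 0" by simp
    qed
    show "AE x in M. norm \<bar>s i x - f x\<bar> \<le> w x + \<bar>f x\<bar>" for i
      using bound[of _ i] by (intro AE_I2) (auto intro: order_trans[OF abs_triangle_ineq4])
    show "integrable M (\<lambda>x. w x + \<bar>f x\<bar>)" using w f by auto
    show "(\<lambda>x. \<bar>s i x - f x\<bar>) \<in> borel_measurable M" for i
      using borel_measurable_integrable[OF s[of i]] borel_measurable_integrable[OF f] by measurable
  qed simp
  then show ?thesis by (simp add: L1_dist_def)
qed

text \<open>The functions \<open>max 0 (1 - k * infdist x T)\<close> are Lipschitz and, for nonempty \<open>T\<close>, decrease to its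
  indicator as \<open>k\<close> grows.\<close>

lemma lipschitz_approx_closed:
  fixes T :: "real set"
  assumes T: "closed T" and \<delta>: "0 < \<delta>"
  obtains g L where "L-lipschitz_on UNIV g" "L1_dist leb_I (indicator T) g < \<delta>"
proof (cases "T = {}")
  case True
  have "0-lipschitz_on UNIV (\<lambda>x::real. 0::real)" by (rule lipschitz_on_constant)
  then show ?thesis using that[of 0 "\<lambda>_. 0"] True \<delta> by (simp add: L1_dist_def)
next
  case False
  define g where "g k x = max 0 (1 - real k * infdist x T)" for k :: nat and x
  have lip: "(real k)-lipschitz_on UNIV (g k)" for k
  proof (rule lipschitz_onI)
    fix x y
    have "dist (g k x) (g k y) \<le> \<bar>real k * infdist x T - real k * infdist y T\<bar>"
      by (auto simp: g_def dist_real_def)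
    also have "\<dots> = real k * \<bar>infdist x T - infdist y T\<bar>"
      by (simp add: abs_mult right_diff_distrib[symmetric])
    also have "\<dots> \<le> real k * dist x y"
      by (intro mult_left_mono infdist_triangle_abs) simp
    finally show "dist (g k x) (g k y) \<le> real k * dist x y" .
  qed simp
  have ind: "integrable leb_I (indicator T :: real \<Rightarrow> real)"
  proof -
    have "(indicator T :: real \<Rightarrow> real) \<in> borel_measurable lborel"
      using T by (auto intro: borel_measurable_indicator borel_closed)
    then show ?thesis
      by (intro leb_I.integrable_const_bound[of _ 1])
         (auto simp: indicator_def intro: measurable_restrict_space1)
  qed
  have "(\<lambda>k. L1_dist leb_I (g k) (indicator T)) \<longlonglongrightarrow> 0"
  proof (rule dominated_L1_dist[OF lipschitz_integrable[OF lip] ind leb_I.integrable_const[of 1]])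
    fix x
    show "(\<lambda>k. g k x) \<longlonglongrightarrow> indicator T x"
    proof (cases "x \<in> T")
      case True
      then show ?thesis by (simp add: g_def)
    next
      case False
      then have "0 < infdist x T"
        using in_closed_iff_infdist_zero[OF T \<open>T \<noteq> {}\<close>] infdist_nonneg[of x T] by (simp add: order_less_le)
      then obtain N where "1 < real N * infdist x T"
        using reals_Archimedean3 by blast
      moreover have "real N * infdist x T \<le> real k * infdist x T" if "k \<ge> N" for k
        using that by (intro mult_right_mono) (auto simp: infdist_nonneg)
      ultimately have "\<forall>\<^sub>F k in sequentially. g k x = 0"
        unfolding g_def eventually_sequentially by (intro exI[of _ N]) (force simp: max_def)
      then show ?thesis
        using False by (simp add: tendsto_eventually)
    qed
    show "\<bar>g k x\<bar> \<le> 1" for k by (auto simp: g_def infdist_nonneg)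
  qed
  from order_tendstoD(2)[OF this \<delta>] obtain k where "L1_dist leb_I (g k) (indicator T) < \<delta>"
    by (auto simp: eventually_sequentially)
  then show ?thesis
    using that[OF lip[of k]] by (simp add: L1_dist_commute)
qed

text \<open>Inner regularity of Lebesgue measure reduces indicators of Borel sets to those of closed sets.
  In particular \<open>V\<^sub>\<alpha>\<close> is dense in the integrable functions.\<close>

lemma lipschitz_dense:
  assumes "integrable leb_I f" and "0 < \<delta>"
  obtains g L where "L-lipschitz_on UNIV g" "L1_dist leb_I f g < \<delta>"
proof -
  have "\<forall>\<delta>>0. \<exists>g L. L-lipschitz_on UNIV g \<and> L1_dist leb_I f g < \<delta>"
    using assms(1)
  proof (induction rule: integrable_induct)
    case (base A c)
    show ?case
    proof (intro allI impI)
      fix \<delta> :: real assume \<delta>: "0 < \<delta>"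
      \<comment> \<open>The factor \<open>2\<close> accounts for two approximations, and adding \<open>1\<close> covers \<open>c = 0\<close>.\<close>
      define \<eta> where "\<eta> = \<delta> / (2 * (\<bar>c\<bar> + 1))"
      have \<eta>: "0 < \<eta>" "\<bar>c\<bar> * (2 * \<eta>) < \<delta>"
        using \<delta> by (auto simp: \<eta>_def field_simps add_nonneg_pos)
      have A: "A \<in> sets borel" "A \<subseteq> I" using base by (auto simp: sets_leb_I)
      have "A \<in> sets lebesgue" using A(1) by simp
      then obtain T where T: "closed T" "T \<subseteq> A" "emeasure lebesgue (A - T) < ennreal \<eta>"
        by (rule sets_lebesgue_inner_closed[OF _ \<eta>(1)])
      have T': "T \<in> sets borel" "T \<subseteq> I" using borel_closed[OF T(1)] T(2) A(2) by blast+
      obtain g L where g: "L-lipschitz_on UNIV g" "L1_dist leb_I (indicator T) g < \<eta>"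
        by (rule lipschitz_approx_closed[OF T(1) \<eta>(1)])
      have gi: "integrable leb_I g" by (rule lipschitz_integrable[OF g(1)])
      have ind: "integrable leb_I (indicator B :: real \<Rightarrow> real)" if "B \<in> sets borel" "B \<subseteq> I" for B
        using that by (intro leb_I.integrable_const_bound[of _ 1]) (auto simp: indicator_def sets_leb_I intro!: borel_measurable_indicator)
      have "L1_dist leb_I (indicator A) (indicator T) = (\<integral>x. indicator (A - T) x \<partial>leb_I)"
        unfolding L1_dist_def using T(2)
        by (intro Bochner_Integration.integral_cong) (auto simp: indicator_def)
      also have "\<dots> = measure leb_I (A - T)"
        using A by (subst Bochner_Integration.integral_indicator) (simp add: Int_absorb2 subset_iff)
      also have "\<dots> < \<eta>"
      proof -
        have "emeasure leb_I (A - T) = emeasure lebesgue (A - T)"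
          using A T' by (subst emeasure_restrict_space) auto
        then have "emeasure leb_I (A - T) < ennreal \<eta>" using T(3) by simp
        then show ?thesis
          using \<eta> by (simp add: leb_I.emeasure_eq_measure ennreal_less_iff)
      qed
      finally have "L1_dist leb_I (indicator A) (indicator T) < \<eta>" .
      then have AT: "L1_dist leb_I (indicator A) g < 2 * \<eta>"
        using L1_dist_triangle[OF ind[OF A] ind[OF T'] gi] g(2) by simp
      have "L1_dist leb_I (\<lambda>x. indicator A x *\<^sub>R c) (\<lambda>x. c * g x) = (\<integral>x. \<bar>c\<bar> * \<bar>indicator A x - g x\<bar> \<partial>leb_I)"
        unfolding L1_dist_def
        by (intro Bochner_Integration.integral_cong) (auto simp: abs_mult[symmetric] algebra_simps)
      also have "\<dots> = \<bar>c\<bar> * L1_dist leb_I (indicator A) g"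
        unfolding L1_dist_def by simp
      also have "\<dots> \<le> \<bar>c\<bar> * (2 * \<eta>)" using AT by (intro mult_left_mono) auto
      also have "\<dots> < \<delta>" by (rule \<eta>(2))
      finally show "\<exists>g L. L-lipschitz_on UNIV g \<and> L1_dist leb_I (\<lambda>x. indicator A x *\<^sub>R c) g < \<delta>"
        using lipschitz_on_cmult_real[OF g(1), of c] by blast
    qed
  next
    case (add f1 f2)
    show ?case
    proof (intro allI impI)
      fix \<delta> :: real assume \<delta>: "0 < \<delta>"
      obtain g1 L1 g2 L2 where g: "L1-lipschitz_on UNIV g1" "L1_dist leb_I f1 g1 < \<delta>/2"
        "L2-lipschitz_on UNIV g2" "L1_dist leb_I f2 g2 < \<delta>/2"
        using add.IH \<delta> by (meson half_gt_zero)
      note i = lipschitz_integrable[OF g(1)] lipschitz_integrable[OF g(3)] add.hyps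
      have "L1_dist leb_I (\<lambda>x. f1 x + f2 x) (\<lambda>x. g1 x + g2 x)
          \<le> (\<integral>x. \<bar>f1 x - g1 x\<bar> + \<bar>f2 x - g2 x\<bar> \<partial>leb_I)"
        unfolding L1_dist_def using i by (intro integral_mono) auto
      also have "\<dots> = L1_dist leb_I f1 g1 + L1_dist leb_I f2 g2"
        unfolding L1_dist_def using i by simp
      finally have "L1_dist leb_I (\<lambda>x. f1 x + f2 x) (\<lambda>x. g1 x + g2 x) < \<delta>" using g by simp
      then show "\<exists>g L. L-lipschitz_on UNIV g \<and> L1_dist leb_I (\<lambda>x. f1 x + f2 x) g < \<delta>"
        using lipschitz_on_add[OF g(1) g(3)] by blast
    qed
  next
    case (lim f s)
    show ?case
    proof (intro allI impI)
      fix \<delta> :: real assume \<delta>: "0 < \<delta>"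
      have "(\<lambda>i. L1_dist leb_I (s i) f) \<longlonglongrightarrow> 0"
        using lim by (intro dominated_L1_dist[of _ _ _ "\<lambda>x. 2 * \<bar>f x\<bar>"]) auto
      from order_tendstoD(2)[OF this, of "\<delta>/2"] \<delta> obtain i where i: "L1_dist leb_I (s i) f < \<delta>/2"
        by (auto simp: eventually_sequentially)
      obtain g L where g: "L-lipschitz_on UNIV g" "L1_dist leb_I (s i) g < \<delta>/2"
        using lim.IH[of i] \<delta> by (meson half_gt_zero)
      have "L1_dist leb_I f g < \<delta>"
        using L1_dist_triangle[OF lim.hyps(4) lim.hyps(1)[of i] lipschitz_integrable[OF g(1)]] i g(2)
        by (simp add: L1_dist_commute)
      then show "\<exists>g L. L-lipschitz_on UNIV g \<and> L1_dist leb_I f g < \<delta>" using g(1) by blast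
    qed
  qed
  then show ?thesis using assms(2) that by blast
qed

section \<open>Stability of fixed densities\<close>

text \<open>Summing the geometric series: the strong norm of the initial function is forgotten
  exponentially, and only its integral norm matters in the limit.\<close>

lemma lasota_yorke_iterate:
  assumes mo: "markov_operator leb_I P" and LY: "lasota_yorke \<epsilon>0 \<alpha> P \<kappa> D"
    and \<kappa>: "0 < \<kappa>" "\<kappa> < 1" and D: "0 < D" and f: "f \<in> V_space \<epsilon>0 \<alpha>"
  shows "(P ^^ n) f \<in> V_space \<epsilon>0 \<alpha>"
    and "V_norm \<epsilon>0 \<alpha> ((P ^^ n) f)
      \<le> ennreal (\<kappa> ^ n * enn2real (V_norm \<epsilon>0 \<alpha> f) + D / (1 - \<kappa>) * (\<integral>x. \<bar>f x\<bar> \<partial>leb_I))"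
proof -
  interpret P: markov_operator leb_I P by (rule mo)
  let ?b = "\<integral>x. \<bar>f x\<bar> \<partial>leb_I"
  let ?v = "enn2real (V_norm \<epsilon>0 \<alpha> f)"
  let ?B = "\<lambda>n. \<kappa> ^ n * ?v + D / (1 - \<kappa>) * ?b"
  have f_int: "integrable leb_I f" using f by (simp add: V_space_iff)
  have int: "integrable leb_I ((P ^^ n) f)" for n by (rule P.iterate_integrable[OF f_int])
  have b0: "0 \<le> ?b" and v0: "0 \<le> ?v" by auto
  have B0: "0 \<le> ?B n" for n using \<kappa> D b0 v0 by (intro add_nonneg_nonneg mult_nonneg_nonneg) auto
  have bound: "V_norm \<epsilon>0 \<alpha> ((P ^^ n) f) \<le> ennreal (?B n)" for n
  proof (induction n)
    case 0
    have "V_norm \<epsilon>0 \<alpha> f = ennreal ?v" using V_norm_finite[OF f] by simp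
    also have "\<dots> \<le> ennreal (?B 0)" using \<kappa> D b0 by (intro ennreal_leI) simp
    finally show ?case by simp
  next
    case (Suc n)
    have "(P ^^ n) f \<in> V_space \<epsilon>0 \<alpha>" using Suc int[of n] by (auto simp: V_space_iff intro: le_less_trans)
    then have "V_norm \<epsilon>0 \<alpha> ((P ^^ Suc n) f)
        \<le> ennreal \<kappa> * V_norm \<epsilon>0 \<alpha> ((P ^^ n) f) + ennreal D * L1_norm ((P ^^ n) f)"
      using LY by (simp add: lasota_yorke_def)
    also have "\<dots> \<le> ennreal \<kappa> * ennreal (?B n) + ennreal D * ennreal ?b"
      unfolding L1_norm_eq[OF int]
      by (intro add_mono mult_left_mono Suc ennreal_leI P.iterate_contraction f_int) auto
    also have "\<dots> = ennreal (\<kappa> * ?B n + D * ?b)"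
      using \<kappa> D b0 B0[of n] by (simp add: ennreal_mult[symmetric] ennreal_plus[symmetric] del: ennreal_plus)
    also have "\<kappa> * ?B n + D * ?b = ?B (Suc n)"
      using \<kappa> by (simp add: field_simps)
    finally show ?case .
  qed
  show "(P ^^ n) f \<in> V_space \<epsilon>0 \<alpha>" using bound[of n] int[of n] by (auto simp: V_space_iff intro: le_less_trans)
  show "V_norm \<epsilon>0 \<alpha> ((P ^^ n) f) \<le> ennreal (?B n)" by (rule bound)
qed

text \<open>The fixed density is only known to be integrable. Iterating \<open>P\<close> on a nearby Lipschitz function never
  increases the distance to the fixed density, while the Lasota-Yorke inequality eventually brings
  the strong norm below a bound that depends only on \<open>\<kappa>\<close> and \<open>D\<close>.\<close>

lemma fixed_density_approx:
  assumes mo: "markov_operator leb_I P" and LY: "lasota_yorke \<epsilon>0 \<alpha> P \<kappa> D"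
    and \<alpha>: "\<alpha> \<le> 1" and \<kappa>: "0 < \<kappa>" "\<kappa> < 1" and D: "0 < D"
    and g: "markov_operator.fixed_density leb_I P g" and \<delta>: "0 < \<delta>"
  obtains f where "f \<in> V_space \<epsilon>0 \<alpha>" "V_norm \<epsilon>0 \<alpha> f \<le> ennreal (1 + 2 * D / (1 - \<kappa>))"
    "L1_dist leb_I f g < \<delta>"
proof -
  interpret P: markov_operator leb_I P by (rule mo)
  have gi: "integrable leb_I g" "AE x in leb_I. 0 \<le> g x" "integral\<^sup>L leb_I g = 1"
    using g by (auto simp: P.fixed_density_def)
  \<comment> \<open>Distance below \<open>1\<close> from a density bounds \<open>\<integral> \<bar>f\<bar>\<close> by \<open>2\<close>, for every \<open>\<delta>\<close>.\<close>
  obtain f L where f: "L-lipschitz_on UNIV f" "L1_dist leb_I g f < min 1 \<delta>"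
    by (rule lipschitz_dense[OF gi(1), of "min 1 \<delta>"]) (use \<delta> in auto)
  have fV: "f \<in> V_space \<epsilon>0 \<alpha>" by (rule lipschitz_V_space[OF f(1) \<alpha>])
  have fi: "integrable leb_I f" by (rule lipschitz_integrable[OF f(1)])
  have "(\<integral>x. \<bar>g x\<bar> \<partial>leb_I) = integral\<^sup>L leb_I g"
    using gi by (intro integral_cong_AE) (auto elim: eventually_mono)
  then have f2: "(\<integral>x. \<bar>f x\<bar> \<partial>leb_I) \<le> 2"
    using L1_norm_dist_le[OF fi gi(1)] f(2) gi(3) by (simp add: L1_dist_commute)
  let ?v = "enn2real (V_norm \<epsilon>0 \<alpha> f)"
  have "(\<lambda>n. \<kappa> ^ n * ?v) \<longlonglongrightarrow> 0 * ?v"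
    using \<kappa> by (intro tendsto_mult LIMSEQ_realpow_zero tendsto_const) auto
  then have "\<forall>\<^sub>F n in sequentially. \<kappa> ^ n * ?v < 1"
    by (intro order_tendstoD(2)[of _ "0 * ?v"]) auto
  then obtain n where n: "\<kappa> ^ n * ?v < 1"
    using eventually_happens'[OF sequentially_bot] by blast
  have "V_norm \<epsilon>0 \<alpha> ((P ^^ n) f) \<le> ennreal (\<kappa> ^ n * ?v + D / (1 - \<kappa>) * (\<integral>x. \<bar>f x\<bar> \<partial>leb_I))"
    by (rule lasota_yorke_iterate[OF mo LY \<kappa> D fV])
  also have "\<dots> \<le> ennreal (1 + 2 * D / (1 - \<kappa>))"
  proof (rule ennreal_leI)
    have "D / (1 - \<kappa>) * (\<integral>x. \<bar>f x\<bar> \<partial>leb_I) \<le> D / (1 - \<kappa>) * 2"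
      using D \<kappa> f2 by (intro mult_left_mono) auto
    then show "\<kappa> ^ n * ?v + D / (1 - \<kappa>) * (\<integral>x. \<bar>f x\<bar> \<partial>leb_I) \<le> 1 + 2 * D / (1 - \<kappa>)"
      using n by (simp add: field_simps)
  qed
  finally have "V_norm \<epsilon>0 \<alpha> ((P ^^ n) f) \<le> ennreal (1 + 2 * D / (1 - \<kappa>))" .
  moreover have "L1_dist leb_I ((P ^^ n) f) g < \<delta>"
    using P.iterate_dist_fixed[OF fi g, of n] f(2) by (simp add: L1_dist_commute)
  ultimately show ?thesis
    using that lasota_yorke_iterate(1)[OF mo LY \<kappa> D fV] by blast
qed

lemma powr_inverse_nat_tendsto_0:
  assumes "0 < \<alpha>"
  shows "(\<lambda>n. B * (1 / real n) powr \<alpha>) \<longlonglongrightarrow> 0"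
proof -
  have "(\<lambda>n. (1 / real n) powr \<alpha>) \<longlonglongrightarrow> 0 powr \<alpha>"
    using assms by (intro tendsto_powr' lim_1_over_n tendsto_const) auto
  from tendsto_mult_left[OF this, of B] show ?thesis by simp
qed

lemma ex_block_scale:
  assumes "0 < \<epsilon>0"
  obtains n0 where "\<And>n. n0 \<le> n \<Longrightarrow> 0 < n" "\<And>n. n0 \<le> n \<Longrightarrow> 1 / real n \<le> \<epsilon>0"
proof -
  obtain n0 :: nat where n0: "1 / \<epsilon>0 < real n0" using reals_Archimedean2 by blast
  have pos: "0 < 1 / \<epsilon>0" using assms by simp
  have n: "0 < n" "1 / real n \<le> \<epsilon>0" if "n0 \<le> n" for n
  proof -
    have less: "1 / \<epsilon>0 < real n" using n0 that by linarith
    with pos have "0 < real n" by linarith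
    then show "0 < n" by simp
    from less \<open>0 < real n\<close> assms show "1 / real n \<le> \<epsilon>0" by (simp add: field_simps)
  qed
  then show ?thesis using that by blast
qed

lemma L1_le_V_norm:
  assumes "f \<in> V_space \<epsilon>0 \<alpha>" "V_norm \<epsilon>0 \<alpha> f \<le> ennreal B" "0 \<le> B"
  shows "(\<integral>x. \<bar>f x\<bar> \<partial>leb_I) \<le> B"
proof -
  have fi: "integrable leb_I f" using assms(1) by (simp add: V_space_iff)
  have "L1_norm f \<le> V_norm \<epsilon>0 \<alpha> f" by (simp add: V_norm_def)
  then have "ennreal (\<integral>x. \<bar>f x\<bar> \<partial>leb_I) \<le> ennreal B"
    using assms(2) by (simp add: L1_norm_eq[OF fi])
  then show ?thesis using assms(3) by simp
qed

text \<open>The iterates of the constant density are bounded in \<open>V\<^sub>\<alpha>\<close>, so their Cesaro means have a limit point,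
  which is fixed because the means are almost fixed.\<close>

lemma ex_fixed_density:
  assumes mo: "markov_operator leb_I P" and LY: "lasota_yorke \<epsilon>0 \<alpha> P \<kappa> D"
    and \<epsilon>0: "0 < \<epsilon>0" and \<alpha>: "0 < \<alpha>" "\<alpha> \<le> 1" and \<kappa>: "0 < \<kappa>" "\<kappa> < 1" and D: "0 < D"
  shows "\<exists>g. markov_operator.fixed_density leb_I P g"
proof -
  interpret P: markov_operator leb_I P by (rule mo)
  let ?f = "\<lambda>_::real. 1::real"
  let ?v = "enn2real (V_norm \<epsilon>0 \<alpha> ?f)"
  let ?B = "?v + D / (1 - \<kappa>)"
  have fV: "?f \<in> V_space \<epsilon>0 \<alpha>" by (rule lipschitz_V_space[OF lipschitz_on_constant \<alpha>(2)])
  have f: "integrable leb_I ?f" "AE x in leb_I. 0 \<le> ?f x" "integral\<^sup>L leb_I ?f = 1"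
    using leb_I.prob_space by auto
  have B: "0 \<le> ?B" using \<kappa> D by auto
  have bound: "V_norm \<epsilon>0 \<alpha> ((P ^^ n) ?f) \<le> ennreal ?B" for n
  proof -
    have "\<kappa> ^ n * ?v \<le> 1 * ?v" using \<kappa> by (intro mult_right_mono power_le_one) auto
    then have "ennreal (\<kappa> ^ n * ?v + D / (1 - \<kappa>) * (\<integral>x. \<bar>?f x\<bar> \<partial>leb_I)) \<le> ennreal ?B"
      using f(3) by (intro ennreal_leI) simp
    then show ?thesis
      using lasota_yorke_iterate(2)[OF mo LY \<kappa> D fV, of n] by (rule order_trans[rotated])
  qed
  note V = lasota_yorke_iterate(1)[OF mo LY \<kappa> D fV]
  obtain n0 where n0: "\<And>n. n0 \<le> n \<Longrightarrow> 0 < n" "\<And>n. n0 \<le> n \<Longrightarrow> 1 / real n \<le> \<epsilon>0"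
    by (rule ex_block_scale[OF \<epsilon>0]) blast
  have approx: "L1_dist leb_I (P.cesaro m ?f) (block_average n (P.cesaro m ?f)) \<le> ?B * (1 / real n) powr \<alpha>"
    if "n0 \<le> n" for m n
    unfolding P.cesaro_def[abs_def]
    by (rule mean_block_average_dist[OF P.iterate_integrable[OF f(1)]
          L1_dist_block_average_le_V_norm[OF P.iterate_integrable[OF f(1)] bound B
            n0(1)[OF that] n0(2)[OF that]]])
  have norm: "(\<integral>x. \<bar>P.cesaro m ?f x\<bar> \<partial>leb_I) \<le> 1" for m
  proof -
    have "(\<integral>x. \<bar>P.cesaro m ?f x\<bar> \<partial>leb_I) = integral\<^sup>L leb_I (P.cesaro m ?f)"
      using P.cesaro_density(1)[OF f, of m] P.cesaro_integrable[OF f(1), of m]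
      by (intro integral_cong_AE) (auto elim: eventually_mono)
    then show ?thesis by (simp add: P.cesaro_density(2)[OF f])
  qed
  obtain r g where r: "strict_mono (r :: nat \<Rightarrow> nat)" and g: "integrable leb_I g"
    "(\<lambda>m. L1_dist leb_I (P.cesaro (r m) ?f) g) \<longlonglongrightarrow> 0"
    by (rule L1_precompact[OF P.cesaro_integrable[OF f(1)] norm approx
          powr_inverse_nat_tendsto_0[OF \<alpha>(1)]]) (assumption+)
  have zero: "(\<lambda>n. 2 / real (Suc n)) \<longlonglongrightarrow> 0"
    using LIMSEQ_Suc[OF lim_const_over_n[of "2::real"]] by simp
  have "(\<lambda>n. L1_dist leb_I (P (P.cesaro n ?f)) (P.cesaro n ?f)) \<longlonglongrightarrow> 0"
  proof (rule tendsto_sandwich[OF _ _ tendsto_const zero])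
    show "\<forall>\<^sub>F n in sequentially. L1_dist leb_I (P (P.cesaro n ?f)) (P.cesaro n ?f) \<le> 2 / real (Suc n)"
      using P.cesaro_almost_fixed[OF f(1)] f(3) by (intro always_eventually allI) simp
  qed simp
  from LIMSEQ_subseq_LIMSEQ[OF this r]
  have "(\<lambda>n. L1_dist leb_I (P (P.cesaro (r n) ?f)) (P.cesaro (r n) ?f)) \<longlonglongrightarrow> 0"
    by (simp add: o_def)
  then have "P.fixed_density g"
    by (rule P.almost_fixed_limit[OF P.cesaro_integrable[OF f(1)] P.cesaro_density[OF f] g])
  then show ?thesis by blast
qed

text \<open>The bound of \<open>fixed_density_approx\<close> is uniform in the noise level. Along noise levels that tend to \<open>0\<close>,
  fixed densities \<open>g\<^sub>n\<close> therefore accumulate at some \<open>g\<close>, and the closeness of the operators on \<open>V\<^sub>\<alpha>\<close> gives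
  \<open>\<parallel>L g\<^sub>n - g\<^sub>n\<parallel> \<rightarrow> 0\<close>. So \<open>g\<close> is fixed by \<open>L\<close>, and there is only one candidate, \<open>h\<close>. The convergence is uniform
  over all fixed densities at a given noise level, which also gives their uniqueness later.\<close>

lemma fixed_densities_converge:
  fixes P :: "real \<Rightarrow> (real \<Rightarrow> real) \<Rightarrow> real \<Rightarrow> real"
  assumes e: "0 < e" and \<epsilon>0: "0 < \<epsilon>0" and \<alpha>: "0 < \<alpha>" "\<alpha> \<le> 1"
    and \<kappa>: "0 < \<kappa>" "\<kappa> < 1" and D: "0 < D"
    and L: "markov_operator leb_I L"
    and P: "\<And>\<epsilon>. \<epsilon> \<in> {0<..e} \<Longrightarrow> markov_operator leb_I (P \<epsilon>)"
    and LY: "\<And>\<epsilon>. \<epsilon> \<in> {0<..e} \<Longrightarrow> lasota_yorke \<epsilon>0 \<alpha> (P \<epsilon>) \<kappa> D"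
    and hom: "\<And>\<epsilon> c f x. L (\<lambda>x. c * f x) x - P \<epsilon> (\<lambda>x. c * f x) x = c * (L f x - P \<epsilon> f x)"
    and close: "\<And>\<epsilon>. \<epsilon> \<in> {0<..e} \<Longrightarrow> mixed_norm \<epsilon>0 \<alpha> (\<lambda>f x. L f x - P \<epsilon> f x) \<le> ennreal (\<upsilon> \<epsilon>)"
    and \<upsilon>: "\<And>\<epsilon>. 0 \<le> \<upsilon> \<epsilon>" "(\<upsilon> \<longlongrightarrow> 0) (at_right 0)"
    and unique: "\<And>g. markov_operator.fixed_density leb_I L g \<Longrightarrow> AE x in leb_I. g x = h x"
    and h: "integrable leb_I h" and \<delta>: "0 < \<delta>"
  shows "\<forall>\<^sub>F \<epsilon> in at_right 0. \<forall>g. markov_operator.fixed_density leb_I (P \<epsilon>) g \<longrightarrow> L1_dist leb_I g h < \<delta>"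
proof (rule ccontr)
  interpret L: markov_operator leb_I L by (rule L)
  let ?fixed = "\<lambda>\<epsilon>. markov_operator.fixed_density leb_I (P \<epsilon>)"
  assume "\<not> ?thesis"
  then have bad: "\<exists>\<epsilon>>0. \<epsilon> < b \<and> (\<exists>g. ?fixed \<epsilon> g \<and> \<not> L1_dist leb_I g h < \<delta>)" if "0 < b" for b
    using that by (auto simp: eventually_at_right_field)
  have "\<forall>n. \<exists>\<epsilon> g. 0 < \<epsilon> \<and> \<epsilon> < min e (1 / real (Suc n)) \<and> ?fixed \<epsilon> g \<and> \<not> L1_dist leb_I g h < \<delta>"
    using bad e by (metis min_less_iff_conj of_nat_0_less_iff zero_less_Suc zero_less_divide_1_iff)
  then obtain \<epsilon> g where \<epsilon>: "\<And>n. 0 < \<epsilon> n" "\<And>n. \<epsilon> n < e" "\<And>n. \<epsilon> n < 1 / real (Suc n)"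
    and g: "\<And>n. ?fixed (\<epsilon> n) (g n)" "\<And>n. \<not> L1_dist leb_I (g n) h < \<delta>"
    by (metis min_less_iff_conj)
  have \<epsilon>e: "\<epsilon> n \<in> {0<..e}" for n using \<epsilon>(1,2)[of n] by simp
  have "\<epsilon> \<longlonglongrightarrow> 0"
    by (rule tendsto_sandwich[OF _ _ tendsto_const LIMSEQ_Suc[OF lim_1_over_n]])
       (use \<epsilon> in \<open>auto intro!: always_eventually less_imp_le\<close>)
  then have "filterlim \<epsilon> (at_right 0) sequentially"
    using \<epsilon>(1) by (auto simp: filterlim_at less_imp_neq[THEN not_sym])
  then have \<upsilon>\<epsilon>: "(\<lambda>n. \<upsilon> (\<epsilon> n)) \<longlonglongrightarrow> 0" by (rule filterlim_compose[OF \<upsilon>(2)])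
  define B where "B = 1 + 2 * D / (1 - \<kappa>)"
  have B: "0 < B" using D \<kappa> by (auto simp: B_def intro!: add_pos_nonneg)
  have "\<exists>f. f \<in> V_space \<epsilon>0 \<alpha> \<and> V_norm \<epsilon>0 \<alpha> f \<le> ennreal B \<and> L1_dist leb_I f (g n) < 1 / real (Suc n)" for n
  proof -
    have "0 < 1 / real (Suc n)" by simp
    from fixed_density_approx[OF P[OF \<epsilon>e] LY[OF \<epsilon>e] \<alpha>(2) \<kappa> D g(1)[of n] this]
    show ?thesis unfolding B_def by blast
  qed
  then obtain f where f: "\<And>n. f n \<in> V_space \<epsilon>0 \<alpha>" "\<And>n. V_norm \<epsilon>0 \<alpha> (f n) \<le> ennreal B"
    and fg: "\<And>n. L1_dist leb_I (f n) (g n) < 1 / real (Suc n)" by metis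
  have fi: "integrable leb_I (f n)" for n using f(1)[of n] by (simp add: V_space_iff)
  have gd: "integrable leb_I (g n)" "AE x in leb_I. 0 \<le> g n x" "integral\<^sup>L leb_I (g n) = 1"
    "AE x in leb_I. P (\<epsilon> n) (g n) x = g n x" for n
    using g(1)[of n] markov_operator.fixed_density_def[OF P[OF \<epsilon>e]] by auto
  have fg0: "(\<lambda>n. L1_dist leb_I (f n) (g n)) \<longlonglongrightarrow> 0"
    by (rule tendsto_sandwich[OF _ _ tendsto_const LIMSEQ_Suc[OF lim_1_over_n]])
       (use fg in \<open>auto intro!: always_eventually less_imp_le\<close>)
  obtain n0 where n0: "\<And>n. n0 \<le> n \<Longrightarrow> 0 < n" "\<And>n. n0 \<le> n \<Longrightarrow> 1 / real n \<le> \<epsilon>0"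
    by (rule ex_block_scale[OF \<epsilon>0]) blast
  obtain r g0 where r: "strict_mono (r :: nat \<Rightarrow> nat)" and g0: "integrable leb_I g0"
    "(\<lambda>m. L1_dist leb_I (f (r m)) g0) \<longlonglongrightarrow> 0"
    by (rule L1_precompact[OF fi L1_le_V_norm[OF f less_imp_le[OF B]]
          L1_dist_block_average_le_V_norm[OF fi f(2) less_imp_le[OF B] n0]
          powr_inverse_nat_tendsto_0[OF \<alpha>(1)]]) (assumption+)
  have g_lim: "(\<lambda>n. L1_dist leb_I (g (r n)) g0) \<longlonglongrightarrow> 0"
  proof (rule tendsto_sandwich[OF _ _ tendsto_const])
    show "(\<lambda>n. L1_dist leb_I (f (r n)) (g (r n)) + L1_dist leb_I (f (r n)) g0) \<longlonglongrightarrow> 0"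
      using tendsto_add[OF LIMSEQ_subseq_LIMSEQ[OF fg0 r] g0(2)] by (simp add: o_def)
    show "\<forall>\<^sub>F n in sequentially. L1_dist leb_I (g (r n)) g0
        \<le> L1_dist leb_I (f (r n)) (g (r n)) + L1_dist leb_I (f (r n)) g0"
    proof (intro always_eventually allI)
      fix n show "L1_dist leb_I (g (r n)) g0 \<le> L1_dist leb_I (f (r n)) (g (r n)) + L1_dist leb_I (f (r n)) g0"
        using L1_dist_triangle[OF gd(1)[of "r n"] fi[of "r n"] g0(1)] by (simp add: L1_dist_commute)
    qed
  qed simp
  \<comment> \<open>Compare \<open>L g\<^sub>n\<close> with \<open>L f\<^sub>n\<close>, then with \<open>P f\<^sub>n\<close>, then with \<open>P g\<^sub>n = g\<^sub>n\<close>; only \<open>f\<^sub>n\<close> is known to lie in \<open>V\<^sub>\<alpha>\<close>.\<close>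
  have Lg: "L1_dist leb_I (L (g n)) (g n) \<le> 2 * L1_dist leb_I (f n) (g n) + B * \<upsilon> (\<epsilon> n)" for n
  proof -
    interpret Pn: markov_operator leb_I "P (\<epsilon> n)" by (rule P[OF \<epsilon>e])
    note i = L.P_integrable[OF gd(1)[of n]] L.P_integrable[OF fi[of n]]
      Pn.P_integrable[OF fi[of n]] Pn.P_integrable[OF gd(1)[of n]]
    have "L1_norm (\<lambda>x. L (f n) x - P (\<epsilon> n) (f n) x)
        \<le> ennreal B * mixed_norm \<epsilon>0 \<alpha> (\<lambda>f x. L f x - P (\<epsilon> n) f x)"
      by (rule L1_norm_le_mixed_norm[where A = "\<lambda>f x. L f x - P (\<epsilon> n) f x", OF hom f(1) f(2) B])
    also have "\<dots> \<le> ennreal B * ennreal (\<upsilon> (\<epsilon> n))"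
      by (intro mult_left_mono close \<epsilon>e) simp
    finally have "L1_dist leb_I (L (f n)) (P (\<epsilon> n) (f n)) \<le> B * \<upsilon> (\<epsilon> n)"
      using i B \<upsilon>(1)[of "\<epsilon> n"] by (simp add: L1_norm_eq L1_dist_def ennreal_mult[symmetric])
    moreover have "L1_dist leb_I (P (\<epsilon> n) (f n)) (g n) \<le> L1_dist leb_I (f n) (g n)"
      using Pn.iterate_dist_fixed[OF fi[of n] g(1)[of n], of 1] by simp
    ultimately show ?thesis
      using L1_dist_triangle[OF i(1,2) gd(1)[of n]] L1_dist_triangle[OF i(2,3) gd(1)[of n]]
        L.P_dist[OF gd(1)[of n] fi[of n]] L1_dist_commute[of leb_I "f n" "g n"] by linarith
  qed
  have "(\<lambda>n. L1_dist leb_I (L (g n)) (g n)) \<longlonglongrightarrow> 0"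
  proof (rule tendsto_sandwich[OF _ _ tendsto_const])
    show "(\<lambda>n. 2 * L1_dist leb_I (f n) (g n) + B * \<upsilon> (\<epsilon> n)) \<longlonglongrightarrow> 0"
      using tendsto_add[OF tendsto_mult_left[OF fg0, of 2] tendsto_mult_left[OF \<upsilon>\<epsilon>, of B]] by simp
  qed (use Lg in auto)
  from LIMSEQ_subseq_LIMSEQ[OF this r]
  have "(\<lambda>n. L1_dist leb_I (L (g (r n))) (g (r n))) \<longlonglongrightarrow> 0" by (simp add: o_def)
  then have "L.fixed_density g0"
    by (rule L.almost_fixed_limit[OF gd(1) gd(2) gd(3) g0(1) g_lim])
  from unique[OF this] have "L1_dist leb_I (g (r n)) h = L1_dist leb_I (g (r n)) g0" for n
    using gd(1) h g0(1) by (intro L1_dist_cong_AE) (auto elim: eventually_mono)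
  then have "(\<lambda>n. L1_dist leb_I (g (r n)) h) \<longlonglongrightarrow> 0" using g_lim by simp
  from order_tendstoD(2)[OF this \<delta>] show False
    using g(2) by (auto simp: eventually_sequentially)
qed

section \<open>Cusp maps and their transfer operators\<close>

definition closed_branch :: "real \<Rightarrow> nat \<Rightarrow> real set" where
  "closed_branch c j = insert c (branch_dom c j)"

definition open_branch :: "real \<Rightarrow> nat \<Rightarrow> real set" where
  "open_branch c j = (if j = 1 then {0<..<c} else {c<..<1})"

lemma cusp_map_le_1: "cusp_map T c \<Longrightarrow> x \<in> I \<Longrightarrow> 0 \<le> T x \<and> T x \<le> 1"
  unfolding cusp_map_def by (metis atLeastAtMost_iff image_subset_iff)

lemma cusp_map_left_mono:
  assumes T: "cusp_map T c" and x: "0 \<le> x" "x < y" "y \<le> c"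
  shows "T x < T y"
proof (cases "y = c")
  case True
  have c: "0 < c" "c < 1" "T c = 1" and mono: "strict_mono_on {0..<c} T"
    using T by (auto simp: cusp_map_def)
  let ?m = "(x + c) / 2"
  have "T x < T ?m" using x True by (intro strict_mono_onD[OF mono]) auto
  also have "T ?m \<le> 1" using cusp_map_le_1[OF T, of ?m] x True c by auto
  finally show ?thesis using True c by simp
next
  case False
  have mono: "strict_mono_on {0..<c} T" using T by (auto simp: cusp_map_def)
  show ?thesis using x False by (intro strict_mono_onD[OF mono]) auto
qed

lemma cusp_map_right_antimono:
  assumes T: "cusp_map T c" and x: "c \<le> x" "x < y" "y \<le> 1"
  shows "T y < T x"
proof (cases "x = c")
  case True
  have c: "0 < c" "c < 1" "T c = 1" and mono: "strict_antimono_on {c<..1} T"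
    using T by (auto simp: cusp_map_def)
  let ?m = "(c + y) / 2"
  have "T y < T ?m" using x True by (intro monotone_onD[OF mono]) auto
  also have "T ?m \<le> 1" using cusp_map_le_1[OF T, of ?m] x True c by auto
  finally show ?thesis using True c by simp
next
  case False
  have mono: "strict_antimono_on {c<..1} T" using T by (auto simp: cusp_map_def)
  show ?thesis using x False by (intro monotone_onD[OF mono]) auto
qed

lemma closed_branch_eq: "0 < c \<Longrightarrow> c < 1 \<Longrightarrow> closed_branch c j = (if j = 1 then {0..c} else {c..1})"
  by (auto simp: closed_branch_def branch_dom_def)

lemma closed_branch_bij:
  assumes T: "cusp_map T c"
  shows "bij_betw T (closed_branch c j) I"
proof -
  have c: "0 < c" "c < 1" "T 0 = 0" "T 1 = 0" "T c = 1" and cont: "continuous_on I T"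
    using T by (auto simp: cusp_map_def)
  note eq = closed_branch_eq[OF c(1,2)]
  have sub: "closed_branch c j \<subseteq> I" using c by (auto simp: eq)
  have inj: "inj_on T (closed_branch c j)"
  proof (rule linorder_inj_onI)
    fix x y assume "x < y" "x \<in> closed_branch c j" "y \<in> closed_branch c j"
    then show "T x \<noteq> T y"
      using cusp_map_left_mono[OF T, of x y] cusp_map_right_antimono[OF T, of x y]
      by (auto simp: eq split: if_splits)
  qed auto
  have "I \<subseteq> T ` closed_branch c j"
  proof
    fix z :: real assume z: "z \<in> I"
    show "z \<in> T ` closed_branch c j"
    proof (cases "j = 1")
      case True
      have "\<exists>x. 0 \<le> x \<and> x \<le> c \<and> T x = z"
        using z c by (intro IVT') (auto intro: continuous_on_subset[OF cont])
      then show ?thesis using True by (auto simp: eq)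
    next
      case False
      have "\<exists>x. c \<le> x \<and> x \<le> 1 \<and> T x = z"
        using z c by (intro IVT2') (auto intro: continuous_on_subset[OF cont])
      then show ?thesis using False by (auto simp: eq)
    qed
  qed
  moreover have "T ` closed_branch c j \<subseteq> I"
    using cusp_map_le_1[OF T] sub by auto
  ultimately show ?thesis using inj by (auto simp: bij_betw_def)
qed

lemma
  assumes T: "cusp_map T c"
  shows inv_branch_closed: "z \<in> I \<Longrightarrow> inv_branch T c j z \<in> closed_branch c j"
    and apply_inv_branch: "z \<in> I \<Longrightarrow> T (inv_branch T c j z) = z"
    and inv_branch_apply: "x \<in> closed_branch c j \<Longrightarrow> inv_branch T c j (T x) = x"
  using closed_branch_bij[OF T, of j]
  unfolding inv_branch_def closed_branch_def[symmetric] bij_betw_def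
  by (auto simp: inv_into_into f_inv_into_f inv_into_f_f)

lemma inv_branch_open:
  assumes T: "cusp_map T c" and z: "0 < z" "z < 1"
  shows "inv_branch T c j z \<in> open_branch c j"
proof -
  have c: "0 < c" "c < 1" "T 0 = 0" "T 1 = 0" "T c = 1" using T by (auto simp: cusp_map_def)
  have "z \<in> I" using z by simp
  note inv_branch_closed[OF T this, of j] apply_inv_branch[OF T this, of j]
  moreover from this(2) have "inv_branch T c j z \<noteq> 0" "inv_branch T c j z \<noteq> 1" "inv_branch T c j z \<noteq> c"
    using z c by auto
  ultimately show ?thesis
    by (auto simp: closed_branch_eq[OF c(1,2)] open_branch_def split: if_splits)
qed

lemma open_branch_subset: "cusp_map T c \<Longrightarrow> open_branch c j \<subseteq> {0<..<1} - {c}"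
  by (auto simp: cusp_map_def open_branch_def split: if_splits)

lemma open_branch_sets: "cusp_map T c \<Longrightarrow> open_branch c j \<in> sets leb_I"
  using open_branch_subset[of T c j] by (auto simp: sets_leb_I open_branch_def)

lemma open_branch_closed: "cusp_map T c \<Longrightarrow> open_branch c j \<subseteq> closed_branch c j"
  by (auto simp: cusp_map_def open_branch_def closed_branch_eq split: if_splits)

lemma image_open_branch:
  assumes T: "cusp_map T c"
  shows "T ` open_branch c j = {0<..<1}"
proof
  have c: "0 < c" "c < 1" "T 0 = 0" "T 1 = 0" "T c = 1" using T by (auto simp: cusp_map_def)
  show "T ` open_branch c j \<subseteq> {0<..<1}"
  proof (rule image_subsetI)
    fix x assume "x \<in> open_branch c j"
    then show "T x \<in> {0<..<1}"
      using cusp_map_left_mono[OF T, of 0 x] cusp_map_left_mono[OF T, of x c]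
        cusp_map_right_antimono[OF T, of x 1] cusp_map_right_antimono[OF T, of c x] c
      by (auto simp: open_branch_def split: if_splits)
  qed
  show "{0<..<1} \<subseteq> T ` open_branch c j"
  proof
    fix z :: real assume "z \<in> {0<..<1}"
    then show "z \<in> T ` open_branch c j"
      using inv_branch_open[OF T, of z j] apply_inv_branch[OF T, of z j] by (intro image_eqI) auto
  qed
qed

lemma cusp_map_deriv:
  assumes T: "cusp_map T c" and x: "x \<in> I - {c}"
  shows "(T has_field_derivative DI T x) (at x within I)" and "DI T x \<noteq> 0"
proof -
  have "T differentiable (at x within I)" "DI T x \<noteq> 0"
    using T x unfolding cusp_map_def by blast+
  then show "(T has_field_derivative DI T x) (at x within I)" "DI T x \<noteq> 0"
    using vector_derivative_works[of T "at x within I"]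
    by (simp_all add: DI_def has_real_derivative_iff_has_vector_derivative)
qed

text \<open>On the left branch \<open>T q \<ge> z\<close> says that \<open>q\<close> is to the right of the preimage of \<open>z\<close>, on the
  right branch that it is to the left.\<close>

lemma inv_branch_left_less_iff:
  assumes T: "cusp_map T c" and z: "0 < z" "z < 1"
  shows "inv_branch T c 1 z < t \<longleftrightarrow> (\<exists>q\<in>\<rat> \<inter> I. q < t \<and> z \<le> T q)"
proof
  have c: "0 < c" "c < 1" using T by (auto simp: cusp_map_def)
  let ?v = "inv_branch T c 1 z"
  have v: "0 < ?v" "?v < c" and Tv: "T ?v = z"
    using inv_branch_open[OF T z, of 1] apply_inv_branch[OF T, of z 1] z by (auto simp: open_branch_def)
  {
    assume "?v < t"
    then obtain q where q: "q \<in> \<rat>" "?v < q" "q < min t c"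
      using Rats_dense_in_real[of ?v "min t c"] v by auto
    then show "\<exists>q\<in>\<rat> \<inter> I. q < t \<and> z \<le> T q"
      using cusp_map_left_mono[OF T, of ?v q] v c Tv by (intro bexI[of _ q]) auto
  next
    assume "\<exists>q\<in>\<rat> \<inter> I. q < t \<and> z \<le> T q"
    then obtain q where q: "q \<in> I" "q < t" "z \<le> T q" by auto
    have "?v \<le> q"
    proof (rule ccontr)
      assume "\<not> ?v \<le> q"
      then show False using cusp_map_left_mono[OF T, of q ?v] q v Tv by auto
    qed
    then show "?v < t" using q by simp
  }
qed

lemma inv_branch_right_greater_iff:
  assumes T: "cusp_map T c" and z: "0 < z" "z < 1"
  shows "t < inv_branch T c 2 z \<longleftrightarrow> (\<exists>q\<in>\<rat> \<inter> I. t < q \<and> z \<le> T q)"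
proof
  have c: "0 < c" "c < 1" using T by (auto simp: cusp_map_def)
  let ?v = "inv_branch T c 2 z"
  have v: "c < ?v" "?v < 1" and Tv: "T ?v = z"
    using inv_branch_open[OF T z, of 2] apply_inv_branch[OF T, of z 2] z by (auto simp: open_branch_def)
  {
    assume "t < ?v"
    then obtain q where q: "q \<in> \<rat>" "max t c < q" "q < ?v"
      using Rats_dense_in_real[of "max t c" ?v] v by auto
    then show "\<exists>q\<in>\<rat> \<inter> I. t < q \<and> z \<le> T q"
      using cusp_map_right_antimono[OF T, of q ?v] v c Tv by (intro bexI[of _ q]) auto
  next
    assume "\<exists>q\<in>\<rat> \<inter> I. t < q \<and> z \<le> T q"
    then obtain q where q: "q \<in> I" "t < q" "z \<le> T q" by auto
    have "q \<le> ?v"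
    proof (rule ccontr)
      assume "\<not> q \<le> ?v"
      then show False using cusp_map_right_antimono[OF T, of ?v q] q v Tv by auto
    qed
    then show "t < ?v" using q by simp
  }
qed

lemma
  fixes g :: "real \<Rightarrow> real"
  assumes U: "U \<subseteq> I" and g: "(\<lambda>x. indicator U x * g x) \<in> borel_measurable leb_I"
  shows integrable_leb_I_iff: "integrable leb_I (\<lambda>x. indicator U x * g x) \<longleftrightarrow> set_integrable lebesgue U g"
    and integral_leb_I: "(\<integral>x. indicator U x * g x \<partial>leb_I) = set_lebesgue_integral lebesgue U g"
proof -
  have eq: "indicator I x * (indicator U x * g x) = indicator U x * g x" for x
    using U by (auto simp: indicator_def)
  have meas: "(\<lambda>x. indicator U x * g x) \<in> borel_measurable lborel"
    using g by (subst (asm) borel_measurable_restrict_space_iff) (auto simp: eq)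
  show "integrable leb_I (\<lambda>x. indicator U x * g x) \<longleftrightarrow> set_integrable lebesgue U g"
    using integrable_completion[OF meas]
    by (subst integrable_restrict_space) (auto simp: eq set_integrable_def)
  show "(\<integral>x. indicator U x * g x \<partial>leb_I) = set_lebesgue_integral lebesgue U g"
    using integral_completion[OF meas]
    by (subst integral_restrict_space) (auto simp: eq set_lebesgue_integral_def)
qed

text \<open>The derivative is unbounded at the cusp, so variables are changed on the open branch, where \<open>T\<close> is
  injective and differentiable, with image the open unit interval.\<close>

lemma branch_change_of_variables:
  fixes T f :: "real \<Rightarrow> real" and c :: real and j :: nat
  defines "F \<equiv> \<lambda>z. f (inv_branch T c j z) * potential T (inv_branch T c j z)"
  assumes T: "cusp_map T c" and f: "integrable leb_I f"
    and meas: "(\<lambda>z. indicator {0<..<1} z * F z) \<in> borel_measurable leb_I"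
  shows "integrable leb_I (\<lambda>z. indicator {0<..<1} z * F z)"
    and "(\<integral>z. indicator {0<..<1} z * F z \<partial>leb_I) = (\<integral>x. indicator (open_branch c j) x * f x \<partial>leb_I)"
proof -
  let ?U = "open_branch c j"
  have sub: "?U \<subseteq> I" "?U \<subseteq> {0<..<1}" "?U \<subseteq> I - {c}" using open_branch_subset[OF T, of j] by auto
  have UI: "?U \<in> sets leb_I" by (rule open_branch_sets[OF T])
  then have Ub: "?U \<in> sets borel" by (simp add: sets_leb_I)
  have intU: "integrable leb_I (\<lambda>x. indicator ?U x * f x)"
    using integrable_mult_indicator[OF UI f] by simp
  then have measU: "(\<lambda>x. indicator ?U x * f x) \<in> borel_measurable leb_I" by auto
  have fU: "set_integrable lebesgue ?U f"
    using intU integrable_leb_I_iff[OF sub(1) measU] by blast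
  have simpl: "\<bar>DI T x\<bar> * F (T x) = f x" if "x \<in> ?U" for x
    using that cusp_map_deriv(2)[OF T, of x] sub(3) open_branch_closed[OF T, of j]
    by (simp add: F_def potential_def inv_branch_apply[OF T] subset_iff)
  have fU': "set_integrable lebesgue ?U (\<lambda>x. \<bar>DI T x\<bar> * F (T x))"
    using fU by (rule set_integrable_cong[THEN iffD1, rotated -1]) (auto simp: simpl)
  have CoV: "(\<lambda>x. \<bar>DI T x\<bar> * F (T x)) absolutely_integrable_on ?U \<and>
      integral ?U (\<lambda>x. \<bar>DI T x\<bar> * F (T x)) = b
    \<longleftrightarrow> F absolutely_integrable_on (T ` ?U) \<and> integral (T ` ?U) (F) = b" for b
  proof (rule has_absolute_integral_change_of_variables_1')
    show "?U \<in> sets lebesgue" using Ub by simp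
    show "(T has_field_derivative DI T x) (at x within ?U)" if "x \<in> ?U" for x
      using that sub by (intro DERIV_subset[OF cusp_map_deriv(1)[OF T]]) auto
    show "inj_on T ?U"
      using closed_branch_bij[OF T, of j] open_branch_closed[OF T, of j]
      by (auto simp: bij_betw_def intro: inj_on_subset)
  qed
  have F: "F absolutely_integrable_on {0<..<1}"
      "integral {0<..<1} (F) = integral ?U (\<lambda>x. \<bar>DI T x\<bar> * F (T x))"
    using CoV[of "integral ?U (\<lambda>x. \<bar>DI T x\<bar> * F (T x))"] fU' image_open_branch[OF T, of j] by auto
  have sub1: "{0<..<1} \<subseteq> I" by auto
  show "integrable leb_I (\<lambda>z. indicator {0<..<1} z * F z)"
    using F(1) integrable_leb_I_iff[OF sub1 meas] by blast
  have "(\<integral>z. indicator {0<..<1} z * F z \<partial>leb_I) = integral {0<..<1} (F)"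
    using integral_leb_I[OF sub1 meas] set_lebesgue_integral_eq_integral(2)[OF F(1)] by simp
  also have "\<dots> = integral ?U f"
    unfolding F(2) by (rule Henstock_Kurzweil_Integration.integral_cong) (rule simpl)
  also have "\<dots> = (\<integral>x. indicator ?U x * f x \<partial>leb_I)"
    using integral_leb_I[OF sub(1) measU] set_lebesgue_integral_eq_integral(2)[OF fU] by simp
  finally show "(\<integral>z. indicator {0<..<1} z * F z \<partial>leb_I) = (\<integral>x. indicator ?U x * f x \<partial>leb_I)" .
qed

lemma transfer_integral:
  assumes T: "cusp_map T c" and f: "integrable leb_I f"
    and meas: "\<And>j. j \<in> {1, 2} \<Longrightarrow> (\<lambda>z. indicator {0<..<1} z *
        (f (inv_branch T c j z) * potential T (inv_branch T c j z))) \<in> borel_measurable leb_I"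
  shows "integrable leb_I (\<lambda>z. indicator {0<..<1} z * transfer T c f z)"
    and "(\<integral>z. indicator {0<..<1} z * transfer T c f z \<partial>leb_I) = integral\<^sup>L leb_I f"
proof -
  let ?F = "\<lambda>j z. indicator {0<..<1} z * (f (inv_branch T c j z) * potential T (inv_branch T c j z))"
  have eq: "indicator {0<..<1} z * transfer T c f z = ?F 1 z + ?F 2 z" for z
    by (simp add: transfer_def algebra_simps)
  note F = branch_change_of_variables[OF T f meas]
  have F1: "integrable leb_I (?F 1)" "integrable leb_I (?F 2)"
    by (rule F(1); simp)+
  show "integrable leb_I (\<lambda>z. indicator {0<..<1} z * transfer T c f z)"
    unfolding eq using F1 by auto
  have ind: "integrable leb_I (\<lambda>x. indicator (open_branch c j) x * f x)" for j
    using integrable_mult_indicator[OF open_branch_sets[OF T] f] by simp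
  have "(\<integral>z. indicator {0<..<1} z * transfer T c f z \<partial>leb_I)
      = (\<integral>x. indicator (open_branch c 1) x * f x \<partial>leb_I) + (\<integral>x. indicator (open_branch c 2) x * f x \<partial>leb_I)"
    unfolding eq using F1 F(2)[of 1] F(2)[of 2] by simp
  also have "\<dots> = (\<integral>x. indicator (open_branch c 1) x * f x + indicator (open_branch c 2) x * f x \<partial>leb_I)"
    using ind by simp
  also have "\<dots> = integral\<^sup>L leb_I f"
  proof (rule integral_cong_AE)
    show "AE x in leb_I. indicator (open_branch c 1) x * f x + indicator (open_branch c 2) x * f x = f x"
      using AE_leb_I_neq[of 0] AE_leb_I_neq[of c] AE_leb_I_neq[of 1] AE_space[of leb_I]
      by eventually_elim (use T in \<open>auto simp: open_branch_def indicator_def cusp_map_def\<close>)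
  qed (use ind[THEN borel_measurable_integrable] f in auto)
  finally show "(\<integral>z. indicator {0<..<1} z * transfer T c f z \<partial>leb_I) = integral\<^sup>L leb_I f" .
qed

lemma AE_leb_I_not_endpoint: "AE x in leb_I. 0 < x \<and> x < 1"
  using AE_leb_I_neq[of 0] AE_leb_I_neq[of 1] AE_space[of leb_I] by eventually_elim auto

section \<open>Random families of cusp maps\<close>

locale cusp_family = prob_space \<Lambda> for \<Lambda> :: "'b measure" +
  fixes S :: "'b \<Rightarrow> real \<Rightarrow> real" and d :: "'b \<Rightarrow> real"
  assumes cusp: "\<And>\<eta>. cusp_map (S \<eta>) (d \<eta>)"
    and meas: "\<And>x. x \<in> I \<Longrightarrow> (\<lambda>\<eta>. S \<eta> x) \<in> borel_measurable \<Lambda>"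
begin

sublocale pair: pair_sigma_finite \<Lambda> leb_I ..

abbreviation N :: "('b \<times> real) measure" where "N \<equiv> \<Lambda> \<Otimes>\<^sub>M leb_I"

lemma snd_N [measurable]: "snd \<in> borel_measurable N"
proof -
  have "(\<lambda>x. x) \<in> borel_measurable leb_I" by (rule measurable_restrict_space1) simp
  from measurable_compose[OF measurable_snd[of \<Lambda> leb_I] this] show ?thesis by simp
qed

text \<open>A function that is measurable in \<open>\<eta>\<close> and continuous in \<open>x\<close> is jointly measurable, as the limit
  of its evaluations on a grid in \<open>x\<close>.\<close>

lemma S_joint: "(\<lambda>p. S (fst p) (snd p)) \<in> borel_measurable N"
proof -
  \<comment> \<open>Clamping keeps every grid point in \<open>I\<close>, where measurability in \<open>\<eta>\<close> is assumed.\<close>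
  define q where "q m x = max 0 (min 1 (of_int \<lfloor>real (Suc m) * x\<rfloor> / real (Suc m)))" for m :: nat and x :: real
  show ?thesis
  proof (rule borel_measurable_LIMSEQ_real[where u = "\<lambda>m p. S (fst p) (q m (snd p))"])
    fix p assume "p \<in> space N"
    then have x: "snd p \<in> I" by (auto simp: space_pair_measure)
    have cont: "continuous_on I (S (fst p))" using cusp[of "fst p"] by (simp add: cusp_map_def)
    have "(\<lambda>m. q m (snd p)) \<longlonglongrightarrow> snd p"
    proof (rule LIMSEQ_I)
      fix e :: real assume "0 < e"
      then obtain n where n: "1 / real (Suc n) < e" using nat_approx_posE by blast
      have "\<bar>q m (snd p) - snd p\<bar> < e" if "m \<ge> n" for m
      proof -
        let ?y = "of_int \<lfloor>real (Suc m) * snd p\<rfloor> / real (Suc m)"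
        have "\<bar>of_int \<lfloor>real (Suc m) * snd p\<rfloor> - real (Suc m) * snd p\<bar> \<le> 1" by linarith
        moreover have "?y - snd p = (of_int \<lfloor>real (Suc m) * snd p\<rfloor> - real (Suc m) * snd p) / real (Suc m)"
          by (simp add: diff_divide_distrib del: of_nat_Suc)
        ultimately have "\<bar>?y - snd p\<bar> \<le> 1 / real (Suc m)"
          by (simp add: divide_right_mono del: of_nat_Suc)
        moreover have "1 / real (Suc m) \<le> 1 / real (Suc n)" using that by (simp add: frac_le)
        ultimately have "\<bar>?y - snd p\<bar> < e" using n by linarith
        moreover have "\<bar>max 0 (min 1 y) - snd p\<bar> \<le> \<bar>y - snd p\<bar>" for y
          using x by (auto simp: max_def min_def)
        then have "\<bar>q m (snd p) - snd p\<bar> \<le> \<bar>?y - snd p\<bar>" unfolding q_def .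
        ultimately show ?thesis by linarith
      qed
      then show "\<exists>no. \<forall>m\<ge>no. norm (q m (snd p) - snd p) < e" by (intro exI[of _ n]) simp
    qed
    then show "(\<lambda>m. S (fst p) (q m (snd p))) \<longlonglongrightarrow> S (fst p) (snd p)"
      by (rule continuous_on_tendsto_compose[OF cont _ x]) (auto simp: q_def)
  next
    fix m :: nat
    let ?g = "\<lambda>i p. S (fst p) (max 0 (min 1 (of_int i / real (Suc m))))"
    have "(\<lambda>p. ?g \<lfloor>real (Suc m) * snd p\<rfloor> p) \<in> borel_measurable N"
    proof (rule measurable_compose_countable[where f = ?g and g = "\<lambda>p. \<lfloor>real (Suc m) * snd p\<rfloor>"])
      show "?g i \<in> borel_measurable N" for i :: int
        by (rule measurable_compose[OF measurable_fst meas]) auto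
      show "(\<lambda>p. \<lfloor>real (Suc m) * snd p\<rfloor>) \<in> N \<rightarrow>\<^sub>M count_space UNIV" by measurable
    qed
    then show "(\<lambda>p. S (fst p) (q m (snd p))) \<in> borel_measurable N"
      by (simp add: q_def)
  qed
qed

lemma S_compose:
  assumes "a \<in> N \<rightarrow>\<^sub>M leb_I"
  shows "(\<lambda>p. S (fst p) (a p)) \<in> borel_measurable N"
proof -
  have "(\<lambda>p. (fst p, a p)) \<in> N \<rightarrow>\<^sub>M N" using assms by measurable
  from measurable_compose[OF this S_joint] show ?thesis by simp
qed

text \<open>The preimage of an interior point; the endpoints form a null set and get an arbitrary value.\<close>

definition preimage :: "nat \<Rightarrow> 'b \<times> real \<Rightarrow> real" where
  "preimage j p = (if 0 < snd p \<and> snd p < 1 then inv_branch (S (fst p)) (d (fst p)) j (snd p) else 1/2)"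

lemma preimage_in_I: "0 < preimage j p \<and> preimage j p < 1"
proof (cases "0 < snd p \<and> snd p < 1")
  case True
  then show ?thesis
    using inv_branch_open[OF cusp, of "snd p" "fst p" j] open_branch_subset[OF cusp, of "fst p" j]
    by (auto simp: preimage_def)
qed (auto simp: preimage_def)

lemma preimage_borel:
  assumes j: "j \<in> {1, 2}"
  shows "preimage j \<in> borel_measurable N"
proof -
  have level: "{p \<in> space N. \<exists>q\<in>\<rat> \<inter> I. R q \<and> snd p \<le> S (fst p) q} \<in> sets N" for R
  proof -
    have "{p \<in> space N. R q \<and> snd p \<le> S (fst p) q} \<in> sets N" if "q \<in> \<rat> \<inter> I" for q
    proof -
      have [measurable]: "(\<lambda>p. S (fst p) q) \<in> borel_measurable N"
        by (rule measurable_compose[OF measurable_fst meas]) (use that in auto)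
      show ?thesis by measurable
    qed
    then have "(\<Union>q\<in>\<rat> \<inter> I. {p \<in> space N. R q \<and> snd p \<le> S (fst p) q}) \<in> sets N"
      by (intro sets.countable_UN') (auto intro: countable_subset[OF _ countable_rat])
    also have "(\<Union>q\<in>\<rat> \<inter> I. {p \<in> space N. R q \<and> snd p \<le> S (fst p) q})
        = {p \<in> space N. \<exists>q\<in>\<rat> \<inter> I. R q \<and> snd p \<le> S (fst p) q}" by auto
    finally show ?thesis .
  qed
  have inner: "{p \<in> space N. 0 < snd p \<and> snd p < 1} \<in> sets N" by measurable
  have outer: "{p \<in> space N. \<not> (0 < snd p \<and> snd p < 1) \<and> Q} \<in> sets N" for Q by measurable
  consider "j = 1" | "j = 2" using j by blast
  then show ?thesis
  proof cases
    case 1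
    have "{p \<in> space N. preimage j p < t} \<in> sets N" for t
    proof -
      have "{p \<in> space N. preimage j p < t}
          = {p \<in> space N. \<exists>q\<in>\<rat> \<inter> I. q < t \<and> snd p \<le> S (fst p) q} \<inter> {p \<in> space N. 0 < snd p \<and> snd p < 1}
            \<union> {p \<in> space N. \<not> (0 < snd p \<and> snd p < 1) \<and> 1/2 < t}"
        unfolding preimage_def 1 using inv_branch_left_less_iff[OF cusp] by auto
      then show ?thesis using sets.Un[OF sets.Int[OF level inner] outer] by simp
    qed
    then show ?thesis by (subst borel_measurable_iff_less) blast
  next
    case 2
    have "{p \<in> space N. t < preimage j p} \<in> sets N" for t
    proof -
      have "{p \<in> space N. t < preimage j p}
          = {p \<in> space N. \<exists>q\<in>\<rat> \<inter> I. t < q \<and> snd p \<le> S (fst p) q} \<inter> {p \<in> space N. 0 < snd p \<and> snd p < 1}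
            \<union> {p \<in> space N. \<not> (0 < snd p \<and> snd p < 1) \<and> t < 1/2}"
        unfolding preimage_def 2 using inv_branch_right_greater_iff[OF cusp] by auto
      then show ?thesis using sets.Un[OF sets.Int[OF level inner] outer] by simp
    qed
    then show ?thesis by (subst borel_measurable_iff_greater) blast
  qed
qed

lemma to_leb_I:
  assumes "a \<in> borel_measurable N" "\<And>p. 0 \<le> a p \<and> a p \<le> 1"
  shows "a \<in> N \<rightarrow>\<^sub>M leb_I"
  using assms by (intro measurable_restrict_space2) auto

lemma preimage_meas:
  assumes "j \<in> {1, 2}"
  shows "preimage j \<in> N \<rightarrow>\<^sub>M leb_I"
  using preimage_in_I[of j] by (intro to_leb_I preimage_borel[OF assms]) (auto intro: less_imp_le)

text \<open>Measurable as the limit of difference quotients along points of \<open>I\<close> to the right of the preimage.\<close>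

definition slope :: "nat \<Rightarrow> 'b \<times> real \<Rightarrow> real" where
  "slope j p = (if 0 < snd p \<and> snd p < 1 then DI (S (fst p)) (preimage j p) else 0)"

lemma slope_meas:
  assumes j: "j \<in> {1, 2}"
  shows "slope j \<in> borel_measurable N"
proof (rule borel_measurable_LIMSEQ_real)
  \<comment> \<open>Points of \<open>I\<close> that decrease to the preimage; the preimage itself is less than \<open>1\<close>.\<close>
  define near where "near n p = preimage j p + (1 - preimage j p) / real (Suc (Suc n))" for n p
  let ?quot = "\<lambda>n p. (if 0 < snd p \<and> snd p < 1
    then (S (fst p) (near n p) - S (fst p) (preimage j p)) / (near n p - preimage j p) else 0)"
  have near: "preimage j p < near n p \<and> near n p \<le> 1" for n p
  proof -
    define t where "t = (1 - preimage j p) / real (Suc (Suc n))"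
    have "t \<le> (1 - preimage j p) / 1"
      unfolding t_def using preimage_in_I[of j p] by (intro divide_left_mono) auto
    moreover have "0 < t" unfolding t_def using preimage_in_I[of j p] by simp
    ultimately show ?thesis unfolding near_def t_def[symmetric] by auto
  qed
  show "(\<lambda>n. ?quot n p) \<longlonglongrightarrow> slope j p" for p
  proof (cases "0 < snd p \<and> snd p < 1")
    case True
    have "preimage j p \<in> I - {d (fst p)}"
      using True inv_branch_open[OF cusp, of "snd p" "fst p" j] open_branch_subset[OF cusp, of "fst p" j]
      by (auto simp: preimage_def)
    from cusp_map_deriv(1)[OF cusp this]
    have "((\<lambda>y. (S (fst p) y - S (fst p) (preimage j p)) / (y - preimage j p)) \<longlongrightarrow> DI (S (fst p)) (preimage j p))
        (at (preimage j p) within I)"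
      by (simp add: has_field_derivative_iff)
    moreover have "filterlim (\<lambda>n. near n p) (at (preimage j p) within I) sequentially"
      unfolding filterlim_at
    proof
      have "(\<lambda>n. (1 - preimage j p) / real (Suc (Suc n))) \<longlonglongrightarrow> 0"
        using LIMSEQ_Suc[OF LIMSEQ_Suc[OF lim_const_over_n[of "1 - preimage j p"]]] .
      from tendsto_add[OF tendsto_const[of "preimage j p"] this]
      show "(\<lambda>n. near n p) \<longlonglongrightarrow> preimage j p" by (simp add: near_def)
      show "\<forall>\<^sub>F n in sequentially. near n p \<in> I \<and> near n p \<noteq> preimage j p"
      proof (intro always_eventually allI)
        fix n show "near n p \<in> I \<and> near n p \<noteq> preimage j p"
          using near[of p n] preimage_in_I[of j p] by auto
      qed
    qed
    ultimately have "(\<lambda>n. (S (fst p) (near n p) - S (fst p) (preimage j p)) / (near n p - preimage j p))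
        \<longlonglongrightarrow> DI (S (fst p)) (preimage j p)"
      by (rule filterlim_compose)
    then show ?thesis using True by (simp add: slope_def)
  qed (auto simp: slope_def)
  show "?quot n \<in> borel_measurable N" for n
  proof -
    have [measurable]: "preimage j \<in> borel_measurable N" by (rule preimage_borel[OF j])
    have near_b: "near n \<in> borel_measurable N" unfolding near_def by measurable
    have "near n \<in> N \<rightarrow>\<^sub>M leb_I"
      using near[of _ n] preimage_in_I[of j] by (intro to_leb_I near_b) (meson less_imp_le order_trans)
    note [measurable] = near_b S_compose[OF this] S_compose[OF preimage_meas[OF j]]
    show ?thesis by measurable
  qed
qed

lemma branch_term_meas:
  assumes f: "f \<in> borel_measurable leb_I" and j: "j \<in> {1, 2}"
  shows "(\<lambda>p. indicator {0<..<1} (snd p) * (f (inv_branch (S (fst p)) (d (fst p)) j (snd p)) *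
     potential (S (fst p)) (inv_branch (S (fst p)) (d (fst p)) j (snd p)))) \<in> borel_measurable N"
proof -
  note [measurable] = measurable_compose[OF preimage_meas[OF j] f] slope_meas[OF j]
  have "(\<lambda>p. indicator {0<..<1} (snd p) * (f (preimage j p) * (1 / \<bar>slope j p\<bar>))) \<in> borel_measurable N"
    by measurable
  also have "(\<lambda>p. indicator {0<..<1} (snd p) * (f (preimage j p) * (1 / \<bar>slope j p\<bar>)))
    = (\<lambda>p. indicator {0<..<1} (snd p) * (f (inv_branch (S (fst p)) (d (fst p)) j (snd p)) *
     potential (S (fst p)) (inv_branch (S (fst p)) (d (fst p)) j (snd p))))"
    by (auto simp: fun_eq_iff indicator_def preimage_def slope_def potential_def)
  finally show ?thesis .
qed

text \<open>The endpoints form a null set; cutting them off keeps all preimages in the open branches, where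
  they depend measurably on \<open>\<eta>\<close> and \<open>z\<close>.\<close>

abbreviation kernel :: "(real \<Rightarrow> real) \<Rightarrow> 'b \<Rightarrow> real \<Rightarrow> real" where
  "kernel f \<eta> z \<equiv> indicator {0<..<1} z * transfer (S \<eta>) (d \<eta>) f z"

lemma kernel_meas:
  assumes f: "f \<in> borel_measurable leb_I"
  shows "case_prod (kernel f) \<in> borel_measurable N"
proof -
  have "(\<lambda>p. indicator {0<..<1} (snd p) * (f (inv_branch (S (fst p)) (d (fst p)) 1 (snd p)) *
       potential (S (fst p)) (inv_branch (S (fst p)) (d (fst p)) 1 (snd p)))
     + indicator {0<..<1} (snd p) * (f (inv_branch (S (fst p)) (d (fst p)) 2 (snd p)) *
       potential (S (fst p)) (inv_branch (S (fst p)) (d (fst p)) 2 (snd p)))) \<in> borel_measurable N"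
    (is "?F \<in> _")
    by (intro borel_measurable_add branch_term_meas f) auto
  also have "?F = case_prod (kernel f)"
    by (auto simp: fun_eq_iff transfer_def distrib_left)
  finally show ?thesis .
qed

lemma
  assumes f: "integrable leb_I f" and \<eta>: "\<eta> \<in> space \<Lambda>"
  shows kernel_section_integrable: "integrable leb_I (kernel f \<eta>)"
    and kernel_section_integral: "(\<integral>z. kernel f \<eta> z \<partial>leb_I) = integral\<^sup>L leb_I f"
proof -
  have "(\<lambda>z. indicator {0<..<1} z * (f (inv_branch (S \<eta>) (d \<eta>) j z) *
      potential (S \<eta>) (inv_branch (S \<eta>) (d \<eta>) j z))) \<in> borel_measurable leb_I" if "j \<in> {1, 2}" for j
    using measurable_compose[OF measurable_Pair1'[OF \<eta>] branch_term_meas[OF borel_measurable_integrable[OF f] that]]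
    by simp
  note transfer_integral[OF cusp f this]
  then show "integrable leb_I (kernel f \<eta>)" "(\<integral>z. kernel f \<eta> z \<partial>leb_I) = integral\<^sup>L leb_I f" by auto
qed

lemma abs_kernel_le: "\<bar>kernel f \<eta> z\<bar> \<le> kernel (\<lambda>x. \<bar>f x\<bar>) \<eta> z"
proof -
  have "\<bar>transfer (S \<eta>) (d \<eta>) f z\<bar> \<le> transfer (S \<eta>) (d \<eta>) (\<lambda>x. \<bar>f x\<bar>) z"
    unfolding transfer_def
    by (rule order_trans[OF sum_abs]) (auto simp: abs_mult potential_def intro!: sum_mono)
  then show ?thesis by (simp add: abs_mult mult_left_mono)
qed

lemma kernel_section_contraction:
  assumes f: "integrable leb_I f" and \<eta>: "\<eta> \<in> space \<Lambda>"
  shows "(\<integral>z. \<bar>kernel f \<eta> z\<bar> \<partial>leb_I) \<le> (\<integral>x. \<bar>f x\<bar> \<partial>leb_I)"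
proof -
  have f': "integrable leb_I (\<lambda>x. \<bar>f x\<bar>)" using f by simp
  have "(\<integral>z. \<bar>kernel f \<eta> z\<bar> \<partial>leb_I) \<le> (\<integral>z. kernel (\<lambda>x. \<bar>f x\<bar>) \<eta> z \<partial>leb_I)"
    by (intro integral_mono integrable_abs kernel_section_integrable f f' \<eta> abs_kernel_le)
  then show ?thesis using kernel_section_integral[OF f' \<eta>] by simp
qed

lemma kernel_integrable:
  assumes f: "integrable leb_I f"
  shows "integrable N (case_prod (kernel f))"
proof (rule pair.Fubini_integrable)
  have m: "case_prod (kernel f) \<in> borel_measurable N" by (rule kernel_meas) (use f in auto)
  show "case_prod (kernel f) \<in> borel_measurable N" by (rule m)
  show "AE \<eta> in \<Lambda>. integrable leb_I (\<lambda>z. case_prod (kernel f) (\<eta>, z))"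
    using kernel_section_integrable[OF f] by (auto intro: AE_I2)
  show "integrable \<Lambda> (\<lambda>\<eta>. \<integral>z. norm (case_prod (kernel f) (\<eta>, z)) \<partial>leb_I)"
  proof (rule integrable_const_bound)
    show "AE \<eta> in \<Lambda>. norm (\<integral>z. norm (case_prod (kernel f) (\<eta>, z)) \<partial>leb_I) \<le> (\<integral>x. \<bar>f x\<bar> \<partial>leb_I)"
      using kernel_section_contraction[OF f] by (intro AE_I2) simp
    have [measurable]: "case_prod (kernel f) \<in> borel_measurable N" by (rule m)
    show "(\<lambda>\<eta>. \<integral>z. norm (case_prod (kernel f) (\<eta>, z)) \<partial>leb_I) \<in> borel_measurable \<Lambda>"
      by measurable
  qed
qed

definition averaged_transfer :: "(real \<Rightarrow> real) \<Rightarrow> real \<Rightarrow> real" where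
  "averaged_transfer f x = (\<integral>\<eta>. kernel f \<eta> x \<partial>\<Lambda>)"

lemma markov: "markov_operator leb_I averaged_transfer"
proof
  fix f g :: "real \<Rightarrow> real" and a b :: real
  assume f: "integrable leb_I f"
  note kf = kernel_integrable[OF f]
  show "integrable leb_I (averaged_transfer f)"
    unfolding averaged_transfer_def using pair.integrable_snd[OF kf] by simp
  show "integral\<^sup>L leb_I (averaged_transfer f) = integral\<^sup>L leb_I f"
  proof -
    have "integral\<^sup>L leb_I (averaged_transfer f) = (\<integral>\<eta>. \<integral>x. kernel f \<eta> x \<partial>leb_I \<partial>\<Lambda>)"
      unfolding averaged_transfer_def using pair.Fubini_integral[OF kf] by simp
    also have "\<dots> = (\<integral>\<eta>. integral\<^sup>L leb_I f \<partial>\<Lambda>)"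
      by (intro Bochner_Integration.integral_cong kernel_section_integral f) auto
    finally show ?thesis by (simp add: prob_space)
  qed
  show "(\<integral>x. \<bar>averaged_transfer f x\<bar> \<partial>leb_I) \<le> (\<integral>x. \<bar>f x\<bar> \<partial>leb_I)"
  proof -
    have ka: "integrable N (case_prod (\<lambda>\<eta> x. \<bar>kernel f \<eta> x\<bar>))"
      using integrable_abs[OF kf] by (simp add: case_prod_unfold)
    have "(\<integral>x. \<bar>averaged_transfer f x\<bar> \<partial>leb_I) \<le> (\<integral>x. \<integral>\<eta>. \<bar>kernel f \<eta> x\<bar> \<partial>\<Lambda> \<partial>leb_I)"
      unfolding averaged_transfer_def
      using pair.integrable_snd[OF kf] pair.integrable_snd[OF ka]
      by (intro integral_mono integral_abs_bound integrable_abs)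
    also have "\<dots> = (\<integral>\<eta>. \<integral>x. \<bar>kernel f \<eta> x\<bar> \<partial>leb_I \<partial>\<Lambda>)"
      by (rule pair.Fubini_integral[OF ka])
    also have "\<dots> \<le> (\<integral>\<eta>. (\<integral>x. \<bar>f x\<bar> \<partial>leb_I) \<partial>\<Lambda>)"
      by (rule integral_mono[OF pair.integrable_fst[OF ka]]) (auto intro: kernel_section_contraction[OF f])
    finally show ?thesis by (simp add: prob_space)
  qed
  assume g: "integrable leb_I g"
  show "AE x in leb_I. averaged_transfer (\<lambda>x. a * f x + b * g x) x = a * averaged_transfer f x + b * averaged_transfer g x"
    using pair.AE_integrable_snd[OF kf] pair.AE_integrable_snd[OF kernel_integrable[OF g]]
  proof eventually_elim
    case (elim x)
    have "kernel (\<lambda>x. a * f x + b * g x) \<eta> x = a * kernel f \<eta> x + b * kernel g \<eta> x" for \<eta>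
      by (simp add: transfer_def algebra_simps)
    then show ?case using elim by (simp add: averaged_transfer_def)
  qed
qed

lemma observed_integrable:
  fixes f :: "real \<Rightarrow> real"
  assumes f: "integrable leb_I f" and A: "A \<in> sets leb_I"
  shows "integrable N (\<lambda>(\<eta>, x). f x * indicator A (S \<eta> x))"
    and "\<eta> \<in> space \<Lambda> \<Longrightarrow> integrable leb_I (\<lambda>x. f x * indicator A (S \<eta> x))"
proof -
  have A': "A \<in> sets borel" "A \<subseteq> I" using A by (auto simp: sets_leb_I)
  have fm: "f \<in> borel_measurable leb_I" using f by auto
  have "(\<lambda>p. f (snd p) * indicator A (S (fst p) (snd p))) \<in> borel_measurable N"
    by (rule borel_measurable_times[OF measurable_compose[OF measurable_snd[of \<Lambda> leb_I] fm]
        measurable_compose[OF S_joint borel_measurable_indicator[OF A'(1)]]])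
  then have m: "(\<lambda>(\<eta>, x). f x * indicator A (S \<eta> x)) \<in> borel_measurable N"
    by (simp add: case_prod_unfold)
  have sec: "integrable leb_I (\<lambda>x. f x * indicator A (S \<eta> x))" if \<eta>: "\<eta> \<in> space \<Lambda>" for \<eta>
  proof (rule Bochner_Integration.integrable_bound[OF f])
    show "(\<lambda>x. f x * indicator A (S \<eta> x)) \<in> borel_measurable leb_I"
      using measurable_compose[OF measurable_Pair1'[OF \<eta>] m] by simp
  qed (auto simp: indicator_def)
  then show "\<eta> \<in> space \<Lambda> \<Longrightarrow> integrable leb_I (\<lambda>x. f x * indicator A (S \<eta> x))" .
  show "integrable N (\<lambda>(\<eta>, x). f x * indicator A (S \<eta> x))"
  proof (rule pair.Fubini_integrable[OF m])
    show "AE \<eta> in \<Lambda>. integrable leb_I (\<lambda>x. case (\<eta>, x) of (\<eta>, x) \<Rightarrow> f x * indicator A (S \<eta> x))"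
      using sec by (intro AE_I2) simp
    show "integrable \<Lambda> (\<lambda>\<eta>. \<integral>x. norm (case (\<eta>, x) of (\<eta>, x) \<Rightarrow> f x * indicator A (S \<eta> x)) \<partial>leb_I)"
    proof (rule integrable_const_bound)
      show "AE \<eta> in \<Lambda>. norm (\<integral>x. norm (case (\<eta>, x) of (\<eta>, x) \<Rightarrow> f x * indicator A (S \<eta> x)) \<partial>leb_I)
          \<le> (\<integral>x. \<bar>f x\<bar> \<partial>leb_I)"
        using f by (intro AE_I2) (auto intro!: integral_mono' simp: indicator_def)
      note [measurable] = m
      show "(\<lambda>\<eta>. \<integral>x. norm (case (\<eta>, x) of (\<eta>, x) \<Rightarrow> f x * indicator A (S \<eta> x)) \<partial>leb_I) \<in> borel_measurable \<Lambda>"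
        by measurable
    qed
  qed
qed

lemma integral_indicator_S:
  assumes A: "A \<in> sets leb_I" and x: "x \<in> I"
  shows "(\<integral>\<eta>. indicator A (S \<eta> x) \<partial>\<Lambda>) = measure \<Lambda> {\<eta> \<in> space \<Lambda>. S \<eta> x \<in> A}"
proof -
  have "(\<integral>\<eta>. indicator A (S \<eta> x) \<partial>\<Lambda>) = (\<integral>\<eta>. indicator {\<eta> \<in> space \<Lambda>. S \<eta> x \<in> A} \<eta> \<partial>\<Lambda>)"
    by (intro Bochner_Integration.integral_cong) (auto simp: indicator_def)
  also have "\<dots> = measure \<Lambda> ({\<eta> \<in> space \<Lambda>. S \<eta> x \<in> A} \<inter> space \<Lambda>)"
    by (rule Bochner_Integration.integral_indicator)
  finally show ?thesis by (simp add: Int_absorb2 subset_iff)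
qed

lemma transition_prob_meas:
  assumes A: "A \<in> sets leb_I"
  shows "(\<lambda>x. measure \<Lambda> {\<eta> \<in> space \<Lambda>. S \<eta> x \<in> A}) \<in> borel_measurable leb_I"
proof -
  have "integrable leb_I (\<lambda>x. \<integral>\<eta>. (1::real) * indicator A (S \<eta> x) \<partial>\<Lambda>)"
    by (rule pair.integrable_snd[OF observed_integrable(1)[of "\<lambda>_. 1", OF _ A]]) simp
  then have "(\<lambda>x. \<integral>\<eta>. (indicator A (S \<eta> x) :: real) \<partial>\<Lambda>) \<in> borel_measurable leb_I" by auto
  then show ?thesis
    by (rule measurable_cong[THEN iffD1, rotated]) (simp add: integral_indicator_S[OF A])
qed

text \<open>\<open>1\<^sub>A \<cdot> L\<^sub>\<eta> f = L\<^sub>\<eta> (1\<^sub>A \<circ> S\<^sub>\<eta> \<cdot> f)\<close>, so integrating over \<open>x\<close> first and over \<open>\<eta>\<close> last turns the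
  averaged transfer operator into the transition probability.\<close>

lemma averaged_transfer_dual:
  assumes f: "integrable leb_I f" and A: "A \<in> sets leb_I"
  shows "(\<integral>x. indicator A x * averaged_transfer f x \<partial>leb_I)
    = (\<integral>x. f x * measure \<Lambda> {\<eta> \<in> space \<Lambda>. S \<eta> x \<in> A} \<partial>leb_I)"
proof -
  have A': "A \<in> sets borel" "A \<subseteq> I" using A by (auto simp: sets_leb_I)
  note kf = kernel_integrable[OF f]
  have Af: "integrable N (\<lambda>(\<eta>, x). indicator A x * kernel f \<eta> x)"
  proof (rule Bochner_Integration.integrable_bound[OF kf])
    have "(\<lambda>p. indicator A (snd p) * case_prod (kernel f) p) \<in> borel_measurable N"
      by (intro borel_measurable_times measurable_compose[OF snd_N borel_measurable_indicator[OF A'(1)]]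
          borel_measurable_integrable[OF kf])
    then show "(\<lambda>(\<eta>, x). indicator A x * kernel f \<eta> x) \<in> borel_measurable N"
      by (simp add: case_prod_unfold)
  qed (auto simp: indicator_def)
  have shift: "indicator A x * kernel f \<eta> x = kernel (\<lambda>x. f x * indicator A (S \<eta> x)) \<eta> x" for \<eta> x
    using apply_inv_branch[OF cusp, of x \<eta>] by (auto simp: indicator_def transfer_def)
  have "(\<integral>x. indicator A x * averaged_transfer f x \<partial>leb_I)
      = (\<integral>x. \<integral>\<eta>. indicator A x * kernel f \<eta> x \<partial>\<Lambda> \<partial>leb_I)"
    unfolding averaged_transfer_def by simp
  also have "\<dots> = (\<integral>\<eta>. \<integral>x. indicator A x * kernel f \<eta> x \<partial>leb_I \<partial>\<Lambda>)"
    by (rule pair.Fubini_integral[OF Af])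
  also have "\<dots> = (\<integral>\<eta>. \<integral>x. f x * indicator A (S \<eta> x) \<partial>leb_I \<partial>\<Lambda>)"
    unfolding shift
    by (intro Bochner_Integration.integral_cong kernel_section_integral observed_integrable(2)[OF f A]) auto
  also have "\<dots> = (\<integral>x. \<integral>\<eta>. f x * indicator A (S \<eta> x) \<partial>\<Lambda> \<partial>leb_I)"
    by (rule pair.Fubini_integral[OF observed_integrable(1)[OF f A], symmetric])
  also have "\<dots> = (\<integral>x. f x * measure \<Lambda> {\<eta> \<in> space \<Lambda>. S \<eta> x \<in> A} \<partial>leb_I)"
    by (intro Bochner_Integration.integral_cong) (auto simp: integral_indicator_S[OF A])
  finally show ?thesis .
qed

end

section \<open>Stationary measures and fixed densities\<close>

text \<open>The transition kernel \<open>K\<close> is a parameter so that the statement covers both the indicator of \<open>T x \<in> A\<close>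
  for a single map and the transition probability of a random family that consists of cusp maps
  only almost surely.\<close>

lemma (in cusp_family) stationary_iff_fixed:
  fixes g :: "real \<Rightarrow> real" and K :: "real \<Rightarrow> real set \<Rightarrow> ennreal"
  assumes g: "integrable leb_I g" "AE x in leb_I. 0 \<le> g x"
    and K: "\<And>x A. x \<in> I \<Longrightarrow> A \<in> sets leb_I \<Longrightarrow> K x A = ennreal (measure \<Lambda> {\<eta> \<in> space \<Lambda>. S \<eta> x \<in> A})"
  defines "\<mu> \<equiv> density leb_I (\<lambda>x. ennreal (g x))"
  shows "(\<forall>A\<in>sets leb_I. emeasure \<mu> A = (\<integral>\<^sup>+x. K x A \<partial>\<mu>))
    \<longleftrightarrow> (AE x in leb_I. averaged_transfer g x = g x)"
proof -
  interpret P: markov_operator leb_I averaged_transfer by (rule markov)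
  have [measurable]: "g \<in> borel_measurable leb_I" using g by auto
  let ?p = "\<lambda>A x. measure \<Lambda> {\<eta> \<in> space \<Lambda>. S \<eta> x \<in> A}"
  have left: "emeasure \<mu> A = ennreal (\<integral>x. indicator A x * g x \<partial>leb_I)"
    and right: "(\<integral>\<^sup>+x. K x A \<partial>\<mu>) = ennreal (\<integral>x. indicator A x * averaged_transfer g x \<partial>leb_I)"
    and nonneg: "0 \<le> (\<integral>x. indicator A x * g x \<partial>leb_I)"
      "0 \<le> (\<integral>x. indicator A x * averaged_transfer g x \<partial>leb_I)"
    if A: "A \<in> sets leb_I" for A
  proof -
    have "emeasure \<mu> A = (\<integral>\<^sup>+x. ennreal (indicator A x * g x) \<partial>leb_I)"
      unfolding \<mu>_def using A
      by (subst emeasure_density) (auto intro!: nn_integral_cong simp: indicator_def)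
    also have "\<dots> = ennreal (\<integral>x. indicator A x * g x \<partial>leb_I)"
      using integrable_mult_indicator[OF A g(1)] g(2)
      by (intro nn_integral_eq_integral) (auto elim!: eventually_mono)
    finally show "emeasure \<mu> A = ennreal (\<integral>x. indicator A x * g x \<partial>leb_I)" .
    note [measurable] = transition_prob_meas[OF A]
    have gp: "integrable leb_I (\<lambda>x. g x * ?p A x)"
      by (rule Bochner_Integration.integrable_bound[OF g(1)])
         (auto simp: abs_mult intro!: AE_I2 mult_left_le)
    have "(\<integral>\<^sup>+x. K x A \<partial>\<mu>) = (\<integral>\<^sup>+x. ennreal (?p A x) \<partial>\<mu>)"
      by (intro nn_integral_cong) (auto simp: \<mu>_def K[OF _ A])
    also have "\<dots> = (\<integral>\<^sup>+x. ennreal (g x) * ennreal (?p A x) \<partial>leb_I)"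
      unfolding \<mu>_def by (rule nn_integral_density) auto
    also have "\<dots> = (\<integral>\<^sup>+x. ennreal (g x * ?p A x) \<partial>leb_I)"
      by (intro nn_integral_cong) (simp add: ennreal_mult'')
    also have "\<dots> = ennreal (\<integral>x. g x * ?p A x \<partial>leb_I)"
      using gp g(2) by (intro nn_integral_eq_integral) (auto elim!: eventually_mono)
    finally show "(\<integral>\<^sup>+x. K x A \<partial>\<mu>) = ennreal (\<integral>x. indicator A x * averaged_transfer g x \<partial>leb_I)"
      unfolding averaged_transfer_dual[OF g(1) A] .
    show "0 \<le> (\<integral>x. indicator A x * g x \<partial>leb_I)"
      using g(2) by (intro integral_nonneg_AE) (auto elim!: eventually_mono)
    show "0 \<le> (\<integral>x. indicator A x * averaged_transfer g x \<partial>leb_I)"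
      using P.P_nonneg[OF g] by (intro integral_nonneg_AE) (auto elim!: eventually_mono)
  qed
  have "(\<forall>A\<in>sets leb_I. emeasure \<mu> A = (\<integral>\<^sup>+x. K x A \<partial>\<mu>))
    \<longleftrightarrow> (\<forall>A\<in>sets leb_I. (\<integral>x. indicator A x * averaged_transfer g x \<partial>leb_I) = (\<integral>x. indicator A x * g x \<partial>leb_I))"
    by (rule ball_cong[OF refl]) (use left right nonneg in auto)
  also have "\<dots> \<longleftrightarrow> (AE x in leb_I. averaged_transfer g x = g x)"
  proof
    assume "\<forall>A\<in>sets leb_I. (\<integral>x. indicator A x * averaged_transfer g x \<partial>leb_I) = (\<integral>x. indicator A x * g x \<partial>leb_I)"
    then show "AE x in leb_I. averaged_transfer g x = g x"
      by (intro density_unique_real P.P_integrable g(1)) (auto simp: set_lebesgue_integral_def)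
  next
    assume "AE x in leb_I. averaged_transfer g x = g x"
    then show "\<forall>A\<in>sets leb_I. (\<integral>x. indicator A x * averaged_transfer g x \<partial>leb_I) = (\<integral>x. indicator A x * g x \<partial>leb_I)"
      using integrable_mult_indicator[OF _ g(1)] integrable_mult_indicator[OF _ P.P_integrable[OF g(1)]]
      by (intro ballI integral_cong_AE) (auto elim!: eventually_mono)
  qed
  finally show ?thesis .
qed

text \<open>At the endpoints \<open>0\<close> and \<open>1\<close> the transfer operators may behave differently from the averaged operator
  of a family; two points influence neither integrability nor integrals.\<close>

lemma markov_operator_cong:
  assumes Q: "markov_operator leb_I Q"
    and eq: "\<And>f x. integrable leb_I f \<Longrightarrow> 0 < x \<Longrightarrow> x < 1 \<Longrightarrow> P f x = Q f x"
  shows "markov_operator leb_I P"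
    and "markov_operator.fixed_density leb_I P g \<longleftrightarrow> markov_operator.fixed_density leb_I Q g"
proof -
  interpret Q: markov_operator leb_I Q by (rule Q)
  have AE_eq: "AE x in leb_I. P f x = Q f x" if "integrable leb_I f" for f
    using AE_leb_I_not_endpoint by eventually_elim (simp add: eq that)
  have null: "emeasure leb_I {x} = 0" if "x \<in> {0, 1}" for x
    using that by (subst emeasure_restrict_space) auto
  have int: "integrable leb_I (P f)" if f: "integrable leb_I f" for f
  proof -
    have "integrable leb_I (Q f) \<longleftrightarrow> integrable leb_I (P f)"
      by (rule integrable_discrete_difference[of "{0, 1}", OF _ null])
         (auto simp: sets_leb_I eq[OF f])
    then show ?thesis using Q.P_integrable[OF f] by simp
  qed
  show P: "markov_operator leb_I P"
  proof
    fix f g :: "real \<Rightarrow> real" and a b :: real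
    assume f: "integrable leb_I f"
    note i = int[OF f] Q.P_integrable[OF f]
    show "integrable leb_I (P f)" by (rule i(1))
    show "integral\<^sup>L leb_I (P f) = integral\<^sup>L leb_I f"
      using i AE_eq[OF f] by (subst Q.P_integral[OF f, symmetric]) (intro integral_cong_AE, auto)
    have "(\<integral>x. \<bar>P f x\<bar> \<partial>leb_I) = (\<integral>x. \<bar>Q f x\<bar> \<partial>leb_I)"
      using i AE_eq[OF f] by (intro integral_cong_AE) (auto elim!: eventually_mono)
    then show "(\<integral>x. \<bar>P f x\<bar> \<partial>leb_I) \<le> (\<integral>x. \<bar>f x\<bar> \<partial>leb_I)"
      using Q.P_contraction[OF f] by simp
    assume g: "integrable leb_I g"
    have fg: "integrable leb_I (\<lambda>x. a * f x + b * g x)" using f g by auto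
    show "AE x in leb_I. P (\<lambda>x. a * f x + b * g x) x = a * P f x + b * P g x"
      using Q.P_linear[OF f g, of a b] AE_eq[OF f] AE_eq[OF g] AE_eq[OF fg] by eventually_elim simp
  qed
  have "(AE x in leb_I. P g x = g x) \<longleftrightarrow> (AE x in leb_I. Q g x = g x)" if g: "integrable leb_I g"
    using AE_eq[OF g] by (auto elim: eventually_elim2)
  then show "markov_operator.fixed_density leb_I P g \<longleftrightarrow> markov_operator.fixed_density leb_I Q g"
    unfolding markov_operator.fixed_density_def[OF P] markov_operator.fixed_density_def[OF Q]
    by (cases "integrable leb_I g") simp_all
qed

lemma is_density_integral:
  assumes g: "is_density \<mu> g" and \<mu>: "prob_space \<mu>"
  shows "integrable leb_I g" "AE x in leb_I. 0 \<le> g x" "integral\<^sup>L leb_I g = 1"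
proof -
  interpret prob_space \<mu> by (rule \<mu>)
  have [measurable]: "g \<in> borel_measurable leb_I" and pos: "AE x in leb_I. 0 \<le> g x"
    and eq: "\<mu> = density leb_I (\<lambda>x. ennreal (g x))"
    using g by (auto simp: is_density_def)
  have "(\<integral>\<^sup>+x. ennreal (g x) \<partial>leb_I) = emeasure \<mu> (space \<mu>)"
    unfolding eq by (subst emeasure_density) (auto simp: sets_leb_I intro!: nn_integral_cong)
  then have one: "(\<integral>\<^sup>+x. ennreal (g x) \<partial>leb_I) = ennreal 1" by (simp add: emeasure_space_1)
  show "AE x in leb_I. 0 \<le> g x" by (rule pos)
  show "integrable leb_I g" "integral\<^sup>L leb_I g = 1"
    using nn_integral_eq_integrable[OF _ pos, of 1] one by auto
qed

lemma ac_prob_density: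
  assumes g: "integrable leb_I g" "AE x in leb_I. 0 \<le> g x" "integral\<^sup>L leb_I g = 1"
  shows "ac_prob (density leb_I (\<lambda>x. ennreal (g x)))" "is_density (density leb_I (\<lambda>x. ennreal (g x))) g"
proof -
  have [measurable]: "g \<in> borel_measurable leb_I" using g by auto
  have "(\<integral>\<^sup>+x. ennreal (g x) \<partial>leb_I) = 1"
    using nn_integral_eq_integral[OF g(1,2)] g(3) by simp
  moreover have "emeasure (density leb_I (\<lambda>x. ennreal (g x))) I = (\<integral>\<^sup>+x. ennreal (g x) * indicator I x \<partial>leb_I)"
    by (rule emeasure_density) (auto simp: sets_leb_I)
  moreover have "(\<integral>\<^sup>+x. ennreal (g x) * indicator I x \<partial>leb_I) = (\<integral>\<^sup>+x. ennreal (g x) \<partial>leb_I)"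
    by (rule nn_integral_cong) simp
  ultimately have "prob_space (density leb_I (\<lambda>x. ennreal (g x)))"
    by (intro prob_spaceI) simp
  then show "ac_prob (density leb_I (\<lambda>x. ennreal (g x)))"
    by (auto simp: ac_prob_def intro!: absolutely_continuousI_density)
  show "is_density (density leb_I (\<lambda>x. ennreal (g x))) g"
    using g by (auto simp: is_density_def)
qed

lemma ac_prob_ex_density:
  assumes \<mu>: "ac_prob \<mu>"
  shows "\<exists>g. is_density \<mu> g"
proof -
  have ac: "prob_space \<mu>" "absolutely_continuous leb_I \<mu>" "sets \<mu> = sets leb_I"
    using \<mu> by (auto simp: ac_prob_def)
  then have "finite_measure \<mu>" by (simp add: prob_space.axioms)
  from leb_I.real_RN_deriv[OF this ac(2,3)] obtain D where D: "D \<in> borel_measurable leb_I"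
    "AE x in leb_I. RN_deriv leb_I \<mu> x = ennreal (D x)" "\<And>x. 0 \<le> D x" by blast
  have "\<mu> = density leb_I (RN_deriv leb_I \<mu>)" by (rule leb_I.density_RN_deriv[OF ac(2,3), symmetric])
  also have "\<dots> = density leb_I (\<lambda>x. ennreal (D x))" using D by (intro density_cong) auto
  finally show ?thesis using D by (auto simp: is_density_def)
qed

lemma is_density_unique:
  assumes "is_density \<mu> g" "is_density \<mu> h"
  shows "AE x in leb_I. g x = h x"
proof -
  have "AE x in leb_I. ennreal (g x) = ennreal (h x)"
    using assms by (intro leb_I.density_unique) (auto simp: is_density_def)
  moreover have "AE x in leb_I. 0 \<le> g x" "AE x in leb_I. 0 \<le> h x" using assms by (auto simp: is_density_def)
  ultimately show ?thesis by eventually_elim simp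
qed

lemma is_density_cong:
  assumes "is_density \<mu> g" "is_density \<nu> h" "AE x in leb_I. g x = h x"
  shows "\<mu> = \<nu>"
proof -
  have "\<mu> = density leb_I (\<lambda>x. ennreal (g x))" "\<nu> = density leb_I (\<lambda>x. ennreal (h x))"
    using assms by (auto simp: is_density_def)
  moreover have "density leb_I (\<lambda>x. ennreal (g x)) = density leb_I (\<lambda>x. ennreal (h x))"
    using assms by (intro density_cong) (auto simp: is_density_def elim!: eventually_mono)
  ultimately show ?thesis by simp
qed

text \<open>A single map is a family over the one-point probability space.\<close>

lemma
  assumes T: "cusp_map T c"
  shows transfer_markov: "markov_operator leb_I (transfer T c)"
    and transfer_fixed_density_invariant:
      "markov_operator.fixed_density leb_I (transfer T c) g \<Longrightarrow>
        ac_invariant T (density leb_I (\<lambda>x. ennreal (g x)))"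
proof -
  interpret R: prob_space "return (count_space UNIV) ()" by (rule prob_space_return) simp
  interpret F: cusp_family "return (count_space UNIV) ()" "\<lambda>_. T" "\<lambda>_. c"
    by unfold_locales (use T in auto)
  have eq: "transfer T c f x = F.averaged_transfer f x" if "0 < x" "x < 1" for f x
    using that by (simp add: F.averaged_transfer_def R.prob_space[simplified])
  note cong = markov_operator_cong[OF F.markov eq]
  show L: "markov_operator leb_I (transfer T c)" by (rule cong(1))
  assume "markov_operator.fixed_density leb_I (transfer T c) g"
  then have "markov_operator.fixed_density leb_I F.averaged_transfer g" by (simp add: cong(2))
  then have g: "integrable leb_I g" "AE x in leb_I. 0 \<le> g x" "integral\<^sup>L leb_I g = 1"
    "AE x in leb_I. F.averaged_transfer g x = g x"
    by (auto simp: markov_operator.fixed_density_def[OF F.markov])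
  let ?\<mu> = "density leb_I (\<lambda>x. ennreal (g x))"
  have ind: "(indicator A (T x) :: ennreal) = ennreal (R.prob {\<eta> \<in> space (return (count_space UNIV) ()). T x \<in> A})" for x A
    by (auto simp: indicator_def R.prob_space[simplified])
  have inv: "emeasure ?\<mu> A = (\<integral>\<^sup>+x. indicator A (T x) \<partial>?\<mu>)" if "A \<in> sets leb_I" for A
    using F.stationary_iff_fixed[OF g(1,2), of "\<lambda>x A. indicator A (T x)"] ind g(4) that by blast
  have Tm: "T \<in> ?\<mu> \<rightarrow>\<^sub>M leb_I"
  proof -
    have "continuous_on I T" "T ` I \<subseteq> I" using T by (auto simp: cusp_map_def)
    then have "T \<in> borel_measurable (restrict_space borel I)"
      using borel_measurable_continuous_on_restrict by blast
    then have "T \<in> leb_I \<rightarrow>\<^sub>M borel"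
      by (subst measurable_cong_sets[OF sets_restrict_space_cong[OF sets_lborel] refl])
    then show ?thesis
      using \<open>T ` I \<subseteq> I\<close> by (auto intro!: measurable_restrict_space2)
  qed
  have "distr ?\<mu> leb_I T = ?\<mu>"
  proof (rule measure_eqI)
    fix A assume "A \<in> sets (distr ?\<mu> leb_I T)"
    then have A: "A \<in> sets leb_I" by simp
    have "emeasure (distr ?\<mu> leb_I T) A = emeasure ?\<mu> (T -` A \<inter> space ?\<mu>)"
      by (rule emeasure_distr[OF Tm A])
    also have "\<dots> = (\<integral>\<^sup>+x. indicator (T -` A \<inter> space ?\<mu>) x \<partial>?\<mu>)"
      by (rule nn_integral_indicator[symmetric]) (rule measurable_sets[OF Tm A])
    also have "\<dots> = (\<integral>\<^sup>+x. indicator A (T x) \<partial>?\<mu>)"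
      by (intro nn_integral_cong) (auto simp: indicator_def)
    finally show "emeasure (distr ?\<mu> leb_I T) A = emeasure ?\<mu> A" using inv[OF A] by simp
  qed simp
  then show "ac_invariant T ?\<mu>"
    using ac_prob_density(1)[OF g(1-3)] by (simp add: ac_invariant_def)
qed

lemma closed_spt: "closed (spt M)"
proof -
  have "open (- spt M)"
  proof (subst open_subopen, intro ballI)
    fix y assume "y \<in> - spt M"
    then obtain U where U: "open U" "y \<in> U" "\<not> 0 < emeasure M U" unfolding spt_def by blast
    then have "U \<subseteq> - spt M" unfolding spt_def by blast
    then show "\<exists>U. open U \<and> y \<in> U \<and> U \<subseteq> - spt M" using U by blast
  qed
  then show ?thesis by (simp add: closed_def)
qed

text \<open>By second countability, countably many open null sets cover the complement of the support.\<close>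

lemma AE_in_spt:
  assumes sets: "sets M = sets borel"
  shows "AE \<eta> in M. \<eta> \<in> spt M"
proof -
  obtain B :: "real set set" where B: "countable B" "topological_basis B"
    using ex_countable_basis by blast
  have "(\<Union>U\<in>{U \<in> B. emeasure M U = 0}. U) \<in> null_sets M"
  proof (rule null_sets_UN')
    show "countable {U \<in> B. emeasure M U = 0}" using B(1) by simp
    show "U \<in> null_sets M" if "U \<in> {U \<in> B. emeasure M U = 0}" for U
      using that topological_basis_open[OF B(2)] sets by (auto simp: null_sets_def)
  qed
  moreover have "- spt M \<subseteq> (\<Union>U\<in>{U \<in> B. emeasure M U = 0}. U)"
  proof
    fix y assume "y \<in> - spt M"
    then obtain U where U: "open U" "y \<in> U" "\<not> 0 < emeasure M U" unfolding spt_def by blast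
    obtain V where V: "V \<in> B" "y \<in> V" "V \<subseteq> U" using topological_basisE[OF B(2) U(1,2)] by blast
    have "emeasure M V \<le> emeasure M U"
      by (rule emeasure_mono[OF V(3)]) (simp add: sets borel_open[OF U(1)])
    then show "y \<in> (\<Union>U\<in>{U \<in> B. emeasure M U = 0}. U)" using U(3) V(1,2) by auto
  qed
  ultimately show ?thesis by (intro AE_I') auto
qed

text \<open>Outside the support nothing is known about the maps, so there they are replaced by the
  reference map \<open>T\<close>; this changes neither transition probabilities nor averaged operators.\<close>

locale random_cusp_maps = prob_space \<Lambda> for \<Lambda> :: "real measure" +
  fixes S :: "real \<Rightarrow> real \<Rightarrow> real" and d :: "real \<Rightarrow> real" and T :: "real \<Rightarrow> real" and c :: real
  assumes sets_\<Lambda>: "sets \<Lambda> = sets borel"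
    and S_meas: "\<And>x. x \<in> I \<Longrightarrow> (\<lambda>\<eta>. S \<eta> x) \<in> borel_measurable \<Lambda>"
    and S_cusp: "\<And>\<eta>. \<eta> \<in> spt \<Lambda> \<Longrightarrow> cusp_map (S \<eta>) (d \<eta>)"
    and T_cusp: "cusp_map T c"
begin

definition S' :: "real \<Rightarrow> real \<Rightarrow> real" where "S' \<eta> = (if \<eta> \<in> spt \<Lambda> then S \<eta> else T)"
definition d' :: "real \<Rightarrow> real" where "d' \<eta> = (if \<eta> \<in> spt \<Lambda> then d \<eta> else c)"

lemma space_\<Lambda>: "space \<Lambda> = UNIV"
  using sets_eq_imp_space_eq[OF sets_\<Lambda>] by simp

lemma spt_sets [measurable]: "spt \<Lambda> \<in> sets \<Lambda>"
  by (simp add: sets_\<Lambda> closed_spt)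

sublocale family: cusp_family \<Lambda> S' d'
proof
  show "cusp_map (S' \<eta>) (d' \<eta>)" for \<eta> using S_cusp T_cusp by (simp add: S'_def d'_def)
  show "(\<lambda>\<eta>. S' \<eta> x) \<in> borel_measurable \<Lambda>" if "x \<in> I" for x
  proof -
    have "(\<lambda>\<eta>. if \<eta> \<in> spt \<Lambda> then S \<eta> x else T x) \<in> borel_measurable \<Lambda>"
      using S_meas[OF that] spt_sets by (intro measurable_If_set) (auto simp: space_\<Lambda>)
    moreover have "(\<lambda>\<eta>. S' \<eta> x) = (\<lambda>\<eta>. if \<eta> \<in> spt \<Lambda> then S \<eta> x else T x)" by (auto simp: S'_def)
    ultimately show ?thesis by simp
  qed
qed

lemma AE_spt: "AE \<eta> in \<Lambda>. \<eta> \<in> spt \<Lambda>"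
  by (rule AE_in_spt[OF sets_\<Lambda>])

lemma random_transfer_eq:
  assumes f: "integrable leb_I f" and x: "0 < x" "x < 1"
  shows "random_transfer \<Lambda> S d f x = family.averaged_transfer f x"
proof -
  have fm: "f \<in> borel_measurable leb_I" using f by auto
  have "x \<in> space leb_I" using x by simp
  from measurable_compose[OF measurable_Pair2'[OF this] family.kernel_meas[OF fm]]
  have k [measurable]: "(\<lambda>\<eta>. family.kernel f \<eta> x) \<in> borel_measurable \<Lambda>" by simp
  have "random_transfer \<Lambda> S d f x = (\<integral>\<eta>. indicator (spt \<Lambda>) \<eta> * family.kernel f \<eta> x \<partial>\<Lambda>)"
    unfolding random_transfer_def set_lebesgue_integral_def using x
    by (intro Bochner_Integration.integral_cong) (auto simp: indicator_def S'_def d'_def)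
  also have "\<dots> = family.averaged_transfer f x"
    unfolding family.averaged_transfer_def
  proof (rule integral_cong_AE)
    show "AE \<eta> in \<Lambda>. indicator (spt \<Lambda>) \<eta> * family.kernel f \<eta> x = family.kernel f \<eta> x"
      using AE_spt by eventually_elim simp
  qed measurable
  finally show ?thesis .
qed

lemma random_transfer_markov: "markov_operator leb_I (random_transfer \<Lambda> S d)"
  by (rule markov_operator_cong(1)[OF family.markov random_transfer_eq])

lemma transition_eq:
  assumes x: "x \<in> I" and A: "A \<in> sets leb_I"
  shows "emeasure (transition \<Lambda> S x) A = ennreal (measure \<Lambda> {\<eta> \<in> space \<Lambda>. S' \<eta> x \<in> A})"
proof -
  have A': "A \<in> sets borel" using A by (simp add: sets_leb_I)
  note [measurable] = S_meas[OF x] family.meas[OF x] A'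
  have "emeasure (transition \<Lambda> S x) A = emeasure \<Lambda> ((\<lambda>\<eta>. S \<eta> x) -` A \<inter> space \<Lambda>)"
    unfolding transition_def by (rule emeasure_distr[OF S_meas[OF x] A'])
  also have "\<dots> = emeasure \<Lambda> {\<eta> \<in> space \<Lambda>. S' \<eta> x \<in> A}"
  proof (rule emeasure_eq_AE)
    show "AE \<eta> in \<Lambda>. \<eta> \<in> (\<lambda>\<eta>. S \<eta> x) -` A \<inter> space \<Lambda> \<longleftrightarrow> \<eta> \<in> {\<eta> \<in> space \<Lambda>. S' \<eta> x \<in> A}"
      using AE_spt by eventually_elim (auto simp: S'_def)
  qed measurable
  finally show ?thesis by (simp add: emeasure_eq_measure)
qed

lemma stationary_iff_fixed_density:
  assumes g: "is_density \<mu> g" and \<mu>: "ac_prob \<mu>"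
  shows "ac_stationary \<Lambda> S \<mu> \<longleftrightarrow> markov_operator.fixed_density leb_I (random_transfer \<Lambda> S d) g"
proof -
  have \<mu>_eq: "\<mu> = density leb_I (\<lambda>x. ennreal (g x))" using g by (simp add: is_density_def)
  have "prob_space \<mu>" using \<mu> by (simp add: ac_prob_def)
  note gd = is_density_integral[OF g this]
  have "ac_stationary \<Lambda> S \<mu> \<longleftrightarrow> (AE x in leb_I. family.averaged_transfer g x = g x)"
  proof -
    have "(\<forall>A\<in>sets leb_I. emeasure \<mu> A = (\<integral>\<^sup>+x. emeasure (transition \<Lambda> S x) A \<partial>\<mu>))
        \<longleftrightarrow> (AE x in leb_I. family.averaged_transfer g x = g x)"
      unfolding \<mu>_eq by (rule family.stationary_iff_fixed[OF gd(1,2) transition_eq])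
    then show ?thesis unfolding ac_stationary_def using \<mu> by blast
  qed
  also have "\<dots> \<longleftrightarrow> markov_operator.fixed_density leb_I family.averaged_transfer g"
    using gd by (simp add: markov_operator.fixed_density_def[OF family.markov])
  also have "\<dots> \<longleftrightarrow> markov_operator.fixed_density leb_I (random_transfer \<Lambda> S d) g"
    by (rule markov_operator_cong(2)[OF family.markov random_transfer_eq, symmetric])
  finally show ?thesis .
qed

text \<open>Uniqueness costs nothing beyond stability: all fixed densities are close to \<open>h\<close>, and two distinct
  stationary measures would give two fixed densities at distance \<open>2\<close>.\<close>

lemma ex1_stationary:
  assumes ex: "\<exists>g. markov_operator.fixed_density leb_I (random_transfer \<Lambda> S d) g"
    and near: "\<And>g. markov_operator.fixed_density leb_I (random_transfer \<Lambda> S d) g \<Longrightarrow> L1_dist leb_I g h < 1"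
    and h: "integrable leb_I h"
  shows "\<exists>!\<mu>. ac_stationary \<Lambda> S \<mu>"
proof -
  interpret P: markov_operator leb_I "random_transfer \<Lambda> S d" by (rule random_transfer_markov)
  obtain g where g: "P.fixed_density g" using ex by blast
  then have gd: "integrable leb_I g" "AE x in leb_I. 0 \<le> g x" "integral\<^sup>L leb_I g = 1"
    by (auto simp: P.fixed_density_def)
  show ?thesis
  proof
    show "ac_stationary \<Lambda> S (density leb_I (\<lambda>x. ennreal (g x)))"
      using g stationary_iff_fixed_density[OF ac_prob_density(2)[OF gd] ac_prob_density(1)[OF gd]] by simp
    fix \<nu> assume \<nu>: "ac_stationary \<Lambda> S \<nu>"
    then have ac: "ac_prob \<nu>" by (simp add: ac_stationary_def)
    then obtain k where k: "is_density \<nu> k" using ac_prob_ex_density by blast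
    then have "P.fixed_density k" using \<nu> stationary_iff_fixed_density[OF k ac] by simp
    from P.fixed_density_unique[OF near h this g]
    show "\<nu> = density leb_I (\<lambda>x. ennreal (g x))"
      by (rule is_density_cong[OF k ac_prob_density(2)[OF gd]])
  qed
qed

end

lemma transfer_scale: "transfer T c (\<lambda>x. a * f x) x = a * transfer T c f x"
  by (simp add: transfer_def algebra_simps)

lemma random_transfer_scale:
  "random_transfer \<Lambda> S d (\<lambda>x. a * f x) x = a * random_transfer \<Lambda> S d f x"
  unfolding random_transfer_def transfer_scale by (rule set_integral_mult_right)

section \<open>Strong stochastic stability\<close>

theorem theorem20:
  fixes T :: "real \<Rightarrow> real" and c :: real
    and S :: "real \<Rightarrow> real \<Rightarrow> real" and d :: "real \<Rightarrow> real"
    and \<Lambda> :: "real \<Rightarrow> real measure"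
    and e \<epsilon>0 \<alpha> Ch \<gamma> \<kappa> D C :: real
    and u v w \<upsilon>' :: "real \<Rightarrow> real"
    and \<mu>\<^sub>T :: "real measure" and h :: "real \<Rightarrow> real"
  assumes e: "0 < e"
    and \<epsilon>0: "0 < \<epsilon>0" and \<alpha>: "0 < \<alpha>" "\<alpha> \<le> 1"
    and noise: "\<forall>\<epsilon>\<in>{0<..e}. noise (\<Lambda> \<epsilon>) \<epsilon>"
    and meas: "\<forall>\<epsilon>\<in>{0<..e}. \<forall>x\<in>I. (\<lambda>\<eta>. S \<eta> x) \<in> borel_measurable (\<Lambda> \<epsilon>)"
    and T: "cusp_map T c"
    and S: "\<forall>\<epsilon>\<in>{0<..e}. \<forall>\<eta>\<in>spt (\<Lambda> \<epsilon>). cusp_map (S \<eta>) (d \<eta>) \<and> (\<exists>\<mu>. ac_invariant (S \<eta>) \<mu>)"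
    and \<gamma>: "0 < \<gamma>" "\<gamma> \<le> 1"
    and holder_T: "holder_potential T c Ch \<gamma>"
    and holder_S: "\<forall>\<epsilon>\<in>{0<..e}. \<forall>\<eta>\<in>spt (\<Lambda> \<epsilon>). holder_potential (S \<eta>) (d \<eta>) Ch \<gamma>"
    and small: "small_fun e u" "small_fun e v" "small_fun e w"
    and close: "\<forall>\<epsilon>\<in>{0<..e}. \<forall>\<eta>\<in>spt (\<Lambda> \<epsilon>). horizontally_close T c (S \<eta>) (d \<eta>) (u \<epsilon>) (v \<epsilon>)"
    and \<kappa>: "0 < \<kappa>" "\<kappa> < 1" and D: "0 < D"
    and A1: "lasota_yorke \<epsilon>0 \<alpha> (transfer T c) \<kappa> D"
    and A2: "ac_invariant T \<mu>\<^sub>T" "\<forall>\<mu>. ac_invariant T \<mu> \<longrightarrow> \<mu> = \<mu>\<^sub>T" "is_density \<mu>\<^sub>T h"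
    and A3: "\<forall>\<epsilon>\<in>{0<..e}. lasota_yorke \<epsilon>0 \<alpha> (random_transfer (\<Lambda> \<epsilon>) S d) \<kappa> D"
    and A4: "\<upsilon>' \<in> borel_measurable borel" "\<forall>\<epsilon>. 0 \<le> \<upsilon>' \<epsilon>" "(\<upsilon>' \<longlongrightarrow> 0) (at_right 0)"
      "\<forall>\<epsilon>\<in>{0<..e}. mixed_norm \<epsilon>0 \<alpha> (\<lambda>f x. transfer T c f x - random_transfer (\<Lambda> \<epsilon>) S d f x)
                       \<le> ennreal (\<upsilon>' \<epsilon>)"
    and A5: "\<forall>\<epsilon>\<in>{0<..e}. \<exists>q::real \<Rightarrow> real \<Rightarrow> ennreal.
               case_prod q \<in> borel_measurable (leb_I \<Otimes>\<^sub>M lborel) \<and>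
               (AE x in leb_I. transition (\<Lambda> \<epsilon>) S x = density lborel (q x))"
    and A6: "\<forall>\<epsilon>\<in>{0<..e}. \<forall>x\<in>I. \<exists>r. 0 \<le> r \<and> r \<le> \<epsilon> \<and> spt (transition (\<Lambda> \<epsilon>) S x) = cball (T x) r \<inter> I"
    and A7: "0 < C"
      "\<forall>\<epsilon>\<in>{0<..e}. \<forall>\<eta>\<in>spt (\<Lambda> \<epsilon>).
         \<forall>x\<in>I - {c, d \<eta>} - ball c (real (cusp_ratio c (d \<eta>) \<eta>) * \<bar>\<eta>\<bar>).
           \<bar>DI (S \<eta>) x - DI T x\<bar> \<le> C * w \<epsilon>"
    and A8: "\<forall>\<epsilon>\<in>{0<..e}. \<forall>\<eta>\<in>spt (\<Lambda> \<epsilon>) - {0}. \<forall>j\<in>{1, 2}.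
               \<forall>x\<in>branch_dom c j \<inter> branch_dom (d \<eta>) j. x \<notin> {0, 1} \<longrightarrow> S \<eta> x \<noteq> T x"
  shows "strongly_stochastically_stable h \<Lambda> S"
proof -
  let ?L = "transfer T c" and ?P = "\<lambda>\<epsilon>. random_transfer (\<Lambda> \<epsilon>) S d"
  let ?fixed = "\<lambda>\<epsilon>. markov_operator.fixed_density leb_I (?P \<epsilon>)"
  have R: "random_cusp_maps (\<Lambda> \<epsilon>) S d T c" if "\<epsilon> \<in> {0<..e}" for \<epsilon>
  proof -
    have n: "noise (\<Lambda> \<epsilon>) \<epsilon>" by (rule bspec[OF noise that])
    then interpret prob_space "\<Lambda> \<epsilon>" by (simp add: noise_def)
    show ?thesis
    proof
      show "sets (\<Lambda> \<epsilon>) = sets borel" using n by (simp add: noise_def)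
      show "(\<lambda>\<eta>. S \<eta> x) \<in> borel_measurable (\<Lambda> \<epsilon>)" if "x \<in> I" for x
        by (rule bspec[OF bspec[OF meas \<open>\<epsilon> \<in> {0<..e}\<close>] that])
      show "cusp_map (S \<eta>) (d \<eta>)" if "\<eta> \<in> spt (\<Lambda> \<epsilon>)" for \<eta>
        using bspec[OF bspec[OF S \<open>\<epsilon> \<in> {0<..e}\<close>] that] by (rule conjunct1)
    qed (rule T)
  qed
  have P: "markov_operator leb_I (?P \<epsilon>)" if "\<epsilon> \<in> {0<..e}" for \<epsilon>
    by (rule random_cusp_maps.random_transfer_markov[OF R[OF that]])
  have LY: "lasota_yorke \<epsilon>0 \<alpha> (?P \<epsilon>) \<kappa> D" if "\<epsilon> \<in> {0<..e}" for \<epsilon>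
    by (rule bspec[OF A3 that])
  have L: "markov_operator leb_I ?L" by (rule transfer_markov[OF T])
  have "prob_space \<mu>\<^sub>T" using A2(1) by (simp add: ac_invariant_def ac_prob_def)
  note h = is_density_integral[OF A2(3) this]
  \<comment> \<open>A density fixed by \<open>L\<close> belongs to an invariant measure of \<open>T\<close>, which is \<open>\<mu>\<^sub>T\<close>.\<close>
  have unique: "AE x in leb_I. g x = h x" if g: "markov_operator.fixed_density leb_I ?L g" for g
  proof -
    have gd: "integrable leb_I g" "AE x in leb_I. 0 \<le> g x" "integral\<^sup>L leb_I g = 1"
      using g by (auto simp: markov_operator.fixed_density_def[OF L])
    have "density leb_I (\<lambda>x. ennreal (g x)) = \<mu>\<^sub>T"
      using A2(2) transfer_fixed_density_invariant[OF T g] by blast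
    then show ?thesis
      using is_density_unique[OF _ A2(3)] ac_prob_density(2)[OF gd] by simp
  qed
  have converge: "\<forall>\<^sub>F \<epsilon> in at_right 0. \<forall>g. ?fixed \<epsilon> g \<longrightarrow> L1_dist leb_I g h < \<delta>" if "0 < \<delta>" for \<delta>
  proof (rule fixed_densities_converge[OF e \<epsilon>0 \<alpha> \<kappa> D L P LY])
    show "?L (\<lambda>x. c * f x) x - ?P \<epsilon> (\<lambda>x. c * f x) x = c * (?L f x - ?P \<epsilon> f x)" for \<epsilon> c f x
      by (simp add: transfer_scale random_transfer_scale right_diff_distrib)
    show "mixed_norm \<epsilon>0 \<alpha> (\<lambda>f x. ?L f x - ?P \<epsilon> f x) \<le> ennreal (\<upsilon>' \<epsilon>)" if "\<epsilon> \<in> {0<..e}" for \<epsilon>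
      by (rule bspec[OF A4(4) that])
  qed (use A4 unique h(1) that in auto)
  have small_noise: "\<forall>\<^sub>F \<epsilon> in at_right 0. \<epsilon> \<in> {0<..e}"
    using e unfolding eventually_at_right_field by (intro exI[of _ e]) auto
  show ?thesis
    unfolding strongly_stochastically_stable_def
  proof (intro conjI allI impI)
    show "\<forall>\<^sub>F \<epsilon> in at_right 0. \<exists>!\<mu>. ac_stationary (\<Lambda> \<epsilon>) S \<mu>"
      using small_noise converge[of 1, OF zero_less_one]
    proof eventually_elim
      case (elim \<epsilon>)
      show ?case
        by (rule random_cusp_maps.ex1_stationary[OF R[OF elim(1)]
              ex_fixed_density[OF P[OF elim(1)] LY[OF elim(1)] \<epsilon>0 \<alpha> \<kappa> D] _ h(1)])
           (use elim(2) in blast)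
    qed
  next
    fix h\<^sub>\<epsilon> :: "real \<Rightarrow> real \<Rightarrow> real"
    assume "\<forall>\<^sub>F \<epsilon> in at_right 0. \<exists>\<mu>. ac_stationary (\<Lambda> \<epsilon>) S \<mu> \<and> is_density \<mu> (h\<^sub>\<epsilon> \<epsilon>)"
    then have fixed: "\<forall>\<^sub>F \<epsilon> in at_right 0. \<epsilon> \<in> {0<..e} \<and> ?fixed \<epsilon> (h\<^sub>\<epsilon> \<epsilon>)"
      using small_noise
    proof eventually_elim
      case (elim \<epsilon>)
      then obtain \<mu> where \<mu>: "ac_stationary (\<Lambda> \<epsilon>) S \<mu>" "is_density \<mu> (h\<^sub>\<epsilon> \<epsilon>)" by blast
      then have "ac_prob \<mu>" by (simp add: ac_stationary_def)
      then show ?case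
        using \<mu> elim(2) random_cusp_maps.stationary_iff_fixed_density[OF R[OF elim(2)] \<mu>(2)] by blast
    qed
    have "((\<lambda>\<epsilon>. L1_dist leb_I (h\<^sub>\<epsilon> \<epsilon>) h) \<longlongrightarrow> 0) (at_right 0)"
    proof (rule tendstoI)
      fix \<delta> :: real assume "0 < \<delta>"
      from converge[OF this] fixed
      show "\<forall>\<^sub>F \<epsilon> in at_right 0. dist (L1_dist leb_I (h\<^sub>\<epsilon> \<epsilon>) h) 0 < \<delta>"
        by eventually_elim simp
    qed
    then have "((\<lambda>\<epsilon>. ennreal (L1_dist leb_I (h\<^sub>\<epsilon> \<epsilon>) h)) \<longlongrightarrow> ennreal 0) (at_right 0)"
      by (rule tendsto_ennrealI)
    moreover have "\<forall>\<^sub>F \<epsilon> in at_right 0. ennreal (L1_dist leb_I (h\<^sub>\<epsilon> \<epsilon>) h) = L1_norm (\<lambda>x. h\<^sub>\<epsilon> \<epsilon> x - h x)"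
      using fixed
    proof eventually_elim
      case (elim \<epsilon>)
      then have "integrable leb_I (h\<^sub>\<epsilon> \<epsilon>)"
        using markov_operator.fixed_density_def[OF P] by blast
      then show ?case using h(1) by (simp add: L1_norm_eq L1_dist_def)
    qed
    ultimately show "((\<lambda>\<epsilon>. L1_norm (\<lambda>x. h\<^sub>\<epsilon> \<epsilon> x - h x)) \<longlongrightarrow> 0) (at_right 0)"
      using Lim_transform_eventually by fastforce
  qed
qed

end
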